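(* Let $V:\mathbb{S}^1\to\mathbb{R}$ be a $C^2$ function. For each $k$ let $\pi_{k,V}$ be the stationary probability of the continuous time Gibbs Markov chain on $\Gamma_k$ associated to $kV_k$, let $\mathbb{P}^{kV_k}_{\pi_{k,V}}$ be the law of this chain started from $\pi_{k,V}$, and let $\mathbb{P}_{\pi_{k,V}}$ be the law of the unperturbed chain with generator $kL_k$ started from $\pi_{k,V}$. Let $$H(\mathbb{P}^{kV_k}_{\pi_{k,V}}|\mathbb{P}_{\pi_{k,V}})=\lim_{T\to\infty}\frac1T\Big(-\int\log\Big(\frac{d\mathbb{P}^{kV_k}_{\pi_{k,V}}}{d\mathbb{P}_{\pi_{k,V}}}\Big|_{\mathcal{F}_T}\Big)\,d\mathbb{P}^{kV_k}_{\pi_{k,V}}\Big)$$ be the entropy of the Gibbs state. Then for every $k$, $$H(\mathbb{P}^{kV_k}_{\pi_{k,V}}|\mathbb{P}_{\pi_{k,V}})=\int kV_k\,d\pi_{k,V}-\lambda_k.$$ Moreover, if the maximum of $V$ is attained at a unique point $x_0$ (so that the Mather measure is the Dirac delta at $x_0$), then the limit entropy is zero: $$H(V)=\lim_{k\to\infty}\frac1kH(\mathbb{P}^{kV_k}_{\pi_{k,V}}|\mathbb{P}_{\pi_{k,V}})=\lim_{k\to\infty}\int V_k\,d\pi_{k,V}-\lim_{k\to\infty}\frac1k\lambda_k=V(x_0)-c(L)=0,$$ where $c(L)=\sup\{V(x)\mid x\in\mathbb{S}^1\}$.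
   Context: $\mathbb{S}^1$ is the unit circle identified with $[0,1)$, and $\Gamma_k=\{0,1/k,\dots,(k-1)/k\}$, with indices mod $k$. $L_k$ acts on $f:\Gamma_k\to\mathbb{R}$ by $(L_kf)(\frac jk)=f(\frac{j+1}k)+f(\frac{j-1}k)-2f(\frac jk)$, so $kL_k$ generates the chain jumping to each neighbour at rate $k$. $V_k$ is the restriction of $V$ to $\Gamma_k$, and $kV_k$ is also viewed as a diagonal matrix. By the continuous time Perron theorem there are a real $\lambda_k$, a unique positive function $u_k$ on $\Gamma_k$ and a unique probability vector $\mu_k$ on $\Gamma_k$ such that $\sum_ju_k(j/k)\mu_k(j/k)=1$, $(kL_k+kV_k)u_k=\lambda_ku_k$, and $\lim_{t\to\infty}e^{-t\lambda_k}e^{t(kL_k+kV_k)}v=\big(\sum_jv(j/k)\mu_k(j/k)\big)u_k$ for every $v:\Gamma_k\to\mathbb{R}$. The Gibbs Markov chain associated to $kV_k$ is the chain that jumps from $x$ to a neighbour $y$ at rate $k\,u_k(y)/u_k(x)$; its stationary probability is $\pi_{k,V}(j/k)=u_k(j/k)\mu_k(j/k)$. Laws are taken on the Skorohod space of càdlàg paths with values in $\Gamma_k$, and $\mathcal{F}_T$ is the sigma-algebra generated by the path up to time $T$. The Mather measure is the probability attaining the infimum $\inf_\mu\int L^V\,d\mu$ over invariant probabilities $\mu$ of the Euler–Lagrange flow of $L^V(x,v)=-V(x)+v\log\big((v+\sqrt{v^2+4})/2\big)-\sqrt{v^2+4}+2$, viewed as a probability on $\mathbb{S}^1$, and $c(L)$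 is minus this infimum.
   Formalization: The sign in the first identity is corrected: with the entropy defined with its leading minus sign, the proved formula is H = λ_k − ∫ kV_k dπ_{k,V}, since the printed right-hand side has the opposite sign and fails (for example k=2, V_2=(2,0)). *)

theory Defs
  imports "HOL-Probability.Probability"
begin

text \<open>
  Points of the circle are represented by \<open>{0..<1}\<close>, functions on the circle by 1-periodic
  functions on the reals. Functions on the grid \<open>\<Gamma>\<^sub>k\<close> are functions on the reals of
  which only the values at grid points matter.
\<close>

definition C2_on_circle :: "(real \<Rightarrow> real) \<Rightarrow> bool" where
  "C2_on_circle V \<longleftrightarrow> (\<forall>x. V (x + 1) = V x) \<and>
     (\<exists>V' V''. (\<forall>x. (V has_real_derivative V' x) (at x)) \<and>
               (\<forall>x. (V' has_real_derivative V'' x) (at x)) \<and>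
               continuous_on UNIV V'')"

definition grid :: "nat \<Rightarrow> real set" where
  "grid k = (\<lambda>j. real j / real k) ` {..<k}"

definition next_site :: "nat \<Rightarrow> real \<Rightarrow> real" where
  "next_site k x = frac (x + 1 / real k)"

definition prev_site :: "nat \<Rightarrow> real \<Rightarrow> real" where
  "prev_site k x = frac (x - 1 / real k)"

definition prob_vector :: "nat \<Rightarrow> (real \<Rightarrow> real) \<Rightarrow> bool" where
  "prob_vector k p \<longleftrightarrow> (\<forall>x\<in>grid k. 0 \<le> p x) \<and> (\<Sum>x\<in>grid k. p x) = 1"

definition discrete_laplacian :: "nat \<Rightarrow> (real \<Rightarrow> real) \<Rightarrow> real \<Rightarrow> real" where
  "discrete_laplacian k f x = f (next_site k x) + f (prev_site k x) - 2 * f x"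

definition free_generator :: "nat \<Rightarrow> (real \<Rightarrow> real) \<Rightarrow> real \<Rightarrow> real" where
  "free_generator k f x = real k * discrete_laplacian k f x"

definition perturbed_operator ::
    "nat \<Rightarrow> (real \<Rightarrow> real) \<Rightarrow> (real \<Rightarrow> real) \<Rightarrow> real \<Rightarrow> real" where
  "perturbed_operator k V f x = real k * discrete_laplacian k f x + real k * V x * f x"

definition op_exp ::
    "((real \<Rightarrow> real) \<Rightarrow> real \<Rightarrow> real) \<Rightarrow> real \<Rightarrow> (real \<Rightarrow> real) \<Rightarrow> real \<Rightarrow> real" where
  "op_exp A t v x = (\<Sum>n. t ^ n / fact n * (A ^^ n) v x)"

definition perron_triple ::
    "nat \<Rightarrow> (real \<Rightarrow> real) \<Rightarrow> real \<Rightarrow> (real \<Rightarrow> real) \<Rightarrow> (real \<Rightarrow> real) \<Rightarrow> bool" where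
  "perron_triple k V lam u \<mu> \<longleftrightarrow>
     (\<forall>x\<in>grid k. 0 < u x) \<and> prob_vector k \<mu> \<and> (\<Sum>x\<in>grid k. u x * \<mu> x) = 1 \<and>
     (\<forall>x\<in>grid k. perturbed_operator k V u x = lam * u x) \<and>
     (\<forall>v. \<forall>x\<in>grid k.
        ((\<lambda>t. exp (- t * lam) * op_exp (perturbed_operator k V) t v x)
           \<longlongrightarrow> (\<Sum>y\<in>grid k. v y * \<mu> y) * u x) at_top)"

text \<open>For \<open>k = 2\<close> the two neighbours of a site coincide and the two rates add up, as they do
  in \<open>free_generator\<close>.\<close>

definition gibbs_generator ::
    "nat \<Rightarrow> (real \<Rightarrow> real) \<Rightarrow> (real \<Rightarrow> real) \<Rightarrow> real \<Rightarrow> real" where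
  "gibbs_generator k u f x =
     real k * u (next_site k x) / u x * (f (next_site k x) - f x) +
     real k * u (prev_site k x) / u x * (f (prev_site k x) - f x)"

definition stationary_prob ::
    "nat \<Rightarrow> ((real \<Rightarrow> real) \<Rightarrow> real \<Rightarrow> real) \<Rightarrow> (real \<Rightarrow> real) \<Rightarrow> bool" where
  "stationary_prob k G p \<longleftrightarrow> prob_vector k p \<and> (\<forall>f. (\<Sum>x\<in>grid k. p x * G f x) = 0)"

definition cadlag_paths :: "nat \<Rightarrow> (real \<Rightarrow> real) set" where
  "cadlag_paths k = {\<omega> \<in> {0..} \<rightarrow>\<^sub>E grid k.
     (\<forall>t\<ge>0. (\<omega> \<longlongrightarrow> \<omega> t) (at_right t)) \<and> (\<forall>t>0. \<exists>l. (\<omega> \<longlongrightarrow> l) (at_left t))}"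

definition path_sigma_upto :: "nat \<Rightarrow> real \<Rightarrow> (real \<Rightarrow> real) measure" where
  "path_sigma_upto k T =
     sigma (cadlag_paths k) {{\<omega> \<in> cadlag_paths k. \<omega> s = x} | s x. 0 \<le> s \<and> s \<le> T \<and> x \<in> grid k}"

text \<open>The Borel sets of the Skorohod topology are exactly the sets in the sigma-algebra generated
  by the coordinate maps.\<close>

definition skorohod_space :: "nat \<Rightarrow> (real \<Rightarrow> real) measure" where
  "skorohod_space k =
     sigma (cadlag_paths k) {{\<omega> \<in> cadlag_paths k. \<omega> s = x} | s x. 0 \<le> s \<and> x \<in> grid k}"

definition chain_law ::
    "nat \<Rightarrow> ((real \<Rightarrow> real) \<Rightarrow> real \<Rightarrow> real) \<Rightarrow> (real \<Rightarrow> real) \<Rightarrow> (real \<Rightarrow> real) measure \<Rightarrow> bool" where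
  "chain_law k G p P \<longleftrightarrow> prob_space P \<and> sets P = sets (skorohod_space k) \<and>
     (\<forall>n (t :: nat \<Rightarrow> real) x.
        t 0 = 0 \<longrightarrow> (\<forall>i<n. t i \<le> t (Suc i)) \<longrightarrow> (\<forall>i\<le>n. x i \<in> grid k) \<longrightarrow>
        measure P {\<omega> \<in> space P. \<forall>i\<le>n. \<omega> (t i) = x i} =
          p (x 0) * (\<Prod>i<n. op_exp G (t (Suc i) - t i) (indicator {x (Suc i)}) (x i)))"

definition density_upto ::
    "nat \<Rightarrow> (real \<Rightarrow> real) measure \<Rightarrow> (real \<Rightarrow> real) measure \<Rightarrow> real \<Rightarrow> (real \<Rightarrow> real) \<Rightarrow> real" where
  "density_upto k Q P T \<omega> =
     enn2real (RN_deriv (restr_to_subalg P (path_sigma_upto k T))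
                        (restr_to_subalg Q (path_sigma_upto k T)) \<omega>)"

definition entropy_upto ::
    "nat \<Rightarrow> (real \<Rightarrow> real) measure \<Rightarrow> (real \<Rightarrow> real) measure \<Rightarrow> real \<Rightarrow> real" where
  "entropy_upto k Q P T = - (\<integral>\<omega>. ln (density_upto k Q P T \<omega>) \<partial>Q)"

text \<open>With the minus sign in \<open>entropy_upto\<close>, this entropy is minus a relative entropy rate, hence
  never positive.\<close>

definition gibbs_entropy ::
    "nat \<Rightarrow> (real \<Rightarrow> real) measure \<Rightarrow> (real \<Rightarrow> real) measure \<Rightarrow> real" where
  "gibbs_entropy k Q P = Lim at_top (\<lambda>T. 1 / T * entropy_upto k Q P T)"

definition lagrangian :: "(real \<Rightarrow> real) \<Rightarrow> real \<Rightarrow> real \<Rightarrow> real" where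
  "lagrangian V x v = - V x + v * ln ((v + sqrt (v\<^sup>2 + 4)) / 2) - sqrt (v\<^sup>2 + 4) + 2"

definition circle :: "real measure" where
  "circle = restrict_space borel {0..<1}"

definition tangent_circle :: "(real \<times> real) measure" where
  "tangent_circle = restrict_space borel ({0..<1} \<times> UNIV)"

text \<open>In \<open>euler_lagrange_flow\<close> the curve \<open>\<gamma>\<close> is the lift to the line of an extremal on the
  circle, and \<open>\<gamma>'\<close> its velocity.\<close>

definition euler_lagrange :: "(real \<Rightarrow> real) \<Rightarrow> (real \<Rightarrow> real) \<Rightarrow> (real \<Rightarrow> real) \<Rightarrow> bool" where
  "euler_lagrange V \<gamma> \<gamma>' \<longleftrightarrow> (\<forall>t. (\<gamma> has_real_derivative \<gamma>' t) (at t)) \<and>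
     (\<forall>t. ((\<lambda>s. deriv (\<lambda>v. lagrangian V (\<gamma> s) v) (\<gamma>' s)) has_real_derivative
             deriv (\<lambda>x. lagrangian V x (\<gamma>' t)) (\<gamma> t)) (at t))"

definition euler_lagrange_flow ::
    "(real \<Rightarrow> real) \<Rightarrow> (real \<Rightarrow> real \<times> real \<Rightarrow> real \<times> real) \<Rightarrow> bool" where
  "euler_lagrange_flow V \<Phi> \<longleftrightarrow> (\<forall>t. \<Phi> t \<in> measurable tangent_circle tangent_circle) \<and>
     (\<forall>z\<in>space tangent_circle. \<exists>\<gamma> \<gamma>'. euler_lagrange V \<gamma> \<gamma>' \<and> (\<gamma> 0, \<gamma>' 0) = z \<and>
        (\<forall>t. \<Phi> t z = (frac (\<gamma> t), \<gamma>' t)))"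

definition invariant_prob ::
    "(real \<Rightarrow> real \<times> real \<Rightarrow> real \<times> real) \<Rightarrow> (real \<times> real) measure \<Rightarrow> bool" where
  "invariant_prob \<Phi> m \<longleftrightarrow> prob_space m \<and> sets m = sets tangent_circle \<and>
     (\<forall>t. distr m tangent_circle (\<Phi> t) = m)"

definition action :: "(real \<Rightarrow> real) \<Rightarrow> (real \<times> real) measure \<Rightarrow> real" where
  "action V m = (\<integral>z. lagrangian V (fst z) (snd z) \<partial>m)"

text \<open>The Lagrangian is bounded below, so the action of an invariant probability is a real number
  or infinity. The latter case does not affect the infimum and is left out, because the Bochner
  integral would then be \<open>0\<close>.\<close>

definition finite_action_prob ::
    "(real \<Rightarrow> real) \<Rightarrow> (real \<Rightarrow> real \<times> real \<Rightarrow> real \<times> real) \<Rightarrow> (real \<times> real) measure \<Rightarrow> bool" where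
  "finite_action_prob V \<Phi> m \<longleftrightarrow> invariant_prob \<Phi> m \<and>
     integrable m (\<lambda>z. lagrangian V (fst z) (snd z))"

definition critical_value ::
    "(real \<Rightarrow> real) \<Rightarrow> (real \<Rightarrow> real \<times> real \<Rightarrow> real \<times> real) \<Rightarrow> real" where
  "critical_value V \<Phi> = - Inf {action V m | m. finite_action_prob V \<Phi> m}"

definition minimizing_prob ::
    "(real \<Rightarrow> real) \<Rightarrow> (real \<Rightarrow> real \<times> real \<Rightarrow> real \<times> real) \<Rightarrow> (real \<times> real) measure \<Rightarrow> bool" where
  "minimizing_prob V \<Phi> m \<longleftrightarrow> finite_action_prob V \<Phi> m \<and>
     action V m = Inf {action V m' | m'. finite_action_prob V \<Phi> m'}"

definition mather_measure ::
    "(real \<Rightarrow> real) \<Rightarrow> (real \<Rightarrow> real \<times> real \<Rightarrow> real \<times> real) \<Rightarrow> real measure \<Rightarrow> bool" where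
  "mather_measure V \<Phi> \<nu> \<longleftrightarrow> (\<exists>m. minimizing_prob V \<Phi> m \<and> \<nu> = distr m circle fst)"

end

theory Submission
  imports Defs
begin

text \<open>
  Conjugating \<open>k L + k V - \<lambda>\<close> with its positive eigenfunction \<open>u\<close> gives the generator of the Gibbs chain.
  On path space this says that, on events up to time \<open>T\<close>, the Gibbs law has the density
  \<open>u(X\<^sub>T) / u(X\<^sub>0) exp (\<integral>\<^sub>0\<^sup>T (k V(X\<^sub>s) - \<lambda>) ds)\<close> with respect to the law of the free chain
  (\<open>restricted_law_eq_density\<close>). Both laws are determined by their values on cylinder events
  (\<open>path_measure_eqI\<close>), and these are compared one observation time after another
  (\<open>cylinder_weight\<close>) by means of the Feynman-Kac formula (\<open>feynman_kac\<close>). The latter is exact for Riemann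
  sums, by the Markov property, and passes to the limit by the Trotter product formula (\<open>trotter\<close>) and
  dominated convergence. The logarithm of the density is bounded; by stationarity the two boundary terms
  cancel in the mean, so its expectation is \<open>T (\<integral> k V d\<pi> - \<lambda>)\<close> for every \<open>T\<close>
  (\<open>ln_density_integral\<close>), and the entropy rate follows with the opposite sign.

  For the limit \<open>k \<rightarrow> \<infinity>\<close> all terms are squeezed:
  \<open>max V - \<epsilon> - 2 / n \<le> \<lambda> / k \<le> \<integral> V d\<pi> \<le> max V\<close>. The first inequality holds for large \<open>k\<close> and comes from a
  parabola on \<open>n\<close> consecutive sites near the maximum point as test function (\<open>eigenvalue_ge\<close>). The second is
  the nonnegativity of the relative entropy rate (\<open>eigenvalue_le_mean\<close>), for which stationarity of \<open>\<pi>\<close> is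
  applied to \<open>ln u\<close>.

  The Lagrangian is \<open>- V(x)\<close> plus a nonnegative function of \<open>v\<close> that vanishes only at \<open>v = 0\<close>. Hence the
  action of a probability is at least \<open>- V(x\<^sub>0)\<close>, with equality only for the Dirac mass at \<open>(x\<^sub>0, 0)\<close>. This
  Dirac mass is invariant because the maximum point is an equilibrium of the Euler-Lagrange flow
  (\<open>equilibrium_at_maximum\<close>), which follows from conservation of energy and Gronwall's inequality. So the
  critical value is \<open>V(x\<^sub>0)\<close>, the common limit above.
\<close>

section \<open>Nearest-neighbour operators on the grid\<close>

lemma finite_grid [simp, intro]: "finite (grid k)"
  by (simp add: grid_def)

lemma grid_nonempty: "k \<ge> 1 \<Longrightarrow> grid k \<noteq> {}"
  by (auto simp: grid_def lessThan_empty_iff)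

lemma zero_in_grid: "k \<ge> 1 \<Longrightarrow> 0 \<in> grid k"
  by (force simp: grid_def)

text \<open>Indexing the sites by all integers turns the two neighbour maps into shifts, without any
  wrap-around.\<close>

lemma frac_in_grid:
  assumes "k \<ge> 1"
  shows "frac (real_of_int i / real k) \<in> grid k"
proof -
  have "i = int k * (i div int k) + i mod int k" by simp
  then have "real_of_int i / real k = real_of_int (i div int k) + real_of_int (i mod int k) / real k"
    using assms by (metis (no_types, opaque_lifting) add_divide_distrib nonzero_mult_div_cancel_left of_int_add of_int_mult
        of_int_of_nat_eq of_nat_0_eq_iff not_one_le_zero)
  moreover have "frac (real_of_int (i mod int k) / real k) = real_of_int (i mod int k) / real k"
  proof -
    have "0 \<le> i mod int k" "i mod int k < int k" using assms by auto
    then have "0 \<le> real_of_int (i mod int k)" "real_of_int (i mod int k) < real k"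
      by (linarith, metis of_int_less_iff of_int_of_nat_eq)
    then show ?thesis using assms by (simp add: frac_eq)
  qed
  ultimately have "frac (real_of_int i / real k) = real (nat (i mod int k)) / real k"
    using assms by (simp add: add.commute)
  moreover have "nat (i mod int k) < k"
    using assms by (simp add: nat_less_iff)
  ultimately show ?thesis unfolding grid_def by (metis image_eqI lessThan_iff)
qed

lemma next_site_frac: "next_site k (frac (real_of_int i / real k)) = frac (real_of_int (i + 1) / real k)"
proof -
  have "frac (real_of_int i / real k) + 1 / real k
      = real_of_int (i + 1) / real k + real_of_int (- \<lfloor>real_of_int i / real k\<rfloor>)"
    by (simp add: frac_def add_divide_distrib)
  then show ?thesis unfolding next_site_def by (metis frac_add_of_int_right)
qed

lemma prev_site_frac: "prev_site k (frac (real_of_int i / real k)) = frac (real_of_int (i - 1) / real k)"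
proof -
  have "frac (real_of_int i / real k) - 1 / real k
      = real_of_int (i - 1) / real k + real_of_int (- \<lfloor>real_of_int i / real k\<rfloor>)"
    by (simp add: frac_def diff_divide_distrib)
  then show ?thesis unfolding prev_site_def by (metis frac_add_of_int_right)
qed

lemma grid_frac:
  assumes "x \<in> grid k"
  obtains i where "x = frac (real_of_int i / real k)"
proof -
  obtain j where j: "j < k" "x = real j / real k" using assms by (auto simp: grid_def)
  have "x = frac (real_of_int (int j) / real k)" using j by (simp add: frac_eq)
  then show ?thesis using that by blast
qed

lemma next_site_in_grid: "k \<ge> 1 \<Longrightarrow> x \<in> grid k \<Longrightarrow> next_site k x \<in> grid k"
  by (metis grid_frac next_site_frac frac_in_grid)

lemma prev_site_in_grid: "k \<ge> 1 \<Longrightarrow> x \<in> grid k \<Longrightarrow> prev_site k x \<in> grid k"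
  by (metis grid_frac prev_site_frac frac_in_grid)

lemma bounded_on_grid: obtains c where "0 \<le> c" "\<And>x. x \<in> grid k \<Longrightarrow> \<bar>f x\<bar> \<le> (c::real)"
proof
  show "0 \<le> (\<Sum>x\<in>grid k. \<bar>f x\<bar>)" by (simp add: sum_nonneg)
  show "\<bar>f x\<bar> \<le> (\<Sum>x\<in>grid k. \<bar>f x\<bar>)" if "x \<in> grid k" for x
    using that by (intro member_le_sum) auto
qed

text \<open>One Lie splitting step for \<open>A + W\<close>. This product form is what the Markov property produces when
  the integral of \<open>W\<close> along a path is replaced by a Riemann sum with right end points.\<close>

definition splitting_step ::
    "((real \<Rightarrow> real) \<Rightarrow> real \<Rightarrow> real) \<Rightarrow> (real \<Rightarrow> real) \<Rightarrow> real \<Rightarrow> (real \<Rightarrow> real) \<Rightarrow> real \<Rightarrow> real" where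
  "splitting_step A W d f = op_exp A d (\<lambda>y. exp (d * W y) * f y)"

text \<open>The free, the perturbed and the Gibbs generators all have this form; only \<open>a\<close>, \<open>b\<close>, \<open>c\<close> differ.
  As \<open>A f x\<close> involves three values of \<open>f\<close>, the operator commutes with convergent series, and
  \<open>M\<close> bounds its norm for the maximum norm on the grid.\<close>

locale nearest_neighbour =
  fixes k :: nat and A :: "(real \<Rightarrow> real) \<Rightarrow> real \<Rightarrow> real" and a b c :: "real \<Rightarrow> real" and M :: real
  assumes k: "k \<ge> 1"
    and A_eq: "A f x = a x * f (next_site k x) + b x * f (prev_site k x) + c x * f x"
    and M: "x \<in> grid k \<Longrightarrow> \<bar>a x\<bar> + \<bar>b x\<bar> + \<bar>c x\<bar> \<le> M"
begin

lemma M_nonneg: "0 \<le> M"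
  using M[OF zero_in_grid[OF k]] by linarith

lemma bound:
  assumes "\<And>y. y \<in> grid k \<Longrightarrow> \<bar>v y\<bar> \<le> B" "x \<in> grid k"
  shows "\<bar>A v x\<bar> \<le> M * B"
proof -
  have B: "\<bar>v x\<bar> \<le> B" "\<bar>v (next_site k x)\<bar> \<le> B" "\<bar>v (prev_site k x)\<bar> \<le> B"
    using assms k next_site_in_grid prev_site_in_grid by auto
  have "\<bar>A v x\<bar> \<le> \<bar>a x\<bar> * \<bar>v (next_site k x)\<bar> + \<bar>b x\<bar> * \<bar>v (prev_site k x)\<bar> + \<bar>c x\<bar> * \<bar>v x\<bar>"
    unfolding A_eq by (simp flip: abs_mult)
  also have "\<dots> \<le> \<bar>a x\<bar> * B + \<bar>b x\<bar> * B + \<bar>c x\<bar> * B"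
    using B by (intro add_mono mult_left_mono) auto
  also have "\<dots> = (\<bar>a x\<bar> + \<bar>b x\<bar> + \<bar>c x\<bar>) * B" by (simp add: algebra_simps)
  also have "\<dots> \<le> M * B" using M[OF assms(2)] B by (intro mult_right_mono) auto
  finally show ?thesis .
qed

lemma power_bound:
  assumes "\<And>y. y \<in> grid k \<Longrightarrow> \<bar>v y\<bar> \<le> B" "x \<in> grid k"
  shows "\<bar>(A ^^ n) v x\<bar> \<le> M ^ n * B"
  using assms(2)
proof (induction n arbitrary: x)
  case (Suc n)
  then show ?case using bound[of "(A ^^ n) v" "M ^ n * B" x] by (simp add: mult.assoc)
qed (use assms in auto)

lemma power_term_bound:
  assumes "\<And>y. y \<in> grid k \<Longrightarrow> \<bar>v y\<bar> \<le> B" "x \<in> grid k"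
  shows "\<bar>t ^ n / fact n * (A ^^ n) v x\<bar> \<le> B * ((\<bar>t\<bar> * M) ^ n /\<^sub>R fact n)"
  using mult_left_mono[OF power_bound[OF assms, where n = n], where c = "\<bar>t\<bar> ^ n / fact n"]
  by (simp add: abs_mult power_abs power_mult_distrib field_simps scaleR_conv_of_real)

lemma summable_abs_op_exp:
  assumes "x \<in> grid k"
  shows "summable (\<lambda>n. \<bar>t ^ n / fact n * (A ^^ n) v x\<bar>)"
proof -
  obtain B where "\<And>y. y \<in> grid k \<Longrightarrow> \<bar>v y\<bar> \<le> B" using bounded_on_grid[of k v] by blast
  from power_term_bound[OF this assms] show ?thesis
    by (intro summable_comparison_test'[OF summable_mult[OF summable_exp_generic[of "\<bar>t\<bar> * M"]]]) auto
qed

lemma summable_op_exp: "x \<in> grid k \<Longrightarrow> summable (\<lambda>n. t ^ n / fact n * (A ^^ n) v x)"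
  by (rule summable_rabs_cancel[OF summable_abs_op_exp])

lemma op_exp_bound:
  assumes "\<And>y. y \<in> grid k \<Longrightarrow> \<bar>v y\<bar> \<le> B" "x \<in> grid k"
  shows "\<bar>op_exp A t v x\<bar> \<le> B * exp (\<bar>t\<bar> * M)"
proof -
  have "\<bar>op_exp A t v x\<bar> \<le> (\<Sum>n. \<bar>t ^ n / fact n * (A ^^ n) v x\<bar>)"
    unfolding op_exp_def using summable_rabs[OF summable_abs_op_exp[OF assms(2)]] by simp
  also have "\<dots> \<le> (\<Sum>n. B * ((\<bar>t\<bar> * M) ^ n /\<^sub>R fact n))"
    using power_term_bound[OF assms] assms
    by (intro suminf_le summable_abs_op_exp summable_mult summable_exp_generic) auto
  also have "\<dots> = B * exp (\<bar>t\<bar> * M)"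
    unfolding exp_def by (intro suminf_mult summable_exp_generic)
  finally show ?thesis .
qed

lemma op_exp_0 [simp]: "op_exp A 0 v x = v x"
proof -
  have "op_exp A 0 v x = (\<Sum>n. if n = 0 then v x else 0)"
    unfolding op_exp_def by (intro suminf_cong) auto
  then show ?thesis using suminf_finite[of "{0::nat}" "\<lambda>n. if n = 0 then v x else 0"] by simp
qed

lemma op_exp_commute:
  assumes "x \<in> grid k"
  shows "op_exp A t (A v) x = A (op_exp A t v) x"
proof -
  have n: "next_site k x \<in> grid k" "prev_site k x \<in> grid k"
    using assms k next_site_in_grid prev_site_in_grid by auto
  have "A (op_exp A t v) x = (\<Sum>n. a x * (t ^ n / fact n * (A ^^ n) v (next_site k x))
        + b x * (t ^ n / fact n * (A ^^ n) v (prev_site k x))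
        + c x * (t ^ n / fact n * (A ^^ n) v x))"
    unfolding A_eq[of "op_exp A t v"] op_exp_def
    using summable_op_exp[OF assms, of t v] summable_op_exp[OF n(1), of t v] summable_op_exp[OF n(2), of t v]
    by (simp only: suminf_mult[symmetric] suminf_add summable_mult summable_add)
  also have "\<dots> = op_exp A t (A v) x"
    unfolding op_exp_def funpow_swap1[symmetric, where f = A] A_eq[of "(A ^^ _) v"]
    by (intro suminf_cong) (simp add: algebra_simps)
  finally show ?thesis ..
qed

lemma op_exp_deriv:
  assumes "x \<in> grid k"
  shows "((\<lambda>t. op_exp A t v x) has_real_derivative op_exp A t (A v) x) (at t)"
proof -
  have s: "summable (\<lambda>n. (A ^^ n) v x / fact n * y ^ n)" for y
    using summable_op_exp[OF assms, of y v] by (simp add: mult.commute)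
  have "diffs (\<lambda>n. (A ^^ n) v x / fact n) n = (A ^^ n) (A v) x / fact n" for n
    by (simp add: diffs_def funpow_swap1 divide_simps del: of_nat_Suc)
  with termdiffs_strong_converges_everywhere[OF s, of t] show ?thesis
    by (simp add: op_exp_def mult.commute)
qed

text \<open>This bound on the second derivative of the exponential at an arbitrary time \<open>r\<close> does the work of
  the semigroup law in the splitting estimate below, so no double series has to be rearranged.\<close>

lemma op_exp_taylor:
  assumes v: "\<And>y. y \<in> grid k \<Longrightarrow> \<bar>v y\<bar> \<le> B" and x: "x \<in> grid k" and "0 \<le> r" "0 \<le> d"
  shows "\<bar>op_exp A (r + d) v x - op_exp A r v x - d * A (op_exp A r v) x\<bar>
           \<le> d\<^sup>2 * M\<^sup>2 * B * exp ((r + d) * M)"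
proof (cases "d = 0")
  case False
  then have d: "d > 0" using assms by simp
  have "\<exists>z>r. z < r + d \<and> op_exp A (r + d) v x - op_exp A r v x = (r + d - r) * op_exp A z (A v) x"
    using d by (intro MVT2 op_exp_deriv x) auto
  then obtain z where z: "r < z" "z < r + d"
    "op_exp A (r + d) v x - op_exp A r v x = d * op_exp A z (A v) x" by auto
  have "\<exists>y>r. y < z \<and> op_exp A z (A v) x - op_exp A r (A v) x = (z - r) * op_exp A y (A (A v)) x"
    using z by (intro MVT2 op_exp_deriv x) auto
  then obtain y where y: "r < y" "y < z"
    "op_exp A z (A v) x - op_exp A r (A v) x = (z - r) * op_exp A y (A (A v)) x" by auto
  have B: "0 \<le> B" using v[OF x] by linarith
  have "\<bar>A (A v) w\<bar> \<le> M\<^sup>2 * B" if "w \<in> grid k" for w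
    using power_bound[OF v that, where n = 2] by (simp add: numeral_2_eq_2)
  then have "\<bar>op_exp A y (A (A v)) x\<bar> \<le> M\<^sup>2 * B * exp (\<bar>y\<bar> * M)"
    by (intro op_exp_bound x)
  also have "\<dots> \<le> M\<^sup>2 * B * exp ((r + d) * M)"
    using y z B M_nonneg \<open>0 \<le> r\<close> by (intro mult_left_mono iffD2[OF exp_le_cancel_iff] mult_right_mono) auto
  finally have "\<bar>d * ((z - r) * op_exp A y (A (A v)) x)\<bar> \<le> d * (d * (M\<^sup>2 * B * exp ((r + d) * M)))"
    using z d unfolding abs_mult by (intro mult_mono) auto
  moreover have "op_exp A (r + d) v x - op_exp A r v x - d * A (op_exp A r v) x
      = d * ((z - r) * op_exp A y (A (A v)) x)"
    unfolding y(3)[symmetric] z(3) op_exp_commute[OF x, of r v] by (simp add: algebra_simps)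
  ultimately show ?thesis by (simp add: power2_eq_square algebra_simps)
qed auto

lemma power_indicator_expansion:
  assumes "x \<in> grid k"
  shows "(A ^^ n) v x = (\<Sum>y\<in>grid k. v y * (A ^^ n) (indicator {y}) x)"
  using assms
proof (induction n arbitrary: x)
  case 0
  then show ?case by (simp add: indicator_def if_distrib cong: if_cong)
next
  case (Suc n)
  note n = next_site_in_grid[OF k Suc.prems] prev_site_in_grid[OF k Suc.prems]
  show ?case
    by (simp add: A_eq[of "(A ^^ n) _"] Suc.IH[of "next_site k x"] Suc.IH[of "prev_site k x"] Suc.IH[of x]
        Suc.prems n sum_distrib_left sum.distrib[symmetric] algebra_simps)
qed

lemma op_exp_indicator_expansion:
  assumes "x \<in> grid k"
  shows "op_exp A t v x = (\<Sum>y\<in>grid k. v y * op_exp A t (indicator {y}) x)"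
proof -
  have "op_exp A t v x = (\<Sum>n. \<Sum>y\<in>grid k. v y * (t ^ n / fact n * (A ^^ n) (indicator {y}) x))"
    unfolding op_exp_def
    by (intro suminf_cong) (simp add: power_indicator_expansion[OF assms, of _ v] sum_distrib_left algebra_simps)
  also have "\<dots> = (\<Sum>y\<in>grid k. \<Sum>n. v y * (t ^ n / fact n * (A ^^ n) (indicator {y}) x))"
    by (intro suminf_sum summable_mult summable_op_exp assms)
  also have "\<dots> = (\<Sum>y\<in>grid k. v y * op_exp A t (indicator {y}) x)"
    unfolding op_exp_def by (intro sum.cong refl suminf_mult summable_op_exp assms)
  finally show ?thesis .
qed

lemma op_exp_diff:
  assumes "x \<in> grid k"
  shows "op_exp A t (\<lambda>y. v y - w y) x = op_exp A t v x - op_exp A t w x"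
  unfolding op_exp_indicator_expansion[OF assms, of t "\<lambda>y. v y - w y"]
    op_exp_indicator_expansion[OF assms, of t v] op_exp_indicator_expansion[OF assms, of t w]
  by (simp add: algebra_simps sum_subtractf)

lemma potential_bound:
  assumes W: "\<And>y. y \<in> grid k \<Longrightarrow> \<bar>W y\<bar> \<le> w" and f: "\<And>y. y \<in> grid k \<Longrightarrow> \<bar>f y\<bar> \<le> B"
    and y: "y \<in> grid k" and d: "0 \<le> (d::real)"
  shows "\<bar>exp (d * W y) * f y\<bar> \<le> B * exp (d * w)"
proof -
  have "W y \<le> w" using W[OF y] by linarith
  then have "exp (d * W y) * \<bar>f y\<bar> \<le> exp (d * w) * B"
    using d f[OF y] by (intro mult_mono) (auto intro: mult_left_mono)
  then show ?thesis by (simp add: abs_mult mult.commute)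
qed

lemma splitting_step_stable:
  assumes W: "\<And>y. y \<in> grid k \<Longrightarrow> \<bar>W y\<bar> \<le> w" and f: "\<And>y. y \<in> grid k \<Longrightarrow> \<bar>f y\<bar> \<le> B"
    and x: "x \<in> grid k" and d: "0 \<le> d"
  shows "\<bar>splitting_step A W d f x\<bar> \<le> B * exp (d * (M + w))"
proof -
  have "\<bar>splitting_step A W d f x\<bar> \<le> B * exp (d * w) * exp (\<bar>d\<bar> * M)"
    unfolding splitting_step_def by (rule op_exp_bound[OF potential_bound[OF W f] x]) (use d in auto)
  then show ?thesis using d by (simp add: exp_add distrib_left mult_ac)
qed

text \<open>Both factors are expanded to first order; the three error terms are those of the exponential of
  \<open>A\<close>, of the multiplication by \<open>exp (d * W)\<close>, and of their interaction.\<close>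

lemma splitting_step_consistent:
  assumes W: "\<And>y. y \<in> grid k \<Longrightarrow> \<bar>W y\<bar> \<le> w" and f: "\<And>y. y \<in> grid k \<Longrightarrow> \<bar>f y\<bar> \<le> B"
    and x: "x \<in> grid k" and d: "0 \<le> d"
  shows "\<bar>splitting_step A W d f x - f x - d * (A f x + W x * f x)\<bar>
          \<le> d\<^sup>2 * (M + w)\<^sup>2 * B * exp (d * (M + w))"
proof -
  define v where "v y = exp (d * W y) * f y" for y
  have w: "0 \<le> w" using W[OF x] by linarith
  have B: "0 \<le> B" using f[OF x] by linarith
  note M0 = M_nonneg
  have vb: "\<bar>v y\<bar> \<le> B * exp (d * w)" if "y \<in> grid k" for y
    unfolding v_def by (rule potential_bound[OF W f that d])
  have 1: "\<bar>op_exp A d v x - v x - d * A v x\<bar> \<le> d\<^sup>2 * M\<^sup>2 * (B * exp (d * w)) * exp (d * M)"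
    using op_exp_taylor[where v = v and r = 0, OF vb x order_refl d]
    by (simp add: A_eq)
  have e1: "\<bar>exp z - 1\<bar> \<le> q * exp q" and e2: "\<bar>exp z - 1 - z\<bar> \<le> q\<^sup>2 * exp q" if "\<bar>z\<bar> \<le> q" for z q :: real
  proof -
    obtain s where s: "\<bar>s\<bar> \<le> \<bar>z\<bar>" "exp z = (\<Sum>m<1. z ^ m / fact m) + exp s / fact 1 * z ^ 1"
      using Maclaurin_exp_le[of z 1] by blast
    then have "\<bar>exp z - 1\<bar> = \<bar>z\<bar> * exp s" by (simp add: abs_mult)
    also have "\<dots> \<le> q * exp q" using s that by (intro mult_mono) auto
    finally show "\<bar>exp z - 1\<bar> \<le> q * exp q" .
    obtain s where s: "\<bar>s\<bar> \<le> \<bar>z\<bar>" "exp z = (\<Sum>m<2. z ^ m / fact m) + exp s / fact 2 * z ^ 2"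
      using Maclaurin_exp_le[of z 2] by blast
    then have "\<bar>exp z - 1 - z\<bar> = \<bar>z\<bar>\<^sup>2 * (exp s / 2)" by (simp add: abs_mult numeral_2_eq_2)
    also have "\<dots> \<le> q\<^sup>2 * exp q"
    proof (intro mult_mono power_mono)
      have "exp s \<le> exp q" using s that by simp
      then show "exp s / 2 \<le> exp q" by (smt (verit) exp_gt_zero field_sum_of_halves)
    qed (use that in auto)
    finally show "\<bar>exp z - 1 - z\<bar> \<le> q\<^sup>2 * exp q" .
  qed
  have dW: "\<bar>d * W y\<bar> \<le> d * w" if "y \<in> grid k" for y
    using W[OF that] d by (simp add: abs_mult mult_left_mono)
  have "\<bar>v x - f x - d * W x * f x\<bar> = \<bar>exp (d * W x) - 1 - d * W x\<bar> * \<bar>f x\<bar>"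
    unfolding v_def abs_mult[symmetric] by (simp add: algebra_simps)
  also have "\<dots> \<le> ((d * w)\<^sup>2 * exp (d * w)) * B"
    using e2[OF dW[OF x]] f[OF x] by (intro mult_mono) auto
  finally have 2: "\<bar>v x - f x - d * W x * f x\<bar> \<le> (d * w)\<^sup>2 * exp (d * w) * B" .
  have "\<bar>v y - f y\<bar> \<le> (d * w * exp (d * w)) * B" if y: "y \<in> grid k" for y
  proof -
    have "\<bar>v y - f y\<bar> = \<bar>exp (d * W y) - 1\<bar> * \<bar>f y\<bar>"
      unfolding v_def abs_mult[symmetric] by (simp add: algebra_simps)
    then show ?thesis using e1[OF dW[OF y]] f[OF y] by (auto intro: mult_mono)
  qed
  from bound[OF this x] have "\<bar>A (\<lambda>y. v y - f y) x\<bar> \<le> M * (d * w * exp (d * w) * B)" .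
  moreover have "A (\<lambda>y. v y - f y) x = A v x - A f x"
    unfolding A_eq by (simp add: algebra_simps)
  ultimately have "\<bar>d * (A v x - A f x)\<bar> \<le> d * (M * (d * w * exp (d * w) * B))"
    using d by (simp add: abs_mult mult_left_mono)
  with 1 2 have "\<bar>op_exp A d v x - f x - d * (A f x + W x * f x)\<bar>
     \<le> d\<^sup>2 * M\<^sup>2 * (B * exp (d * w)) * exp (d * M) + (d * w)\<^sup>2 * exp (d * w) * B
       + d * (M * (d * w * exp (d * w) * B))"
    by (simp add: algebra_simps)
  also have "\<dots> \<le> d\<^sup>2 * M\<^sup>2 * (B * exp (d * w)) * exp (d * M) + (d * w)\<^sup>2 * exp (d * w) * B * exp (d * M)
       + d * (M * (d * w * exp (d * w) * B)) * exp (d * M)"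
  proof -
    have e: "X \<le> X * exp (d * M)" if "0 \<le> X" for X :: real
      using mult_left_mono[OF _ that, of 1 "exp (d * M)"] d M0 by simp
    show ?thesis using d w B M0 by (intro add_mono order_refl e) auto
  qed
  also have "\<dots> = d\<^sup>2 * (M\<^sup>2 + w\<^sup>2 + M * w) * B * exp (d * (M + w))"
    by (simp add: algebra_simps exp_add power2_eq_square)
  also have "\<dots> \<le> d\<^sup>2 * (M + w)\<^sup>2 * B * exp (d * (M + w))"
  proof -
    have "M\<^sup>2 + w\<^sup>2 + M * w \<le> (M + w)\<^sup>2" using M0 w by (simp add: power2_sum)
    then show ?thesis using B by (intro mult_right_mono mult_left_mono) auto
  qed
  finally show ?thesis unfolding splitting_step_def v_def .
qed

end

text \<open>Stability and consistency give convergence: the distance \<open>e\<^sub>i\<close> to the exact flow after \<open>i\<close> steps of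
  size \<open>d\<close> satisfies \<open>e\<^sub>i\<^sub>+\<^sub>1 \<le> exp (d Q) e\<^sub>i + O(d\<^sup>2)\<close>, so it is \<open>O(d)\<close> at a fixed time \<open>t\<close>.\<close>

lemma trotter:
  assumes "nearest_neighbour k K a b c M"
    and "nearest_neighbour k S a b c' (M + w)"
    and c': "\<And>x. c' x = c x + W x"
    and W: "\<And>x. x \<in> grid k \<Longrightarrow> \<bar>W x\<bar> \<le> w"
    and x: "x \<in> grid k" and t: "0 \<le> t"
  shows "(\<lambda>N. (splitting_step K W (t / real N) ^^ N) f x) \<longlonglongrightarrow> op_exp S t f x"
proof -
  interpret K: nearest_neighbour k K a b c M by fact
  interpret S: nearest_neighbour k S a b c' "M + w" by fact
  obtain B where B: "0 \<le> B" "\<And>y. y \<in> grid k \<Longrightarrow> \<bar>f y\<bar> \<le> B" using bounded_on_grid[of k f] by blast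
  define Q where "Q = M + w"
  have S_eq: "S g y = K g y + W y * g y" for g y
    by (simp add: S.A_eq K.A_eq c' algebra_simps)
  have err: "\<bar>(splitting_step K W d ^^ i) f y - op_exp S (real i * d) f y\<bar>
        \<le> real i * (2 * Q\<^sup>2 * d\<^sup>2 * B) * exp (real i * d * Q)"
    if d: "0 \<le> d" and y: "y \<in> grid k" for i d y
    using y
  proof (induction i arbitrary: y)
    case (Suc i)
    define r where "r = real i * d"
    have r: "0 \<le> r" using d by (simp add: r_def)
    define g where "g = op_exp S r f"
    define h where "h = (splitting_step K W d ^^ i) f"
    define e where "e = real i * (2 * Q\<^sup>2 * d\<^sup>2 * B) * exp (r * Q)"
    have gb: "\<bar>g z\<bar> \<le> B * exp (r * Q)" if "z \<in> grid k" for z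
      using S.op_exp_bound[OF B(2) that, where t = r] r by (simp add: g_def Q_def)
    have "\<bar>h z - g z\<bar> \<le> e" if "z \<in> grid k" for z
      using Suc.IH[OF that] by (simp add: h_def g_def e_def r_def)
    from K.splitting_step_stable[OF W this Suc.prems d]
    have 1: "\<bar>splitting_step K W d (\<lambda>z. h z - g z) y\<bar> \<le> e * exp (d * Q)" by (simp add: Q_def)
    have 2: "splitting_step K W d (\<lambda>z. h z - g z) y = splitting_step K W d h y - splitting_step K W d g y"
      unfolding splitting_step_def right_diff_distrib by (rule K.op_exp_diff[OF Suc.prems])
    have 3: "\<bar>splitting_step K W d g y - g y - d * S g y\<bar> \<le> d\<^sup>2 * Q\<^sup>2 * (B * exp (r * Q)) * exp (d * Q)"
      using K.splitting_step_consistent[OF W gb Suc.prems d] by (simp add: Q_def S_eq)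
    have 4: "\<bar>op_exp S (r + d) f y - g y - d * S g y\<bar> \<le> d\<^sup>2 * Q\<^sup>2 * B * exp ((r + d) * Q)"
      using S.op_exp_taylor[OF B(2) Suc.prems r d] by (simp add: Q_def g_def)
    have "\<bar>splitting_step K W d h y - op_exp S (r + d) f y\<bar>
       \<le> e * exp (d * Q) + d\<^sup>2 * Q\<^sup>2 * (B * exp (r * Q)) * exp (d * Q) + d\<^sup>2 * Q\<^sup>2 * B * exp ((r + d) * Q)"
      using 1 2 3 4 by linarith
    also have "\<dots> = real (Suc i) * (2 * Q\<^sup>2 * d\<^sup>2 * B) * exp ((r + d) * Q)"
      by (simp add: e_def distrib_right exp_add algebra_simps)
    finally show ?case by (simp add: h_def r_def distrib_right add.commute)
  qed simp
  have "(\<lambda>N. (splitting_step K W (t / real N) ^^ N) f x - op_exp S t f x) \<longlonglongrightarrow> 0"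
  proof (rule Lim_null_comparison)
    show "\<forall>\<^sub>F N in sequentially. norm ((splitting_step K W (t / real N) ^^ N) f x - op_exp S t f x)
        \<le> (2 * Q\<^sup>2 * t\<^sup>2 * B) * exp (t * Q) / real N"
      using eventually_gt_at_top[of 0]
    proof eventually_elim
      case (elim N)
      have "real N * (2 * Q\<^sup>2 * (t / real N)\<^sup>2 * B) * exp (real N * (t / real N) * Q)
          = (2 * Q\<^sup>2 * t\<^sup>2 * B) * exp (t * Q) / real N"
        using elim by (simp add: power2_eq_square field_simps)
      then show ?case using err[of "t / real N" x N] t x elim by simp
    qed
    show "(\<lambda>N. (2 * Q\<^sup>2 * t\<^sup>2 * B) * exp (t * Q) / real N) \<longlonglongrightarrow> 0"
      by (rule lim_const_over_n)
  qed
  then show ?thesis by (rule LIM_zero_cancel)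
qed

section \<open>The principal eigenvalue\<close>

text \<open>Summation by parts: the summands differ by the increments of \<open>w i * U (i + 1) - w (i + 1) * U i\<close>.\<close>

lemma discrete_green:
  fixes w U :: "nat \<Rightarrow> real"
  shows "(\<Sum>i<n. w (Suc i) * (U (Suc (Suc i)) + U i - 2 * U (Suc i)))
       = (\<Sum>i<n. U (Suc i) * (w (Suc (Suc i)) + w i - 2 * w (Suc i)))
         + (w n * U (Suc n) - w (Suc n) * U n) - (w 0 * U 1 - w 1 * U 0)"
  by (induction n) (auto simp: algebra_simps)

lemma periodic_frac:
  fixes g :: "real \<Rightarrow> 'a"
  assumes "\<And>x. g (x + 1) = g x"
  shows "g (frac x) = g x"
proof -
  have nat: "g (x + real n) = g x" for n x
  proof (induction n)
    case (Suc n)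
    then show ?case using assms[of "x + real n"] by (simp add: add_ac)
  qed simp
  have "g (x + of_int i) = g x" for i x
  proof (cases i rule: int_cases2)
    case (nonneg n)
    then show ?thesis using nat by simp
  next
    case (nonpos n)
    then show ?thesis using nat[of "x - real n" n] by simp
  qed
  from this[of x "- \<lfloor>x\<rfloor>"] show ?thesis by (simp add: frac_def)
qed

locale ground_state =
  fixes k :: nat and V :: "real \<Rightarrow> real" and lam :: real and u :: "real \<Rightarrow> real"
  assumes k: "k \<ge> 1"
    and u: "\<And>x. x \<in> grid k \<Longrightarrow> 0 < u x"
    and eig: "\<And>x. x \<in> grid k \<Longrightarrow> perturbed_operator k V u x = lam * u x"
begin

text \<open>Maximum principle: the Laplacian is nonpositive where \<open>u\<close> is largest.\<close>

lemma eigenvalue_le: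
  assumes "\<And>x. x \<in> grid k \<Longrightarrow> V x \<le> m"
  shows "lam \<le> real k * m"
proof -
  have "Max (u ` grid k) \<in> u ` grid k" using grid_nonempty[OF k] by (intro Max_in) auto
  then obtain x where x: "x \<in> grid k" "u x = Max (u ` grid k)" by force
  have max: "u y \<le> u x" if "y \<in> grid k" for y using that x by simp
  have "discrete_laplacian k u x \<le> 0"
    using max[OF next_site_in_grid[OF k x(1)]] max[OF prev_site_in_grid[OF k x(1)]]
    by (simp add: discrete_laplacian_def)
  then have "real k * discrete_laplacian k u x \<le> 0" by (simp add: mult_nonneg_nonpos)
  then have "lam * u x \<le> real k * V x * u x"
    using eig[OF x(1)] by (simp add: perturbed_operator_def)
  then have "lam \<le> real k * V x" using u[OF x(1)] by simp
  also have "\<dots> \<le> real k * m" using assms[OF x(1)] by (intro mult_left_mono) auto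
  finally show ?thesis .
qed

text \<open>The eigenvalue equation is tested against the parabola \<open>w i = i (n + 1 - i)\<close> on \<open>n\<close> consecutive
  sites. Its second difference is \<open>-2\<close>, its values there are at least \<open>n\<close>, and it vanishes at both ends,
  so the boundary terms have a favourable sign. The Laplacian therefore costs at most \<open>2 / n\<close>.
  Counting sites by integers makes it harmless if the window winds around the circle.\<close>

lemma eigenvalue_ge:
  fixes a :: int
  assumes n: "n \<ge> 1" and v: "\<And>i. i < n \<Longrightarrow> v \<le> V (frac (of_int (a + int (Suc i)) / real k))"
  shows "real k * (v - 2 / real n) \<le> lam"
proof -
  define x where "x i = frac (of_int (a + int i) / real k)" for i :: nat
  define U where "U i = u (x i)" for i
  define w where "w i = real i * (real n + 1 - real i)" for i
  have x: "x i \<in> grid k" for i unfolding x_def by (rule frac_in_grid[OF k])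
  have U: "0 < U i" for i using u[OF x] by (simp add: U_def)
  have nb: "next_site k (x (Suc i)) = x (Suc (Suc i))" "prev_site k (x (Suc i)) = x i" for i
    unfolding x_def next_site_frac prev_site_frac by (simp_all add: add_ac)
  have eigU: "real k * (U (Suc (Suc i)) + U i - 2 * U (Suc i)) + real k * V (x (Suc i)) * U (Suc i) = lam * U (Suc i)" for i
    using eig[OF x[of "Suc i"]] by (simp add: perturbed_operator_def discrete_laplacian_def nb U_def)
  have w: "real n \<le> w (Suc i)" if "i < n" for i
  proof -
    have "0 \<le> real i * (real n - 1 - real i)" using that by simp
    then show ?thesis by (simp add: w_def algebra_simps)
  qed
  have n0: "0 < real n" using n by simp
  define Z where "Z = (\<Sum>i<n. w (Suc i) * U (Suc i))"
  have Z: "0 < Z"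
    unfolding Z_def using n w U n0 by (intro sum_pos mult_pos_pos) (force intro: less_le_trans)+
  have "(\<Sum>i<n. w (Suc i) * (U (Suc (Suc i)) + U i - 2 * U (Suc i)))
      = (\<Sum>i<n. U (Suc i) * (- 2)) + real n * U (Suc n) + real n * U 0"
    unfolding discrete_green[of w U n] by (simp add: w_def algebra_simps)
  also have "\<dots> \<ge> (\<Sum>i<n. U (Suc i) * (- 2))" using U[of "Suc n"] U[of 0] by (simp add: less_imp_le)
  also (xtrans) have "(\<Sum>i<n. U (Suc i) * (- 2)) \<ge> (\<Sum>i<n. - (2 / real n) * (w (Suc i) * U (Suc i)))"
  proof (rule sum_mono)
    fix i assume "i \<in> {..<n}"
    then have "real n * U (Suc i) \<le> w (Suc i) * U (Suc i)"
      using w[of i] U[of "Suc i"] by (intro mult_right_mono) auto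
    then show "- (2 / real n) * (w (Suc i) * U (Suc i)) \<le> U (Suc i) * (- 2)" using n0 by (simp add: field_simps)
  qed
  finally have 1: "- (2 / real n) * Z \<le> (\<Sum>i<n. w (Suc i) * (U (Suc (Suc i)) + U i - 2 * U (Suc i)))"
    by (simp add: Z_def sum_distrib_left)
  have 2: "v * Z \<le> (\<Sum>i<n. w (Suc i) * (V (x (Suc i)) * U (Suc i)))"
    unfolding Z_def sum_distrib_left
  proof (rule sum_mono)
    fix i assume i: "i \<in> {..<n}"
    then have "v \<le> V (x (Suc i))" using v[of i] by (simp add: x_def)
    moreover have "0 \<le> w (Suc i) * U (Suc i)" using w[of i] i U[of "Suc i"] by simp
    ultimately have "v * (w (Suc i) * U (Suc i)) \<le> V (x (Suc i)) * (w (Suc i) * U (Suc i))"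
      by (rule mult_right_mono)
    then show "v * (w (Suc i) * U (Suc i)) \<le> w (Suc i) * (V (x (Suc i)) * U (Suc i))" by (simp add: mult_ac)
  qed
  have "lam * Z = (\<Sum>i<n. w (Suc i) * (lam * U (Suc i)))"
    unfolding Z_def sum_distrib_left by (intro sum.cong) auto
  also have "\<dots> = real k * ((\<Sum>i<n. w (Suc i) * (U (Suc (Suc i)) + U i - 2 * U (Suc i)))
       + (\<Sum>i<n. w (Suc i) * (V (x (Suc i)) * U (Suc i))))"
    unfolding eigU[symmetric] sum.distrib[symmetric] sum_distrib_left
    by (intro sum.cong) (auto simp: algebra_simps)
  also have "\<dots> \<ge> real k * (- (2 / real n) * Z + v * Z)"
    by (intro mult_left_mono add_mono 1 2) auto
  finally have "(real k * (v - 2 / real n)) * Z \<le> lam * Z" by (simp add: algebra_simps)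
  then show ?thesis using Z by simp
qed

text \<open>The difference of the two sides is the relative entropy rate of the Gibbs chain. Its sign comes from
  stationarity applied to \<open>ln u\<close> together with \<open>r ln r \<ge> r - 1\<close> for the ratios \<open>r\<close> of values of \<open>u\<close> at
  neighbouring sites.\<close>

lemma eigenvalue_le_mean:
  assumes "stationary_prob k (gibbs_generator k u) p"
  shows "lam \<le> (\<Sum>x\<in>grid k. real k * V x * p x)"
proof -
  have p: "0 \<le> p x" if "x \<in> grid k" for x
    using assms that by (simp add: stationary_prob_def prob_vector_def)
  have p1: "(\<Sum>x\<in>grid k. p x) = 1" using assms by (simp add: stationary_prob_def prob_vector_def)
  have rln: "r * ln r \<ge> r - 1" if "0 < r" for r :: real
    using ln_le_minus_one[of "1 / r"] that by (simp add: ln_div field_simps)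
  have "lam - real k * V x \<le> gibbs_generator k u (\<lambda>y. ln (u y)) x" if x: "x \<in> grid k" for x
  proof -
    have e: "u (next_site k x) / u x - 1 \<le> u (next_site k x) / u x * (ln (u (next_site k x)) - ln (u x))"
      "u (prev_site k x) / u x - 1 \<le> u (prev_site k x) / u x * (ln (u (prev_site k x)) - ln (u x))"
      using rln[of "u (next_site k x) / u x"] rln[of "u (prev_site k x) / u x"]
        u[OF x] u[OF next_site_in_grid[OF k x]] u[OF prev_site_in_grid[OF k x]]
      by (simp_all add: ln_div)
    have "lam - real k * V x = real k * (u (next_site k x) / u x - 1 + (u (prev_site k x) / u x - 1))"
    proof -
      have "(lam - real k * V x) * u x = real k * discrete_laplacian k u x"
        using eig[OF x] by (simp add: perturbed_operator_def algebra_simps)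
      then have "lam - real k * V x = real k * discrete_laplacian k u x / u x"
        using u[OF x] by (simp add: eq_divide_eq)
      then show ?thesis
        using u[OF x] by (simp add: discrete_laplacian_def add_divide_distrib diff_divide_distrib algebra_simps)
    qed
    also have "\<dots> \<le> real k * (u (next_site k x) / u x * (ln (u (next_site k x)) - ln (u x))
        + u (prev_site k x) / u x * (ln (u (prev_site k x)) - ln (u x)))"
      by (intro mult_left_mono add_mono e) auto
    also have "\<dots> = gibbs_generator k u (\<lambda>y. ln (u y)) x"
      by (simp add: gibbs_generator_def distrib_left)
    finally show ?thesis .
  qed
  then have "(\<Sum>x\<in>grid k. p x * (lam - real k * V x)) \<le> (\<Sum>x\<in>grid k. p x * gibbs_generator k u (\<lambda>y. ln (u y)) x)"
    by (intro sum_mono mult_left_mono p) auto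
  also have "\<dots> = 0" using assms by (simp add: stationary_prob_def)
  finally have "lam * (\<Sum>x\<in>grid k. p x) - (\<Sum>x\<in>grid k. real k * V x * p x) \<le> 0"
    by (simp add: right_diff_distrib sum_subtractf sum_distrib_left mult_ac)
  then show ?thesis by (simp add: p1)
qed

end

text \<open>The width \<open>n\<close> of the test window is fixed first, according to the error \<open>2 / n\<close>; when \<open>k\<close> grows the
  window of length \<open>n / k\<close> shrinks to the maximum point.\<close>

lemma scaled_eigenvalue_tendsto:
  fixes lam :: "nat \<Rightarrow> real"
  assumes gs: "\<And>k. k \<ge> 1 \<Longrightarrow> ground_state k V (lam k) (u k)"
    and per: "\<And>x. V (x + 1) = V x" and cont: "isCont V x\<^sub>0" and max: "\<And>x. V x \<le> V x\<^sub>0"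
  shows "(\<lambda>k. 1 / real k * lam k) \<longlonglongrightarrow> V x\<^sub>0"
proof (rule LIMSEQ_I)
  fix e :: real assume e: "0 < e"
  obtain d where d: "d > 0" "\<And>x. dist x x\<^sub>0 < d \<Longrightarrow> dist (V x) (V x\<^sub>0) < e / 2"
    using cont e unfolding continuous_at_eps_delta by (metis half_gt_zero)
  obtain n where n: "4 / e < real n" using reals_Archimedean2 by blast
  have n1: "n \<ge> 1" using n e by (metis One_nat_def Suc_leI divide_pos_pos gr0I less_asym of_nat_0 zero_less_numeral)
  obtain K where K: "real n / d < real K" using reals_Archimedean2 by blast
  have "norm (1 / real k * lam k - V x\<^sub>0) < e" if kK: "k \<ge> max 1 K" for k
  proof -
    have k1: "k \<ge> 1" "real k > 0" using kK by auto
    interpret ground_state k V "lam k" "u k" by (rule gs[OF k1(1)])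
    have up: "lam k \<le> real k * V x\<^sub>0" by (rule eigenvalue_le) (rule max)
    have "real k * ((V x\<^sub>0 - e / 2) - 2 / real n) \<le> lam k"
    proof (rule eigenvalue_ge[OF n1, where a = "\<lfloor>real k * x\<^sub>0\<rfloor>"])
      fix i assume i: "i < n"
      let ?y = "of_int (\<lfloor>real k * x\<^sub>0\<rfloor> + int (Suc i)) / real k"
      have "real k * x\<^sub>0 \<le> of_int (\<lfloor>real k * x\<^sub>0\<rfloor> + int (Suc i))"
        "of_int (\<lfloor>real k * x\<^sub>0\<rfloor> + int (Suc i)) \<le> real k * x\<^sub>0 + real n"
        using i by linarith+
      then have "x\<^sub>0 \<le> ?y" "?y \<le> (real k * x\<^sub>0 + real n) / real k"
        using k1(2) by (simp add: pos_le_divide_eq mult.commute, intro divide_right_mono) auto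
      then have "x\<^sub>0 \<le> ?y" "?y \<le> x\<^sub>0 + real n / real k"
        using k1(2) by (simp_all add: add_divide_distrib)
      moreover have "real n / real k < d"
      proof -
        have "real n / d < real k" using K kK by linarith
        then show ?thesis using d(1) k1(2) by (simp add: field_simps)
      qed
      ultimately have "dist ?y x\<^sub>0 < d" by (simp add: dist_real_def)
      from d(2)[OF this] have "V x\<^sub>0 - e / 2 \<le> V ?y"
        unfolding dist_real_def by linarith
      then show "V x\<^sub>0 - e / 2 \<le> V (frac ?y)" by (simp add: periodic_frac[of V, OF per])
    qed
    moreover have "2 / real n < e / 2" using n e n1 by (simp add: field_simps)
    ultimately have "(V x\<^sub>0 - e / 2) - 2 / real n \<le> lam k / real k" "2 / real n < e / 2"
      using k1(2) by (simp_all add: pos_le_divide_eq mult.commute)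
    then have "V x\<^sub>0 - e < lam k / real k" by linarith
    moreover have "lam k / real k \<le> V x\<^sub>0" using up k1(2) by (simp add: field_simps)
    ultimately show ?thesis by (simp add: abs_less_iff)
  qed
  then show "\<exists>K. \<forall>k\<ge>K. norm (1 / real k * lam k - V x\<^sub>0) < e" by blast
qed

text \<open>Squeezed between the scaled eigenvalue and the maximum of the potential.\<close>

lemma mean_potential_tendsto:
  fixes lam :: "nat \<Rightarrow> real"
  assumes gs: "\<And>k. k \<ge> 1 \<Longrightarrow> ground_state k V (lam k) (u k)"
    and stat: "\<And>k. k \<ge> 1 \<Longrightarrow> stationary_prob k (gibbs_generator k (u k)) (p k)"
    and per: "\<And>x. V (x + 1) = V x" and cont: "isCont V x\<^sub>0" and max: "\<And>x. V x \<le> V x\<^sub>0"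
  shows "(\<lambda>k. \<Sum>x\<in>grid k. V x * p k x) \<longlonglongrightarrow> V x\<^sub>0"
proof (rule tendsto_sandwich[OF _ _ scaled_eigenvalue_tendsto[OF gs per cont max] tendsto_const])
  show "\<forall>\<^sub>F k in sequentially. 1 / real k * lam k \<le> (\<Sum>x\<in>grid k. V x * p k x)"
    using eventually_ge_at_top[of 1]
  proof eventually_elim
    case (elim k)
    interpret ground_state k V "lam k" "u k" by (rule gs[OF elim])
    have "lam k \<le> real k * (\<Sum>x\<in>grid k. V x * p k x)"
      using eigenvalue_le_mean[OF stat[OF elim]] by (simp add: sum_distrib_left mult_ac)
    then show ?case using elim by (simp add: field_simps)
  qed
  show "\<forall>\<^sub>F k in sequentially. (\<Sum>x\<in>grid k. V x * p k x) \<le> V x\<^sub>0"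
    using eventually_ge_at_top[of 1]
  proof eventually_elim
    case (elim k)
    have p: "\<And>x. x \<in> grid k \<Longrightarrow> 0 \<le> p k x" "(\<Sum>x\<in>grid k. p k x) = 1"
      using stat[OF elim] by (auto simp: stationary_prob_def prob_vector_def)
    have "(\<Sum>x\<in>grid k. V x * p k x) \<le> (\<Sum>x\<in>grid k. V x\<^sub>0 * p k x)"
      using p max by (intro sum_mono mult_right_mono) auto
    then show ?case using p by (simp flip: sum_distrib_left)
  qed
qed

section \<open>Riemann sums of right-continuous functions\<close>

text \<open>Right end points are needed: the function is only continuous from the right, and the right end points
  of the mesh intervals that contain \<open>r\<close> converge to \<open>r\<close> from the right.\<close>

lemma riemann_sums_right:
  fixes f :: "real \<Rightarrow> real"
  assumes "s \<le> t"
    and rc: "\<And>r. s \<le> r \<Longrightarrow> r \<le> t \<Longrightarrow> (f \<longlongrightarrow> f r) (at_right r)"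
    and B: "\<And>r. s \<le> r \<Longrightarrow> r \<le> t \<Longrightarrow> \<bar>f r\<bar> \<le> B"
  shows "set_integrable lborel {s<..t} f"
    and "(\<lambda>N. \<Sum>i<N. (t - s) / real N * f (s + real (Suc i) * ((t - s) / real N)))
           \<longlonglongrightarrow> (LINT r:{s<..t}|lborel. f r)"
proof -
  have "set_integrable lborel {s<..t} f \<and>
    (\<lambda>N. \<Sum>i<N. (t - s) / real N * f (s + real (Suc i) * ((t - s) / real N)))
           \<longlonglongrightarrow> (LINT r:{s<..t}|lborel. f r)"
  proof (cases "s = t")
    case True
    then show ?thesis by (simp add: set_integrable_def set_lebesgue_integral_def)
  next
    case False
    then have st: "s < t" using assms by simp
    define d where "d N = (t - s) / real N" for N
    define g where "g N r = (\<Sum>i<N. f (s + real (Suc i) * d N) * indicator {s + real i * d N<..s + real (Suc i) * d N} r)" for N r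
    \<comment> \<open>the right end point of the mesh interval that contains \<open>r\<close>\<close>
    define h where "h N r = s + of_int \<lceil>(r - s) / d N\<rceil> * d N" for N r
    have g_eq: "g N r = f (h N r) \<and> r \<le> h N r \<and> h N r \<le> t \<and> h N r \<le> r + d N"
      if N: "N > 0" and r: "s < r" "r \<le> t" for N r
    proof -
      have d: "d N > 0" using st N by (simp add: d_def)
      define m where "m = \<lceil>(r - s) / d N\<rceil>"
      have m: "of_int m - 1 < (r - s) / d N" "(r - s) / d N \<le> of_int m"
        unfolding m_def by linarith+
      have m0: "m > 0" using r d by (simp add: m_def)
      have "(r - s) / d N \<le> real N" using r N st by (simp add: d_def field_simps)
      then have mN: "m \<le> int N" by (simp add: m_def ceiling_le_iff)
      define n where "n = nat (m - 1)"
      have n: "n < N" "m = int n + 1" using m0 mN by (auto simp: n_def)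
      have iff: "s + real i * d N < r \<and> r \<le> s + real (Suc i) * d N \<longleftrightarrow> i = n" for i
      proof -
        have "s + real i * d N < r \<and> r \<le> s + real (Suc i) * d N \<longleftrightarrow>
            of_int (int i) < (r - s) / d N \<and> (r - s) / d N \<le> of_int (int i) + 1"
          using d by (auto simp: field_simps)
        also have "\<dots> \<longleftrightarrow> \<lceil>(r - s) / d N\<rceil> = int i + 1" by (auto simp: ceiling_eq_iff)
        finally show ?thesis using n by (auto simp: m_def)
      qed
      have "g N r = (\<Sum>i<N. if i = n then f (s + real (Suc i) * d N) else 0)"
        unfolding g_def by (intro sum.cong refl) (simp add: indicator_def iff del: of_nat_Suc)
      also have "\<dots> = f (s + real (Suc n) * d N)" using n by simp
      also have "s + real (Suc n) * d N = h N r" using n by (simp add: h_def m_def[symmetric] algebra_simps)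
      finally have 1: "g N r = f (h N r)" .
      have "r \<le> h N r" "h N r \<le> r + d N" using m d by (simp_all add: h_def m_def[symmetric] field_simps)
      moreover have "of_int m * d N \<le> real N * d N"
        using mN d by (intro mult_right_mono) (metis of_int_le_iff of_int_of_nat_eq, simp)
      then have "h N r \<le> t" using N unfolding h_def m_def[symmetric] by (simp add: d_def)
      ultimately show ?thesis using 1 by simp
    qed
    have g_out: "g N r = 0" if "\<not> (s < r \<and> r \<le> t)" for N r
    proof -
      have "\<not> (s + real i * d N < r \<and> r \<le> s + real (Suc i) * d N)" if "i < N" for i
      proof -
        have d: "d N > 0" using st that by (simp add: d_def)
        have "real i * d N \<ge> 0" "real (Suc i) * d N \<le> real N * d N"
          using d that by (auto intro!: mult_right_mono simp del: of_nat_Suc)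
        moreover have "real N * d N = t - s" using that by (simp add: d_def)
        ultimately show ?thesis using \<open>\<not> (s < r \<and> r \<le> t)\<close> by linarith
      qed
      then show ?thesis unfolding g_def by (intro sum.neutral) (auto simp: indicator_def)
    qed
    have d0: "d \<longlonglongrightarrow> 0" unfolding d_def by (rule lim_const_over_n)
    have lim: "(\<lambda>N. g N r) \<longlonglongrightarrow> indicator {s<..t} r * f r" for r
    proof (cases "s < r \<and> r \<le> t")
      case True
      have "(\<lambda>N. h N r) \<longlonglongrightarrow> r"
      proof (rule tendsto_sandwich[where f = "\<lambda>_. r" and h = "\<lambda>N. r + d N"])
        show "(\<lambda>N. r + d N) \<longlonglongrightarrow> r" using tendsto_add[OF tendsto_const d0, of r] by simp
      qed (use g_eq True in \<open>auto intro!: eventually_mono[OF eventually_gt_at_top[of 0]]\<close>)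
      have "(f \<longlongrightarrow> f r) (at_right r)" using rc[of r] True by simp
      then have "(f \<longlongrightarrow> f r) (at r within {r..})"
        by (smt (verit, ccfv_SIG) Lim_cong_within at_within_Ici_at_right order_antisym_conv atLeast_iff tendsto_at_iff_tendsto_nhds_within)
      then have nb: "((\<lambda>x. f x) \<longlongrightarrow> f r) (inf (nhds r) (principal {r..}))"
        by (simp add: tendsto_at_iff_tendsto_nhds_within)
      have "filterlim (\<lambda>N. h N r) (inf (nhds r) (principal {r..})) sequentially"
        unfolding filterlim_inf filterlim_principal
        using \<open>(\<lambda>N. h N r) \<longlonglongrightarrow> r\<close> g_eq True
        by (auto intro!: eventually_mono[OF eventually_gt_at_top[of 0]])
      from filterlim_compose[OF nb this] have "(\<lambda>N. f (h N r)) \<longlonglongrightarrow> f r" .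
      then have "(\<lambda>N. g N r) \<longlonglongrightarrow> f r"
        by (rule Lim_transform_eventually)
           (use g_eq True in \<open>auto intro!: eventually_mono[OF eventually_gt_at_top[of 0]]\<close>)
      then show ?thesis using True by simp
    qed (simp add: g_out)
    have gm [measurable]: "g N \<in> borel_measurable lborel" for N unfolding g_def by measurable
    have fm: "(\<lambda>r. indicator {s<..t} r * f r) \<in> borel_measurable lborel"
      by (rule borel_measurable_LIMSEQ_real[OF lim gm])
    have bnd: "AE r in lborel. norm (g N r) \<le> B * indicator {s<..t} r" if "N > 0" for N
    proof (rule AE_I2)
      fix r
      show "norm (g N r) \<le> B * indicator {s<..t} r"
      proof (cases "s < r \<and> r \<le> t")
        case True
        then show ?thesis using g_eq[of N r] B[of "h N r"] that by auto
      qed (simp add: g_out)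
    qed
    have w: "integrable lborel (\<lambda>r. B * indicator {s<..t} r)"
      by (intro integrable_mult_right integrable_real_indicator) (use st in auto)
    have bnd': "AE r in lborel. norm (g (Suc N) r) \<le> B * indicator {s<..t} r" for N
      by (rule bnd) simp
    have lim': "AE r in lborel. (\<lambda>N. g (Suc N) r) \<longlonglongrightarrow> indicator {s<..t} r * f r"
      using LIMSEQ_Suc[OF lim] by (intro AE_I2)
    have int: "integrable lborel (\<lambda>r. indicator {s<..t} r * f r)"
      by (rule integrable_dominated_convergence[OF fm _ w lim' bnd']) auto
    have "(\<lambda>N. \<integral>r. g (Suc N) r \<partial>lborel) \<longlonglongrightarrow> (\<integral>r. indicator {s<..t} r * f r \<partial>lborel)"
      by (rule integral_dominated_convergence[OF fm _ w lim' bnd']) auto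
    then have L: "(\<lambda>N. \<integral>r. g N r \<partial>lborel) \<longlonglongrightarrow> (LINT r:{s<..t}|lborel. f r)"
      unfolding set_lebesgue_integral_def real_scaleR_def by (rule LIMSEQ_imp_Suc)
    have "(\<integral>r. g N r \<partial>lborel) = (\<Sum>i<N. d N * f (s + real (Suc i) * d N))" for N
    proof -
      have "d N \<ge> 0" using st by (simp add: d_def)
      then have "(\<integral>r. g N r \<partial>lborel) = (\<Sum>i<N. f (s + real (Suc i) * d N) * measure lborel {s + real i * d N<..s + real (Suc i) * d N})"
        unfolding g_def
        by (subst Bochner_Integration.integral_sum)
           (auto intro!: integrable_mult_right integrable_real_indicator simp: distrib_right)
      then show ?thesis using \<open>d N \<ge> 0\<close> by (simp add: algebra_simps)
    qed
    with L int show ?thesis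
      by (simp add: d_def set_integrable_def)
  qed
  then show "set_integrable lborel {s<..t} f"
    and "(\<lambda>N. \<Sum>i<N. (t - s) / real N * f (s + real (Suc i) * ((t - s) / real N)))
           \<longlonglongrightarrow> (LINT r:{s<..t}|lborel. f r)" by auto
qed

section \<open>Laws of chains and cylinder events\<close>

definition cylinder :: "nat \<Rightarrow> real set \<Rightarrow> (real \<Rightarrow> real) \<Rightarrow> (real \<Rightarrow> real) set" where
  "cylinder k S x = {\<omega> \<in> cadlag_paths k. \<forall>s\<in>S. \<omega> s = x s}"

lemma path_in_grid: "\<omega> \<in> cadlag_paths k \<Longrightarrow> 0 \<le> t \<Longrightarrow> \<omega> t \<in> grid k"
  by (auto simp: cadlag_paths_def)

lemma space_path_sigma_upto [simp]: "space (path_sigma_upto k T) = cadlag_paths k"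
  unfolding path_sigma_upto_def by (rule space_measure_of) auto

lemma sets_path_sigma_upto:
  "sets (path_sigma_upto k T) = sigma_sets (cadlag_paths k)
     {{\<omega> \<in> cadlag_paths k. \<omega> s = x} | s x. 0 \<le> s \<and> s \<le> T \<and> x \<in> grid k}"
  unfolding path_sigma_upto_def by (rule sets_measure_of) auto

lemma space_skorohod_space [simp]: "space (skorohod_space k) = cadlag_paths k"
  unfolding skorohod_space_def by (rule space_measure_of) auto

lemma sets_skorohod_space:
  "sets (skorohod_space k) = sigma_sets (cadlag_paths k)
     {{\<omega> \<in> cadlag_paths k. \<omega> s = x} | s x. 0 \<le> s \<and> x \<in> grid k}"
  unfolding skorohod_space_def by (rule sets_measure_of) auto

lemma subalgebra_path_sigma_upto:
  assumes "sets P = sets (skorohod_space k)"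
  shows "subalgebra P (path_sigma_upto k T)"
  unfolding subalgebra_def assms sets_skorohod_space sets_path_sigma_upto
  using sets_eq_imp_space_eq[OF assms] by (auto intro!: sigma_sets_mono')

lemma path_sigma_upto_mono:
  "s \<le> t \<Longrightarrow> sets (path_sigma_upto k s) \<subseteq> sets (path_sigma_upto k t)"
  unfolding sets_path_sigma_upto by (intro sigma_sets_mono') force

lemma coordinate_measurable:
  fixes g :: "real \<Rightarrow> real"
  assumes "0 \<le> t" "t \<le> T"
  shows "(\<lambda>\<omega>. g (\<omega> t)) \<in> borel_measurable (path_sigma_upto k T)"
proof -
  have set: "{\<omega> \<in> cadlag_paths k. \<omega> t = y} \<in> sets (path_sigma_upto k T)" if "y \<in> grid k" for y
    unfolding sets_path_sigma_upto using assms that by (intro sigma_sets.Basic) auto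
  have "(\<lambda>\<omega>. \<Sum>y\<in>grid k. g y * indicator {\<omega> \<in> cadlag_paths k. \<omega> t = y} \<omega>) \<in> borel_measurable (path_sigma_upto k T)"
    by (intro borel_measurable_sum borel_measurable_times borel_measurable_const borel_measurable_indicator set)
  also have "?this \<longleftrightarrow> (\<lambda>\<omega>. g (\<omega> t)) \<in> borel_measurable (path_sigma_upto k T)"
  proof (intro measurable_cong)
    fix \<omega> assume "\<omega> \<in> space (path_sigma_upto k T)"
    then have w: "\<omega> \<in> cadlag_paths k" "\<omega> t \<in> grid k" using path_in_grid assms by auto
    then have "(\<Sum>y\<in>grid k. g y * indicator {\<omega> \<in> cadlag_paths k. \<omega> t = y} \<omega>)
        = (\<Sum>y\<in>grid k. if y = \<omega> t then g y else 0)"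
      by (intro sum.cong) (auto simp: indicator_def)
    then show "(\<Sum>y\<in>grid k. g y * indicator {\<omega> \<in> cadlag_paths k. \<omega> t = y} \<omega>) = g (\<omega> t)"
      using w by simp
  qed
  finally show ?thesis .
qed

lemma path_sigma_upto_measurable_mono:
  assumes "s \<le> t" "f \<in> measurable (path_sigma_upto k s) N"
  shows "f \<in> measurable (path_sigma_upto k t) N"
  using assms(2) path_sigma_upto_mono[OF assms(1), of k] unfolding measurable_def by auto

lemma cylinder_in_sets:
  assumes "finite S" "S \<subseteq> {0..T}" "x \<in> S \<rightarrow> grid k"
  shows "cylinder k S x \<in> sets (path_sigma_upto k T)"
proof (cases "S = {}")
  case True
  then show ?thesis using sets.top[of "path_sigma_upto k T"] by (simp add: cylinder_def)
next
  case False
  have "{\<omega> \<in> space (path_sigma_upto k T). \<forall>s\<in>S. \<omega> s = x s} \<in> sets (path_sigma_upto k T)"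
  proof (intro sets.sets_Collect_finite_All' assms(1) False)
    fix s assume "s \<in> S"
    then show "{\<omega> \<in> space (path_sigma_upto k T). \<omega> s = x s} \<in> sets (path_sigma_upto k T)"
      unfolding sets_path_sigma_upto using assms by (intro sigma_sets.Basic) force
  qed
  then show ?thesis by (simp add: cylinder_def)
qed

text \<open>Requiring the times \<open>0\<close> and \<open>T\<close> to be among the observed ones costs nothing, since the
  state space is finite, and makes the probability of a cylinder event computable step by step.\<close>

lemma path_measure_eqI:
  assumes T: "0 \<le> T"
    and M: "sets M = sets (path_sigma_upto k T)" and N: "sets N = sets (path_sigma_upto k T)"
    and fin: "finite_measure M"
    and eq: "\<And>S x. finite S \<Longrightarrow> {0, T} \<subseteq> S \<Longrightarrow> S \<subseteq> {0..T} \<Longrightarrow> x \<in> S \<rightarrow> grid k \<Longrightarrow>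
      emeasure M (cylinder k S x) = emeasure N (cylinder k S x)"
  shows "M = N"
proof -
  define E where "E = {cylinder k S x | S x. finite S \<and> {0, T} \<subseteq> S \<and> S \<subseteq> {0..T} \<and> x \<in> S \<rightarrow> grid k}"
  have stable: "Int_stable (insert {} E)"
  proof (rule Int_stableI)
    fix A B assume AB: "A \<in> insert {} E" "B \<in> insert {} E"
    show "A \<inter> B \<in> insert {} E"
    proof (cases "A \<inter> B = {}")
      case False
      then obtain S x S' x' where S: "A = cylinder k S x" "finite S" "{0, T} \<subseteq> S" "S \<subseteq> {0..T}" "x \<in> S \<rightarrow> grid k"
         and S': "B = cylinder k S' x'" "finite S'" "{0, T} \<subseteq> S'" "S' \<subseteq> {0..T}" "x' \<in> S' \<rightarrow> grid k"
        using AB unfolding E_def by auto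
      obtain \<omega> where w: "\<omega> \<in> A" "\<omega> \<in> B" using False by auto
      have "A \<inter> B = cylinder k (S \<union> S') \<omega>"
        using w unfolding S S' cylinder_def by auto
      moreover have "\<omega> \<in> S \<union> S' \<rightarrow> grid k"
      proof
        fix r assume "r \<in> S \<union> S'"
        then have "0 \<le> r" using S(4) S'(4) by auto
        moreover have "\<omega> \<in> cadlag_paths k" using w S(1) by (simp add: cylinder_def)
        ultimately show "\<omega> r \<in> grid k" by (rule path_in_grid[rotated])
      qed
      ultimately have "A \<inter> B \<in> E" unfolding E_def using S S' by blast
      then show ?thesis by simp
    qed simp
  qed
  have sub: "insert {} E \<subseteq> Pow (cadlag_paths k)" by (auto simp: E_def cylinder_def)
  have cover: "{\<omega> \<in> cadlag_paths k. \<forall>s\<in>R. \<omega> s = z s} =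
      \<Union> (cylinder k ({0, T} \<union> R) ` {f \<in> {0, T} \<union> R \<rightarrow>\<^sub>E grid k. \<forall>s\<in>R. f s = z s})" (is "?L = ?R")
    if "R \<subseteq> {0..T}" for R z
  proof
    show "?L \<subseteq> ?R"
    proof
      fix \<omega> assume w: "\<omega> \<in> ?L"
      then have "\<omega> r \<in> grid k" if "r \<in> {0, T} \<union> R" for r
        using path_in_grid[of \<omega> k r] that \<open>R \<subseteq> {0..T}\<close> T by auto
      then have "restrict \<omega> ({0, T} \<union> R) \<in> {f \<in> {0, T} \<union> R \<rightarrow>\<^sub>E grid k. \<forall>s\<in>R. f s = z s}"
        using w by auto
      moreover have "\<omega> \<in> cylinder k ({0, T} \<union> R) (restrict \<omega> ({0, T} \<union> R))"
        using w by (simp add: cylinder_def)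
      ultimately show "\<omega> \<in> ?R" by blast
    qed
    show "?R \<subseteq> ?L" by (auto simp: cylinder_def)
  qed
  have inE: "cylinder k ({0, T} \<union> R) ` {f \<in> {0, T} \<union> R \<rightarrow>\<^sub>E grid k. \<forall>s\<in>R. f s = z s} \<subseteq> E"
    if "finite R" "R \<subseteq> {0..T}" for R z
  proof
    fix C assume "C \<in> cylinder k ({0, T} \<union> R) ` {f \<in> {0, T} \<union> R \<rightarrow>\<^sub>E grid k. \<forall>s\<in>R. f s = z s}"
    then obtain f where f: "C = cylinder k ({0, T} \<union> R) f" "f \<in> {0, T} \<union> R \<rightarrow> grid k"
      by (auto simp: PiE_def)
    have "finite ({0, T} \<union> R)" "{0, T} \<subseteq> {0, T} \<union> R" "{0, T} \<union> R \<subseteq> {0..T}"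
      using that T by auto
    with f show "C \<in> E" unfolding E_def by blast
  qed
  have fin_cover: "finite (cylinder k ({0, T} \<union> R) ` {f \<in> {0, T} \<union> R \<rightarrow>\<^sub>E grid k. \<forall>s\<in>R. f s = z s})"
    if "finite R" for R z
    by (intro finite_imageI finite_subset[OF _ finite_PiE[of "{0, T} \<union> R" "\<lambda>_. grid k"]]) (use that in auto)
  have gen: "sets (path_sigma_upto k T) = sigma_sets (cadlag_paths k) (insert {} E)"
  proof
    have "insert {} E \<subseteq> sets (path_sigma_upto k T)"
      unfolding E_def by (auto intro: cylinder_in_sets)
    from sets.sigma_sets_subset[OF this]
    show "sigma_sets (cadlag_paths k) (insert {} E) \<subseteq> sets (path_sigma_upto k T)" by simp
    have "{\<omega> \<in> cadlag_paths k. \<omega> s = y} \<in> sigma_sets (cadlag_paths k) (insert {} E)"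
      if "0 \<le> s" "s \<le> T" for s y
    proof -
      interpret sigma_algebra "cadlag_paths k" "sigma_sets (cadlag_paths k) (insert {} E)"
        by (rule sigma_algebra_sigma_sets[OF sub])
      have "\<Union> (cylinder k ({0, T} \<union> {s}) ` {f \<in> {0, T} \<union> {s} \<rightarrow>\<^sub>E grid k. \<forall>r\<in>{s}. f r = y}) \<in> sigma_sets (cadlag_paths k) (insert {} E)"
        using inE[of "{s}" "\<lambda>_. y"] fin_cover[of "{s}" "\<lambda>_. y"] that by (intro finite_Union) auto
      then show ?thesis using cover[of "{s}" "\<lambda>_. y"] that by simp
    qed
    then show "sets (path_sigma_upto k T) \<subseteq> sigma_sets (cadlag_paths k) (insert {} E)"
      unfolding sets_path_sigma_upto by (intro sigma_sets_mono) auto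
  qed
  show ?thesis
  proof (rule measure_eqI_generator_eq_countable[OF stable sub])
    show "emeasure M X = emeasure N X" if "X \<in> insert {} E" for X
      using that eq by (auto simp: E_def)
    show "\<Union> (cylinder k ({0, T} \<union> {}) ` {f \<in> {0, T} \<union> {} \<rightarrow>\<^sub>E grid k. \<forall>s\<in>{}. f s = (0::real)}) = cadlag_paths k"
      using cover[of "{}" "\<lambda>_. 0"] by simp
    show "emeasure M a \<noteq> \<infinity>" for a using finite_measure.emeasure_finite[OF fin] by simp
    show "cylinder k ({0, T} \<union> {}) ` {f \<in> {0, T} \<union> {} \<rightarrow>\<^sub>E grid k. \<forall>s\<in>{}. f s = (0::real)} \<subseteq> insert {} E"
      using inE[of "{}" "\<lambda>_. 0"] by blast
    show "countable (cylinder k ({0, T} \<union> {}) ` {f \<in> {0, T} \<union> {} \<rightarrow>\<^sub>E grid k. \<forall>s\<in>{}. f s = (0::real)})"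
      using fin_cover[of "{}" "\<lambda>_. 0"] by (intro countable_finite) auto
  qed (use M N gen in auto)
qed

locale chain = nearest_neighbour k G a b c M
  for k :: nat and G :: "(real \<Rightarrow> real) \<Rightarrow> real \<Rightarrow> real" and a b c M +
  fixes p :: "real \<Rightarrow> real" and P :: "(real \<Rightarrow> real) measure"
  assumes law: "chain_law k G p P"
begin

sublocale prob_space P using law by (simp add: chain_law_def)

lemma sets_P: "sets P = sets (skorohod_space k)"
  using law by (simp add: chain_law_def)

lemma space_P [simp]: "space P = cadlag_paths k"
  using sets_eq_imp_space_eq[OF sets_P] by simp

lemma subalg: "subalgebra P (path_sigma_upto k T)"
  by (rule subalgebra_path_sigma_upto[OF sets_P])

lemma measurable_upto: "f \<in> measurable (path_sigma_upto k T) N \<Longrightarrow> f \<in> measurable P N"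
  by (rule measurable_from_subalg[OF subalg])

lemma upto_in_events: "A \<in> sets (path_sigma_upto k T) \<Longrightarrow> A \<in> events"
  using subalg[of T] by (auto simp: subalgebra_def)

lemma coordinate_measurable_P: "0 \<le> t \<Longrightarrow> (\<lambda>\<omega>. g (\<omega> t) :: real) \<in> borel_measurable P"
  by (rule measurable_upto[OF coordinate_measurable]) auto

lemma integrable_coordinate:
  assumes "0 \<le> t"
  shows "integrable P (\<lambda>\<omega>. g (\<omega> t) :: real)"
proof -
  obtain B where "\<And>y. y \<in> grid k \<Longrightarrow> \<bar>g y\<bar> \<le> B" using bounded_on_grid[of k g] by blast
  then show ?thesis
    using assms path_in_grid by (intro integrable_const_bound[of _ B] AE_I2 coordinate_measurable_P) auto
qed

lemma chain_law_prob:
  assumes "t 0 = 0" "\<And>i. i < n \<Longrightarrow> t i \<le> t (Suc i)" "\<And>i. i \<le> n \<Longrightarrow> x i \<in> grid k"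
  shows "prob {\<omega> \<in> cadlag_paths k. \<forall>i\<le>n. \<omega> (t i) = x i} =
      p (x 0) * (\<Prod>i<n. op_exp G (t (Suc i) - t i) (indicator {x (Suc i)}) (x i))"
  using law assms unfolding chain_law_def by simp

lemma cylinder_initial:
  assumes "x 0 \<in> grid k"
  shows "prob (cylinder k {0} x) = p (x 0)"
  using chain_law_prob[of "\<lambda>_. 0" 0 "\<lambda>_. x 0"] assms by (simp add: cylinder_def)

text \<open>The Markov property for finite-dimensional distributions, arranged so that cylinder probabilities
  can be computed by induction on the set of observation times, adding the latest one.\<close>

lemma cylinder_extend:
  assumes S: "finite S" "0 \<in> S" "S \<subseteq> {0..t}" and x: "x \<in> S \<rightarrow> grid k" and y: "y \<in> grid k"
  shows "prob {\<omega> \<in> cylinder k S x. \<omega> t = y} =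
           prob (cylinder k S x) * op_exp G (t - Max S) (indicator {y}) (x (Max S))"
proof -
  define l where "l = sorted_list_of_set S"
  define n where "n = length l - 1"
  have l: "set l = S" "sorted l" using S by (auto simp: l_def)
  have ln: "length l = Suc n" using l S by (cases l) (auto simp: n_def)
  have set: "S = (!) l ` {..n}"
    unfolding l(1)[symmetric] set_conv_nth ln by (auto simp: less_Suc_eq_le)
  have mono: "l ! i \<le> l ! j" if "i \<le> j" "j \<le> n" for i j
    using sorted_nth_mono[OF l(2) that(1)] that ln by simp
  have max: "Max S = l ! n"
    using S mono unfolding set by (intro Max_eqI) auto
  have zero: "l ! 0 = 0"
  proof -
    obtain i where i: "i \<le> n" "0 = l ! i" using S(2) unfolding set by auto
    have "l ! 0 \<le> 0" using mono[of 0 i] i by simp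
    moreover have "l ! 0 \<in> S" unfolding set by auto
    ultimately show ?thesis using S by force
  qed
  define \<tau> where "\<tau> i = (if i \<le> n then l ! i else t)" for i
  define \<xi> where "\<xi> i = (if i \<le> n then x (l ! i) else y)" for i
  have \<xi>: "\<xi> i \<in> grid k" for i using x y set by (auto simp: \<xi>_def)
  have \<tau>: "\<tau> i \<le> \<tau> (Suc i)" if "i \<le> n" for i
  proof (cases "i = n")
    case True
    then show ?thesis using S(3) set by (auto simp: \<tau>_def)
  qed (use that mono[of i "Suc i"] in \<open>auto simp: \<tau>_def\<close>)
  have 0: "\<tau> 0 = 0" using zero by (simp add: \<tau>_def)
  have "cylinder k S x = {\<omega> \<in> cadlag_paths k. \<forall>i\<le>n. \<omega> (\<tau> i) = \<xi> i}"
    unfolding cylinder_def set by (auto simp: \<tau>_def \<xi>_def)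
  then have 1: "prob (cylinder k S x) =
      p (\<xi> 0) * (\<Prod>i<n. op_exp G (\<tau> (Suc i) - \<tau> i) (indicator {\<xi> (Suc i)}) (\<xi> i))"
    using chain_law_prob[of \<tau> n \<xi>] 0 \<tau> \<xi> by simp
  have "{\<omega> \<in> cylinder k S x. \<omega> t = y} = {\<omega> \<in> cadlag_paths k. \<forall>i\<le>Suc n. \<omega> (\<tau> i) = \<xi> i}"
    unfolding cylinder_def set by (auto simp: \<tau>_def \<xi>_def le_Suc_eq)
  then have "prob {\<omega> \<in> cylinder k S x. \<omega> t = y} =
      p (\<xi> 0) * (\<Prod>i<Suc n. op_exp G (\<tau> (Suc i) - \<tau> i) (indicator {\<xi> (Suc i)}) (\<xi> i))"
    using chain_law_prob[of \<tau> "Suc n" \<xi>] 0 \<tau> \<xi> by simp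
  then show ?thesis using 1 by (simp add: \<tau>_def \<xi>_def max)
qed

lemma cylinder_events:
  assumes "finite S" "S \<subseteq> {0..}" "x \<in> S \<rightarrow> grid k"
  shows "cylinder k S x \<in> events"
proof (cases "S = {}")
  case True
  then show ?thesis using sets.top[of P] by (simp add: cylinder_def)
next
  case False
  then show ?thesis using assms
    by (intro upto_in_events[OF cylinder_in_sets[where T = "Max S"]]) (auto intro: Max_ge)
qed

lemma cylinder_markov:
  assumes S: "finite S" "{0, s} \<subseteq> S" "S \<subseteq> {0..s}" and x: "x \<in> S \<rightarrow> grid k" and st: "s \<le> t"
  shows "(\<integral>\<omega>. indicator (cylinder k S x) \<omega> * f (\<omega> t) \<partial>P) =
         (\<integral>\<omega>. indicator (cylinder k S x) \<omega> * op_exp G (t - s) f (\<omega> s) \<partial>P)"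
proof -
  have s0: "0 \<le> s" using S by auto
  have Max: "Max S = s" using S by (intro Max_eqI) auto
  have C: "cylinder k S x \<in> events" using S by (intro cylinder_events x) auto
  have Cy: "{\<omega> \<in> cylinder k S x. \<omega> t = y} \<in> events" if "y \<in> grid k" for y
  proof -
    have "{\<omega> \<in> cylinder k S x. \<omega> t = y} = cylinder k S x \<inter> cylinder k {t} (\<lambda>_. y)"
      by (auto simp: cylinder_def)
    also have "\<dots> \<in> events" using s0 st that by (intro sets.Int C cylinder_events) auto
    finally show ?thesis .
  qed
  have "(\<integral>\<omega>. indicator (cylinder k S x) \<omega> * f (\<omega> t) \<partial>P)
      = (\<integral>\<omega>. (\<Sum>y\<in>grid k. f y * indicator {\<omega> \<in> cylinder k S x. \<omega> t = y} \<omega>) \<partial>P)"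
  proof (intro Bochner_Integration.integral_cong refl)
    fix \<omega> assume "\<omega> \<in> space P"
    then have "\<omega> t \<in> grid k" using path_in_grid s0 st by auto
    have "(\<Sum>y\<in>grid k. f y * indicator {\<omega> \<in> cylinder k S x. \<omega> t = y} \<omega>)
        = (\<Sum>y\<in>grid k. if y = \<omega> t then f y * indicator (cylinder k S x) \<omega> else 0)"
      by (intro sum.cong) (auto simp: indicator_def)
    then show "indicator (cylinder k S x) \<omega> * f (\<omega> t) = (\<Sum>y\<in>grid k. f y * indicator {\<omega> \<in> cylinder k S x. \<omega> t = y} \<omega>)"
      using \<open>\<omega> t \<in> grid k\<close> by simp
  qed
  also have "\<dots> = (\<Sum>y\<in>grid k. f y * prob {\<omega> \<in> cylinder k S x. \<omega> t = y})"
  proof (subst Bochner_Integration.integral_sum)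
    have "{\<omega> \<in> cylinder k S x. \<omega> t = y} \<inter> cadlag_paths k = {\<omega> \<in> cylinder k S x. \<omega> t = y}" for y
      by (auto simp: cylinder_def)
    then show "(\<Sum>y\<in>grid k. \<integral>\<omega>. f y * indicator {\<omega> \<in> cylinder k S x. \<omega> t = y} \<omega> \<partial>P)
        = (\<Sum>y\<in>grid k. f y * prob {\<omega> \<in> cylinder k S x. \<omega> t = y})"
      by simp
  qed (use Cy in \<open>auto intro!: integrable_mult_right integrable_real_indicator simp: emeasure_eq_measure\<close>)
  also have "\<dots> = prob (cylinder k S x) * op_exp G (t - s) f (x s)"
  proof -
    have "prob {\<omega> \<in> cylinder k S x. \<omega> t = y} = prob (cylinder k S x) * op_exp G (t - s) (indicator {y}) (x s)"
      if "y \<in> grid k" for y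
      using cylinder_extend[of S t x y] S x st that by (fastforce simp: Max)
    then have "(\<Sum>y\<in>grid k. f y * prob {\<omega> \<in> cylinder k S x. \<omega> t = y})
        = (\<Sum>y\<in>grid k. prob (cylinder k S x) * (f y * op_exp G (t - s) (indicator {y}) (x s)))"
      by (intro sum.cong) (simp_all add: mult_ac)
    moreover have "x s \<in> grid k" using S x by auto
    ultimately show ?thesis
      by (simp add: op_exp_indicator_expansion[of "x s" _ f] sum_distrib_left)
  qed
  also have "\<dots> = (\<integral>\<omega>. indicator (cylinder k S x) \<omega> * op_exp G (t - s) f (x s) \<partial>P)"
    using C sets.sets_into_space[OF C] by (simp add: Int_absorb2)
  also have "\<dots> = (\<integral>\<omega>. indicator (cylinder k S x) \<omega> * op_exp G (t - s) f (\<omega> s) \<partial>P)"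
    using S(2) by (intro Bochner_Integration.integral_cong refl) (force simp: indicator_def cylinder_def)
  finally show ?thesis .
qed

lemma integrable_weighted_coordinate:
  fixes Z :: "(real \<Rightarrow> real) \<Rightarrow> real" and g :: "real \<Rightarrow> real"
  assumes Z: "Z \<in> borel_measurable P" "\<And>\<omega>. \<omega> \<in> cadlag_paths k \<Longrightarrow> \<bar>Z \<omega>\<bar> \<le> B" and t: "0 \<le> t"
  shows "integrable P (\<lambda>\<omega>. Z \<omega> * g (\<omega> t))"
proof -
  obtain B' where B': "\<And>y. y \<in> grid k \<Longrightarrow> \<bar>g y\<bar> \<le> B'" using bounded_on_grid[of k g] by blast
  show ?thesis
  proof (rule integrable_const_bound[of _ "\<bar>B\<bar> * \<bar>B'\<bar>"])
    show "AE \<omega> in P. norm (Z \<omega> * g (\<omega> t)) \<le> \<bar>B\<bar> * \<bar>B'\<bar>"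
    proof (rule AE_I2)
      fix \<omega> assume "\<omega> \<in> space P"
      then show "norm (Z \<omega> * g (\<omega> t)) \<le> \<bar>B\<bar> * \<bar>B'\<bar>"
        using Z(2)[of \<omega>] B'[OF path_in_grid[of \<omega> k t]] t
        by (auto simp: abs_mult intro!: mult_mono)
    qed
  qed (intro borel_measurable_times Z coordinate_measurable_P t)
qed

lemma weighted_measure:
  fixes X :: "(real \<Rightarrow> real) \<Rightarrow> real" and T :: real
  assumes X: "X \<in> borel_measurable P" "\<And>\<omega>. \<omega> \<in> cadlag_paths k \<Longrightarrow> 0 \<le> X \<omega> \<and> X \<omega> \<le> (B::real)"
  defines "N \<equiv> restr_to_subalg (density P (\<lambda>\<omega>. ennreal (X \<omega>))) (path_sigma_upto k T)"
  shows "sets N = sets (path_sigma_upto k T)" "finite_measure N"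
    and "A \<in> sets (path_sigma_upto k T) \<Longrightarrow> emeasure N A = ennreal (\<integral>\<omega>. indicator A \<omega> * X \<omega> \<partial>P)"
proof -
  have sub: "subalgebra (density P (\<lambda>\<omega>. ennreal (X \<omega>))) (path_sigma_upto k T)"
    using subalg[of T] by (simp add: subalgebra_def)
  have eq: "emeasure (density P (\<lambda>\<omega>. ennreal (X \<omega>))) A = ennreal (\<integral>\<omega>. indicator A \<omega> * X \<omega> \<partial>P)"
    if A: "A \<in> events" for A
  proof -
    have "emeasure (density P (\<lambda>\<omega>. ennreal (X \<omega>))) A = (\<integral>\<^sup>+\<omega>. ennreal (indicator A \<omega> * X \<omega>) \<partial>P)"
      using A X(1) by (subst emeasure_density) (auto intro!: nn_integral_cong simp: indicator_def)
    also have "\<dots> = ennreal (\<integral>\<omega>. indicator A \<omega> * X \<omega> \<partial>P)"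
    proof (rule nn_integral_eq_integral)
      show "integrable P (\<lambda>\<omega>. indicator A \<omega> * X \<omega>)"
      proof -
        have "integrable P X" using X(2) by (intro integrable_const_bound[of X B] AE_I2 X(1)) auto
        then show ?thesis using integrable_mult_indicator[OF A] by fastforce
      qed
    qed (use X(2) in \<open>auto simp: indicator_def\<close>)
    finally show ?thesis .
  qed
  show "sets N = sets (path_sigma_upto k T)" unfolding N_def by (rule sets_restr_to_subalg[OF sub])
  show "emeasure N A = ennreal (\<integral>\<omega>. indicator A \<omega> * X \<omega> \<partial>P)" if "A \<in> sets (path_sigma_upto k T)"
    unfolding N_def using emeasure_restr_to_subalg[OF sub that] eq[OF upto_in_events[OF that]] by simp
  have "emeasure (density P (\<lambda>\<omega>. ennreal (X \<omega>))) (space P) \<noteq> \<infinity>" using eq[OF sets.top] by simp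
  then have "finite_measure (density P (\<lambda>\<omega>. ennreal (X \<omega>)))" by (intro finite_measureI) simp
  then show "finite_measure N" unfolding N_def by (rule finite_measure_restr_to_subalg[OF sub])
qed

text \<open>Cylinder events determine a finite measure, so both sides are turned into measures of \<open>A\<close>: adding
  the constant \<open>B\<close> makes the two observables nonnegative, hence densities.\<close>

lemma markov_event:
  assumes s: "0 \<le> s" "s \<le> t" and A: "A \<in> sets (path_sigma_upto k s)"
  shows "(\<integral>\<omega>. indicator A \<omega> * f (\<omega> t) \<partial>P) = (\<integral>\<omega>. indicator A \<omega> * op_exp G (t - s) f (\<omega> s) \<partial>P)"
proof -
  define g where "g = op_exp G (t - s) f"
  obtain B1 where B1: "\<And>y. y \<in> grid k \<Longrightarrow> \<bar>f y\<bar> \<le> B1" using bounded_on_grid[of k f] by blast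
  obtain B2 where B2: "\<And>y. y \<in> grid k \<Longrightarrow> \<bar>g y\<bar> \<le> B2" using bounded_on_grid[of k g] by blast
  define B where "B = max B1 B2"
  have B: "\<bar>f y\<bar> \<le> B" "\<bar>g y\<bar> \<le> B" if "y \<in> grid k" for y
    using B1[OF that] B2[OF that] by (auto simp: B_def)
  define X where "X \<omega> = f (\<omega> t) + B" for \<omega> :: "real \<Rightarrow> real"
  define Y where "Y \<omega> = g (\<omega> s) + B" for \<omega> :: "real \<Rightarrow> real"
  have Xm: "X \<in> borel_measurable P" "Y \<in> borel_measurable P"
    unfolding X_def[abs_def] Y_def[abs_def] using s by (intro borel_measurable_add coordinate_measurable_P; simp)+
  have Xb: "0 \<le> X \<omega> \<and> X \<omega> \<le> 2 * B" "0 \<le> Y \<omega> \<and> Y \<omega> \<le> 2 * B" if "\<omega> \<in> cadlag_paths k" for \<omega>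
    using B(1)[OF path_in_grid[OF that, of t]] B(2)[OF path_in_grid[OF that, of s]] s
    by (auto simp: X_def Y_def abs_le_iff)
  have split: "(\<integral>\<omega>. indicator A \<omega> * X \<omega> \<partial>P) = (\<integral>\<omega>. indicator A \<omega> * f (\<omega> t) \<partial>P) + B * prob A"
    "(\<integral>\<omega>. indicator A \<omega> * Y \<omega> \<partial>P) = (\<integral>\<omega>. indicator A \<omega> * g (\<omega> s) \<partial>P) + B * prob A"
    if A: "A \<in> events" for A
  proof -
    have i: "integrable P (\<lambda>\<omega>. indicator A \<omega> * h (\<omega> r))" if "0 \<le> r" for h :: "real \<Rightarrow> real" and r
      using integrable_mult_indicator[OF A integrable_coordinate[OF that, of h]] by simp
    have iB: "integrable P (\<lambda>\<omega>. indicator A \<omega> * B)"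
      using A by (intro integrable_mult_left integrable_real_indicator) (auto simp: emeasure_eq_measure)
    show "(\<integral>\<omega>. indicator A \<omega> * X \<omega> \<partial>P) = (\<integral>\<omega>. indicator A \<omega> * f (\<omega> t) \<partial>P) + B * prob A"
      unfolding X_def distrib_left using i[of t f] iB s A sets.sets_into_space[OF A]
      by (subst Bochner_Integration.integral_add) (auto simp: Int_absorb2)
    show "(\<integral>\<omega>. indicator A \<omega> * Y \<omega> \<partial>P) = (\<integral>\<omega>. indicator A \<omega> * g (\<omega> s) \<partial>P) + B * prob A"
      unfolding Y_def distrib_left using i[of s g] iB s A sets.sets_into_space[OF A]
      by (subst Bochner_Integration.integral_add) (auto simp: Int_absorb2)
  qed
  note wX = weighted_measure[where X = X and T = s, OF Xm(1) Xb(1)]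
  note wY = weighted_measure[where X = Y and T = s, OF Xm(2) Xb(2)]
  have "restr_to_subalg (density P (\<lambda>\<omega>. ennreal (X \<omega>))) (path_sigma_upto k s)
      = restr_to_subalg (density P (\<lambda>\<omega>. ennreal (Y \<omega>))) (path_sigma_upto k s)"
  proof (rule path_measure_eqI[OF s(1) wX(1) wY(1) wX(2)])
    fix S x assume S: "finite S" "{0, s} \<subseteq> S" "S \<subseteq> {0..s}" "x \<in> S \<rightarrow> grid k"
    have C: "cylinder k S x \<in> sets (path_sigma_upto k s)" by (intro cylinder_in_sets S)
    have "(\<integral>\<omega>. indicator (cylinder k S x) \<omega> * X \<omega> \<partial>P) = (\<integral>\<omega>. indicator (cylinder k S x) \<omega> * Y \<omega> \<partial>P)"
      unfolding split[OF upto_in_events[OF C]] using cylinder_markov[OF S s(2), of f] by (simp add: g_def)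
    then show "emeasure (restr_to_subalg (density P (\<lambda>\<omega>. ennreal (X \<omega>))) (path_sigma_upto k s)) (cylinder k S x)
      = emeasure (restr_to_subalg (density P (\<lambda>\<omega>. ennreal (Y \<omega>))) (path_sigma_upto k s)) (cylinder k S x)"
      by (simp add: wX(3)[OF _ C] wY(3)[OF _ C])
  qed auto
  then have "ennreal (\<integral>\<omega>. indicator A \<omega> * X \<omega> \<partial>P) = ennreal (\<integral>\<omega>. indicator A \<omega> * Y \<omega> \<partial>P)"
    using wX(3)[OF _ A] wY(3)[OF _ A] by simp
  then have "(\<integral>\<omega>. indicator A \<omega> * X \<omega> \<partial>P) = (\<integral>\<omega>. indicator A \<omega> * Y \<omega> \<partial>P)"
    using Xb by (subst (asm) ennreal_inj) (auto intro!: Bochner_Integration.integral_nonneg_AE AE_I2 simp: indicator_def)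
  then show ?thesis unfolding split[OF upto_in_events[OF A]] by (simp add: g_def)
qed

text \<open>Passing from events of the past to bounded functionals of the past is the defining property of
  conditional expectation.\<close>

lemma markov:
  assumes s: "0 \<le> s" "s \<le> t"
    and Z: "Z \<in> borel_measurable (path_sigma_upto k s)" "\<And>\<omega>. \<omega> \<in> cadlag_paths k \<Longrightarrow> \<bar>Z \<omega>\<bar> \<le> (B::real)"
  shows "(\<integral>\<omega>. Z \<omega> * f (\<omega> t) \<partial>P) = (\<integral>\<omega>. Z \<omega> * op_exp G (t - s) f (\<omega> s) \<partial>P)"
proof -
  interpret F: finite_measure_subalgebra P "path_sigma_upto k s"
    by unfold_locales (rule subalg)
  have ae: "AE \<omega> in P. real_cond_exp P (path_sigma_upto k s) (\<lambda>\<omega>. f (\<omega> t)) \<omega> = op_exp G (t - s) f (\<omega> s)"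
    using s markov_event[OF s, of _ f]
    by (intro F.real_cond_exp_charact integrable_coordinate coordinate_measurable)
       (auto simp: set_lebesgue_integral_def)
  have int: "integrable P (\<lambda>\<omega>. Z \<omega> * f (\<omega> t))"
    using s by (intro integrable_weighted_coordinate[OF measurable_upto[OF Z(1)] Z(2)]) auto
  have "(\<integral>\<omega>. Z \<omega> * f (\<omega> t) \<partial>P) = (\<integral>\<omega>. Z \<omega> * real_cond_exp P (path_sigma_upto k s) (\<lambda>\<omega>. f (\<omega> t)) \<omega> \<partial>P)"
    using s by (intro F.real_cond_exp_intg(2)[symmetric] int Z coordinate_measurable_P) auto
  also have "\<dots> = (\<integral>\<omega>. Z \<omega> * op_exp G (t - s) f (\<omega> s) \<partial>P)"
    using ae measurable_upto[OF Z(1)] s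
    by (intro integral_cong_AE borel_measurable_times coordinate_measurable_P
        measurable_upto[OF borel_measurable_cond_exp]) auto
  finally show ?thesis .
qed

end

section \<open>The Feynman-Kac formula\<close>

definition path_int :: "(real \<Rightarrow> real) \<Rightarrow> real \<Rightarrow> real \<Rightarrow> (real \<Rightarrow> real) \<Rightarrow> real" where
  "path_int W s t \<omega> = (LINT r:{s<..t}|lborel. W (\<omega> r))"

definition riemann_sum :: "(real \<Rightarrow> real) \<Rightarrow> real \<Rightarrow> real \<Rightarrow> (real \<Rightarrow> real) \<Rightarrow> nat \<Rightarrow> real" where
  "riemann_sum W s t \<omega> N = (\<Sum>i<N. (t - s) / real N * W (\<omega> (s + real (Suc i) * ((t - s) / real N))))"

lemma path_right_continuous:
  assumes "\<omega> \<in> cadlag_paths k" "0 \<le> r" "isCont W (\<omega> r)"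
  shows "((\<lambda>r. W (\<omega> r)) \<longlongrightarrow> W (\<omega> r)) (at_right r)"
  using assms by (intro isCont_tendsto_compose[OF assms(3)]) (auto simp: cadlag_paths_def)

lemma riemann_sum_bound:
  assumes "\<omega> \<in> cadlag_paths k" "0 \<le> s" "s \<le> t" "\<And>x. x \<in> grid k \<Longrightarrow> \<bar>W x\<bar> \<le> w"
  shows "\<bar>riemann_sum W s t \<omega> N\<bar> \<le> (t - s) * w"
proof -
  have w: "0 \<le> w" using assms(4)[OF path_in_grid[OF assms(1), of 0]] by simp
  have "\<bar>riemann_sum W s t \<omega> N\<bar> \<le> (\<Sum>i<N. (t - s) / real N * w)"
    unfolding riemann_sum_def
  proof (rule order_trans[OF sum_abs sum_mono])
    fix i
    show "\<bar>(t - s) / real N * W (\<omega> (s + real (Suc i) * ((t - s) / real N)))\<bar> \<le> (t - s) / real N * w"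
      unfolding abs_mult using assms by (intro mult_mono assms(4) path_in_grid) auto
  qed
  also have "\<dots> \<le> (t - s) * w" using w assms by simp
  finally show ?thesis .
qed

lemma
  assumes "\<omega> \<in> cadlag_paths k" "0 \<le> s" "s \<le> t" "\<And>x. x \<in> grid k \<Longrightarrow> isCont W x"
  shows path_int_integrable: "set_integrable lborel {s<..t} (\<lambda>r. W (\<omega> r))"
    and riemann_sum_tendsto: "riemann_sum W s t \<omega> \<longlonglongrightarrow> path_int W s t \<omega>"
proof -
  obtain w where w: "\<And>x. x \<in> grid k \<Longrightarrow> \<bar>W x\<bar> \<le> w" using bounded_on_grid[of k W] by blast
  have rc: "((\<lambda>r. W (\<omega> r)) \<longlongrightarrow> W (\<omega> r)) (at_right r)" if "s \<le> r" "r \<le> t" for r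
    using assms that path_in_grid[OF assms(1), of r] by (intro path_right_continuous) auto
  have B: "\<bar>W (\<omega> r)\<bar> \<le> w" if "s \<le> r" "r \<le> t" for r
    using assms that path_in_grid[OF assms(1), of r] w by auto
  show "set_integrable lborel {s<..t} (\<lambda>r. W (\<omega> r))"
    by (rule riemann_sums_right(1)[where f = "\<lambda>r. W (\<omega> r)", OF assms(3) rc B])
  show "riemann_sum W s t \<omega> \<longlonglongrightarrow> path_int W s t \<omega>"
    unfolding riemann_sum_def[abs_def] path_int_def
    by (rule riemann_sums_right(2)[where f = "\<lambda>r. W (\<omega> r)", OF assms(3) rc B])
qed

lemma path_int_bound:
  assumes "\<omega> \<in> cadlag_paths k" "0 \<le> s" "s \<le> t" "\<And>x. x \<in> grid k \<Longrightarrow> isCont W x"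
    "\<And>x. x \<in> grid k \<Longrightarrow> \<bar>W x\<bar> \<le> w"
  shows "\<bar>path_int W s t \<omega>\<bar> \<le> (t - s) * w"
proof (rule LIMSEQ_le_const2[OF tendsto_rabs[OF riemann_sum_tendsto[of \<omega> k s t W]]])
  show "\<exists>N. \<forall>n\<ge>N. \<bar>riemann_sum W s t \<omega> n\<bar> \<le> (t - s) * w"
    using riemann_sum_bound[where W = W, OF assms(1-3,5)] by auto
qed (use assms in auto)

lemma path_int_add:
  assumes "\<omega> \<in> cadlag_paths k" "0 \<le> r" "r \<le> s" "s \<le> t" "\<And>x. x \<in> grid k \<Longrightarrow> isCont W x"
  shows "path_int W r t \<omega> = path_int W r s \<omega> + path_int W s t \<omega>"
proof -
  have "{r<..t} = {r<..s} \<union> {s<..t}" using assms by auto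
  then show ?thesis unfolding path_int_def
    by (simp only:) (rule set_integral_Un; use assms in \<open>auto intro!: path_int_integrable[of \<omega> k]\<close>)
qed

lemma riemann_sum_measurable:
  assumes "0 \<le> s" "s \<le> t"
  shows "(\<lambda>\<omega>. riemann_sum W s t \<omega> N) \<in> borel_measurable (path_sigma_upto k t)"
  unfolding riemann_sum_def
proof (intro borel_measurable_sum borel_measurable_times borel_measurable_const coordinate_measurable)
  fix i assume i: "i \<in> {..<N}"
  show "0 \<le> s + real (Suc i) * ((t - s) / real N)" using assms by simp
  have "real (Suc i) * ((t - s) / real N) \<le> real N * ((t - s) / real N)"
    using i assms by (intro mult_right_mono) auto
  then show "s + real (Suc i) * ((t - s) / real N) \<le> t" using i by simp
qed

lemma path_int_measurable:
  assumes "0 \<le> s" "s \<le> t" "\<And>x. x \<in> grid k \<Longrightarrow> isCont W x"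
  shows "path_int W s t \<in> borel_measurable (path_sigma_upto k t)"
proof (rule borel_measurable_LIMSEQ_real)
  show "(\<lambda>N. riemann_sum W s t \<omega> N) \<longlonglongrightarrow> path_int W s t \<omega>" if "\<omega> \<in> space (path_sigma_upto k t)" for \<omega>
    using that assms by (intro riemann_sum_tendsto[of \<omega> k]) auto
  show "(\<lambda>\<omega>. riemann_sum W s t \<omega> N) \<in> borel_measurable (path_sigma_upto k t)" for N
    by (rule riemann_sum_measurable[OF assms(1,2)])
qed

context chain
begin

text \<open>For a Riemann sum the Feynman-Kac formula is exact: each mesh point costs one use of the Markov
  property, with the factors before it absorbed into the functional of the past.\<close>

lemma feynman_kac_discrete:
  assumes s: "0 \<le> s" "0 \<le> d"
    and Z: "Z \<in> borel_measurable (path_sigma_upto k s)" "\<And>\<omega>. \<omega> \<in> cadlag_paths k \<Longrightarrow> \<bar>Z \<omega>\<bar> \<le> (B::real)"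
  shows "(\<integral>\<omega>. Z \<omega> * (\<Prod>i<N. exp (d * W (\<omega> (s + real (Suc i) * d)))) * f (\<omega> (s + real N * d)) \<partial>P)
       = (\<integral>\<omega>. Z \<omega> * (splitting_step G W d ^^ N) f (\<omega> s) \<partial>P)"
proof (induction N arbitrary: f)
  case (Suc N)
  obtain w where w: "\<And>x. x \<in> grid k \<Longrightarrow> \<bar>W x\<bar> \<le> w" using bounded_on_grid[of k W] by blast
  define Z' where "Z' \<omega> = Z \<omega> * (\<Prod>i<N. exp (d * W (\<omega> (s + real (Suc i) * d))))" for \<omega>
  have Z'm: "Z' \<in> borel_measurable (path_sigma_upto k (s + real N * d))"
    unfolding Z'_def[abs_def]
  proof (intro borel_measurable_times borel_measurable_prod
      path_sigma_upto_measurable_mono[OF _ Z(1)] coordinate_measurable[where g = "\<lambda>x. exp (d * W x)"])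
    fix i assume "i \<in> {..<N}"
    then have "real (Suc i) * d \<le> real N * d" using s by (intro mult_right_mono) auto
    then show "s + real (Suc i) * d \<le> s + real N * d" by simp
  qed (use s in auto)
  have Z'b: "\<bar>Z' \<omega>\<bar> \<le> \<bar>B\<bar> * exp (d * w) ^ N" if "\<omega> \<in> cadlag_paths k" for \<omega>
  proof -
    have "d * W (\<omega> (s + real (Suc i) * d)) \<le> d * w" for i
      using w[OF path_in_grid[OF that, of "s + real (Suc i) * d"]] s by (intro mult_left_mono) auto
    then have "(\<Prod>i<N. exp (d * W (\<omega> (s + real (Suc i) * d)))) \<le> (\<Prod>i<N. exp (d * w))"
      by (intro prod_mono) auto
    then show ?thesis unfolding Z'_def abs_mult using Z(2)[OF that]
      by (intro mult_mono) (auto simp: prod_nonneg abs_of_nonneg)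
  qed
  have "(\<integral>\<omega>. Z \<omega> * (\<Prod>i<Suc N. exp (d * W (\<omega> (s + real (Suc i) * d)))) * f (\<omega> (s + real (Suc N) * d)) \<partial>P)
      = (\<integral>\<omega>. Z' \<omega> * (\<lambda>x. exp (d * W x) * f x) (\<omega> (s + real (Suc N) * d)) \<partial>P)"
    by (simp add: Z'_def mult_ac)
  also have "\<dots> = (\<integral>\<omega>. Z' \<omega> * op_exp G (s + real (Suc N) * d - (s + real N * d)) (\<lambda>x. exp (d * W x) * f x) (\<omega> (s + real N * d)) \<partial>P)"
    using s by (intro markov[OF _ _ Z'm Z'b]) (auto simp: algebra_simps)
  also have "\<dots> = (\<integral>\<omega>. Z \<omega> * (\<Prod>i<N. exp (d * W (\<omega> (s + real (Suc i) * d)))) * splitting_step G W d f (\<omega> (s + real N * d)) \<partial>P)"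
    by (simp add: splitting_step_def Z'_def algebra_simps)
  also have "\<dots> = (\<integral>\<omega>. Z \<omega> * (splitting_step G W d ^^ N) (splitting_step G W d f) (\<omega> s) \<partial>P)"
    by (rule Suc.IH)
  finally show ?case by (simp only: funpow_Suc_right comp_apply)
qed simp

lemma integral_coordinate_sum:
  assumes Z: "Z \<in> borel_measurable P" "\<And>\<omega>. \<omega> \<in> cadlag_paths k \<Longrightarrow> \<bar>Z \<omega>\<bar> \<le> (B::real)" and s: "0 \<le> s"
  shows "(\<integral>\<omega>. Z \<omega> * g (\<omega> s) \<partial>P) = (\<Sum>y\<in>grid k. g y * (\<integral>\<omega>. Z \<omega> * indicator {y} (\<omega> s) \<partial>P))"
proof -
  have "(\<integral>\<omega>. Z \<omega> * g (\<omega> s) \<partial>P) = (\<integral>\<omega>. (\<Sum>y\<in>grid k. g y * (Z \<omega> * indicator {y} (\<omega> s))) \<partial>P)"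
  proof (intro Bochner_Integration.integral_cong refl)
    fix \<omega> assume "\<omega> \<in> space P"
    then have "\<omega> s \<in> grid k" using path_in_grid s by simp
    have "(\<Sum>y\<in>grid k. g y * (Z \<omega> * indicator {y} (\<omega> s))) = (\<Sum>y\<in>grid k. if y = \<omega> s then Z \<omega> * g y else 0)"
      by (intro sum.cong) (auto simp: indicator_def)
    then show "Z \<omega> * g (\<omega> s) = (\<Sum>y\<in>grid k. g y * (Z \<omega> * indicator {y} (\<omega> s)))"
      using \<open>\<omega> s \<in> grid k\<close> by simp
  qed
  also have "\<dots> = (\<Sum>y\<in>grid k. g y * (\<integral>\<omega>. Z \<omega> * indicator {y} (\<omega> s) \<partial>P))"
    by (subst Bochner_Integration.integral_sum)
       (auto intro!: integrable_mult_right integrable_weighted_coordinate[OF Z s])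
  finally show ?thesis .
qed

text \<open>In the limit of fine meshes the path side converges by dominated convergence and the operator
  side by the Trotter formula. The functional \<open>Z\<close> of the past lets the formula be iterated along the
  observation times of a cylinder event.\<close>

lemma feynman_kac:
  assumes st: "0 \<le> s" "s \<le> t"
    and Z: "Z \<in> borel_measurable (path_sigma_upto k s)" "\<And>\<omega>. \<omega> \<in> cadlag_paths k \<Longrightarrow> \<bar>Z \<omega>\<bar> \<le> (B::real)"
    and S: "nearest_neighbour k S a b c' (M + w)" "\<And>x. c' x = c x + W x"
    and W: "\<And>x. x \<in> grid k \<Longrightarrow> \<bar>W x\<bar> \<le> w" "\<And>x. x \<in> grid k \<Longrightarrow> isCont W x"
  shows "(\<integral>\<omega>. Z \<omega> * exp (path_int W s t \<omega>) * f (\<omega> t) \<partial>P) = (\<integral>\<omega>. Z \<omega> * op_exp S (t - s) f (\<omega> s) \<partial>P)"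
proof (rule LIMSEQ_unique)
  define Y where "Y N \<omega> = Z \<omega> * exp (riemann_sum W s t \<omega> N) * f (\<omega> t)" for N \<omega>
  obtain C where C: "\<And>y. y \<in> grid k \<Longrightarrow> \<bar>f y\<bar> \<le> C" using bounded_on_grid[of k f] by blast
  note Zm = measurable_upto[OF Z(1)]
  note rm = measurable_upto[OF riemann_sum_measurable[OF st, of W _ k]]
  have Ym: "Y N \<in> borel_measurable P" for N
    unfolding Y_def using st
    by (intro borel_measurable_times Zm borel_measurable_exp rm coordinate_measurable_P
        measurable_compose[OF rm, of exp borel]) auto
  have lim: "(\<lambda>N. Y N \<omega>) \<longlonglongrightarrow> Z \<omega> * exp (path_int W s t \<omega>) * f (\<omega> t)" if "\<omega> \<in> space P" for \<omega>
    unfolding Y_def using that W st by (intro tendsto_intros riemann_sum_tendsto[of \<omega> k]) auto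
  have bnd: "norm (Y N \<omega>) \<le> \<bar>B\<bar> * exp ((t - s) * w) * C" if "\<omega> \<in> space P" for N \<omega>
  proof -
    have "riemann_sum W s t \<omega> N \<le> (t - s) * w"
      using riemann_sum_bound[of \<omega> k s t W w N] that st W by auto
    then show ?thesis
      unfolding Y_def real_norm_def abs_mult using that Z(2)[of \<omega>] C[OF path_in_grid[of \<omega> k t]] st
      by (intro mult_mono) auto
  qed
  have "(\<lambda>N. \<integral>\<omega>. Y N \<omega> \<partial>P) \<longlonglongrightarrow> (\<integral>\<omega>. Z \<omega> * exp (path_int W s t \<omega>) * f (\<omega> t) \<partial>P)"
  proof (rule integral_dominated_convergence)
    show "(\<lambda>\<omega>. Z \<omega> * exp (path_int W s t \<omega>) * f (\<omega> t)) \<in> borel_measurable P"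
      by (rule borel_measurable_LIMSEQ_real[OF lim Ym])
    show "integrable P (\<lambda>_. \<bar>B\<bar> * exp ((t - s) * w) * C)" by simp
  qed (use Ym lim bnd in auto)
  moreover have "\<forall>\<^sub>F N in sequentially. (\<integral>\<omega>. Y N \<omega> \<partial>P) =
      (\<Sum>y\<in>grid k. (splitting_step G W ((t - s) / real N) ^^ N) f y * (\<integral>\<omega>. Z \<omega> * indicator {y} (\<omega> s) \<partial>P))"
    using eventually_gt_at_top[of 0]
  proof eventually_elim
    case (elim N)
    define d where "d = (t - s) / real N"
    have d: "0 \<le> d" "s + real N * d = t" using elim st by (auto simp: d_def)
    have "(\<integral>\<omega>. Y N \<omega> \<partial>P) = (\<integral>\<omega>. Z \<omega> * (splitting_step G W d ^^ N) f (\<omega> s) \<partial>P)"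
      using feynman_kac_discrete[OF st(1) d(1) Z, where N = N and W = W and f = f] unfolding d(2)
      by (simp add: Y_def riemann_sum_def exp_sum flip: d_def)
    also have "\<dots> = (\<Sum>y\<in>grid k. (splitting_step G W d ^^ N) f y * (\<integral>\<omega>. Z \<omega> * indicator {y} (\<omega> s) \<partial>P))"
      by (rule integral_coordinate_sum[OF Zm Z(2) st(1)])
    finally show ?case unfolding d_def .
  qed
  ultimately show "(\<lambda>N. \<Sum>y\<in>grid k. (splitting_step G W ((t - s) / real N) ^^ N) f y * (\<integral>\<omega>. Z \<omega> * indicator {y} (\<omega> s) \<partial>P))
      \<longlonglongrightarrow> (\<integral>\<omega>. Z \<omega> * exp (path_int W s t \<omega>) * f (\<omega> t) \<partial>P)"
    by (rule Lim_transform_eventually)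
  have "nearest_neighbour k G a b c M" by unfold_locales
  note tr = trotter[OF this S W(1)]
  have eq: "(\<integral>\<omega>. Z \<omega> * op_exp S (t - s) f (\<omega> s) \<partial>P)
      = (\<Sum>y\<in>grid k. op_exp S (t - s) f y * (\<integral>\<omega>. Z \<omega> * indicator {y} (\<omega> s) \<partial>P))"
    by (rule integral_coordinate_sum[OF Zm Z(2) st(1)])
  show "(\<lambda>N. \<Sum>y\<in>grid k. (splitting_step G W ((t - s) / real N) ^^ N) f y * (\<integral>\<omega>. Z \<omega> * indicator {y} (\<omega> s) \<partial>P))
      \<longlonglongrightarrow> (\<integral>\<omega>. Z \<omega> * op_exp S (t - s) f (\<omega> s) \<partial>P)"
    unfolding eq using st by (intro tendsto_sum tendsto_mult tendsto_const tr) auto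
qed

end

section \<open>The density and the entropy of the Gibbs chain\<close>

definition tilted_operator :: "nat \<Rightarrow> (real \<Rightarrow> real) \<Rightarrow> real \<Rightarrow> (real \<Rightarrow> real) \<Rightarrow> real \<Rightarrow> real" where
  "tilted_operator k V lam f x = perturbed_operator k V f x - lam * f x"

lemma free_nearest_neighbour:
  "k \<ge> 1 \<Longrightarrow> nearest_neighbour k (free_generator k) (\<lambda>_. real k) (\<lambda>_. real k) (\<lambda>_. - 2 * real k) (4 * real k)"
  by unfold_locales (auto simp: free_generator_def discrete_laplacian_def algebra_simps)

lemma tilted_nearest_neighbour:
  assumes "k \<ge> 1" "\<And>x. x \<in> grid k \<Longrightarrow> \<bar>real k * V x - lam\<bar> \<le> w"
  shows "nearest_neighbour k (tilted_operator k V lam) (\<lambda>_. real k) (\<lambda>_. real k)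
           (\<lambda>x. - 2 * real k + (real k * V x - lam)) (4 * real k + w)"
proof unfold_locales
  show "\<bar>real k\<bar> + \<bar>real k\<bar> + \<bar>- 2 * real k + (real k * V x - lam)\<bar> \<le> 4 * real k + w" if "x \<in> grid k" for x
    using assms(2)[OF that] by (auto simp: abs_le_iff)
qed (use assms in \<open>auto simp: tilted_operator_def perturbed_operator_def discrete_laplacian_def algebra_simps\<close>)

lemma gibbs_nearest_neighbour:
  assumes "k \<ge> 1"
  obtains a b c M where "nearest_neighbour k (gibbs_generator k u) a b c M"
proof -
  define a where "a x = real k * u (next_site k x) / u x" for x
  define b where "b x = real k * u (prev_site k x) / u x" for x
  define c where "c x = - (a x + b x)" for x
  obtain M where "\<And>x. x \<in> grid k \<Longrightarrow> \<bar>\<bar>a x\<bar> + \<bar>b x\<bar> + \<bar>c x\<bar>\<bar> \<le> M" using bounded_on_grid[of k "\<lambda>x. \<bar>a x\<bar> + \<bar>b x\<bar> + \<bar>c x\<bar>"] by blast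
  then have "nearest_neighbour k (gibbs_generator k u) a b c M"
  proof unfold_locales
    show "gibbs_generator k u f x = a x * f (next_site k x) + b x * f (prev_site k x) + c x * f x" for f x
      by (simp add: gibbs_generator_def a_def b_def c_def algebra_simps diff_divide_distrib)
    show "\<bar>a x\<bar> + \<bar>b x\<bar> + \<bar>c x\<bar> \<le> M" if "x \<in> grid k" for x
      using \<open>\<And>x. x \<in> grid k \<Longrightarrow> \<bar>\<bar>a x\<bar> + \<bar>b x\<bar> + \<bar>c x\<bar>\<bar> \<le> M\<close>[OF that] by simp
  qed (rule assms)
  then show ?thesis using that by blast
qed

text \<open>The Gibbs generator is the Doob transform of the tilted operator: by the eigenvalue equation
  \<open>k V - lam\<close> is minus \<open>k\<close> times the Laplacian of \<open>u\<close> divided by \<open>u\<close>, which accounts exactly for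
  the diagonal part.\<close>

lemma gibbs_conjugation:
  assumes k: "k \<ge> 1" and u: "\<And>x. x \<in> grid k \<Longrightarrow> 0 < u x"
    and eig: "\<And>x. x \<in> grid k \<Longrightarrow> perturbed_operator k V u x = lam * u x"
    and x: "x \<in> grid k"
  shows "op_exp (gibbs_generator k u) t f x = op_exp (tilted_operator k V lam) t (\<lambda>y. u y * f y) x / u x"
proof -
  define S where "S = tilted_operator k V lam"
  obtain w where w: "\<And>x. x \<in> grid k \<Longrightarrow> \<bar>real k * V x - lam\<bar> \<le> w"
    using bounded_on_grid[of k "\<lambda>x. real k * V x - lam"] by blast
  interpret S: nearest_neighbour k S "\<lambda>_. real k" "\<lambda>_. real k" "\<lambda>x. - 2 * real k + (real k * V x - lam)" "4 * real k + w"
    unfolding S_def by (rule tilted_nearest_neighbour[OF k w])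
  have step: "u x * gibbs_generator k u g x = S (\<lambda>y. u y * g y) x" if x: "x \<in> grid k" for g x
  proof -
    have "(real k * V x - lam) * u x = - (real k * discrete_laplacian k u x)"
      using eig[OF x] by (simp add: perturbed_operator_def algebra_simps)
    then have "(real k * V x - lam) * (u x * g x) = - (real k * discrete_laplacian k u x) * g x"
      by (simp only: mult.assoc[symmetric])
    moreover have "u x * gibbs_generator k u g x = real k * u (next_site k x) * (g (next_site k x) - g x)
        + real k * u (prev_site k x) * (g (prev_site k x) - g x)"
      using u[OF x] by (simp add: gibbs_generator_def distrib_left)
    ultimately show ?thesis
      unfolding S.A_eq by (simp add: discrete_laplacian_def algebra_simps)
  qed
  have pow: "u x * (gibbs_generator k u ^^ n) f x = (S ^^ n) (\<lambda>y. u y * f y) x" if "x \<in> grid k" for n x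
    using that
  proof (induction n arbitrary: x)
    case (Suc n)
    have "u x * (gibbs_generator k u ^^ Suc n) f x = S (\<lambda>y. u y * (gibbs_generator k u ^^ n) f y) x"
      using step[OF Suc.prems] by simp
    also have "\<dots> = S ((S ^^ n) (\<lambda>y. u y * f y)) x"
      using next_site_in_grid[OF k Suc.prems] prev_site_in_grid[OF k Suc.prems] Suc
      unfolding S.A_eq by simp
    finally show ?case by simp
  qed simp
  obtain a b c M where "nearest_neighbour k (gibbs_generator k u) a b c M"
    using gibbs_nearest_neighbour[OF k] .
  then interpret G: nearest_neighbour k "gibbs_generator k u" a b c M .
  have "u x * op_exp (gibbs_generator k u) t f x = (\<Sum>n. u x * (t ^ n / fact n * (gibbs_generator k u ^^ n) f x))"
    unfolding op_exp_def by (rule suminf_mult[symmetric, OF G.summable_op_exp[OF x]])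
  also have "\<dots> = op_exp S t (\<lambda>y. u y * f y) x"
    unfolding op_exp_def using pow[OF x] by (intro suminf_cong) (simp add: field_simps)
  finally show ?thesis using u[OF x] by (simp add: S_def field_simps)
qed

lemma (in nearest_neighbour) stationary_op_exp:
  assumes "stationary_prob k A p"
  shows "(\<Sum>x\<in>grid k. p x * op_exp A t f x) = (\<Sum>x\<in>grid k. p x * f x)"
proof -
  have z: "(\<Sum>x\<in>grid k. p x * A g x) = 0" for g
    using assms by (simp add: stationary_prob_def)
  have "(\<Sum>x\<in>grid k. p x * op_exp A t f x) = (\<Sum>x\<in>grid k. \<Sum>n. p x * (t ^ n / fact n * (A ^^ n) f x))"
    unfolding op_exp_def by (intro sum.cong refl suminf_mult[symmetric] summable_op_exp)
  also have "\<dots> = (\<Sum>n. \<Sum>x\<in>grid k. p x * (t ^ n / fact n * (A ^^ n) f x))"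
    by (intro suminf_sum[symmetric] summable_mult summable_op_exp)
  also have "\<dots> = (\<Sum>n. t ^ n / fact n * (\<Sum>x\<in>grid k. p x * (A ^^ n) f x))"
    by (simp add: sum_distrib_left mult_ac)
  also have "\<dots> = (\<Sum>n\<in>{0}. t ^ n / fact n * (\<Sum>x\<in>grid k. p x * (A ^^ n) f x))"
  proof (rule suminf_finite)
    fix n :: nat assume "n \<notin> {0}"
    then obtain m where "n = Suc m" by (cases n) auto
    then show "t ^ n / fact n * (\<Sum>x\<in>grid k. p x * (A ^^ n) f x) = 0" using z[of "(A ^^ m) f"] by simp
  qed simp
  finally show ?thesis by simp
qed

lemma (in chain) expectation_initial:
  "(\<integral>\<omega>. g (\<omega> 0) \<partial>P) = (\<Sum>y\<in>grid k. g y * p y)"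
proof -
  have "(\<integral>\<omega>. 1 * g (\<omega> 0) \<partial>P) = (\<Sum>y\<in>grid k. g y * (\<integral>\<omega>. 1 * indicator {y} (\<omega> 0) \<partial>P))"
    by (rule integral_coordinate_sum[where B = 1]) auto
  also have "\<dots> = (\<Sum>y\<in>grid k. g y * p y)"
  proof (intro sum.cong refl arg_cong2[where f = "(*)"])
    fix y assume y: "y \<in> grid k"
    have "(\<integral>\<omega>. 1 * indicator {y} (\<omega> 0) \<partial>P) = (\<integral>\<omega>. indicat_real (cylinder k {0} (\<lambda>_. y)) \<omega> \<partial>P)"
      by (intro Bochner_Integration.integral_cong) (auto simp: cylinder_def indicator_def)
    also have "\<dots> = prob (cylinder k {0} (\<lambda>_. y))"
      by (simp add: cylinder_def Int_def conj_ac)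
    also have "\<dots> = p y" using cylinder_initial[of "\<lambda>_. y"] y by simp
    finally show "(\<integral>\<omega>. 1 * indicator {y} (\<omega> 0) \<partial>P) = p y" .
  qed
  finally show ?thesis by simp
qed

lemma (in chain) expectation_stationary:
  assumes "stationary_prob k G p" "0 \<le> t"
  shows "(\<integral>\<omega>. g (\<omega> t) \<partial>P) = (\<Sum>y\<in>grid k. p y * g y)"
proof -
  have "(\<integral>\<omega>. 1 * g (\<omega> t) \<partial>P) = (\<integral>\<omega>. 1 * op_exp G (t - 0) g (\<omega> 0) \<partial>P)"
    using assms(2) by (intro markov[where B = 1]) auto
  then show ?thesis
    using stationary_op_exp[OF assms(1), of t g] by (simp add: expectation_initial mult.commute)
qed

text \<open>By stationarity every Riemann sum already has the limiting mean.\<close>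

lemma (in chain) expectation_path_int:
  assumes "stationary_prob k G p" "0 \<le> T" and W: "\<And>x. x \<in> grid k \<Longrightarrow> isCont W x"
  shows "integrable P (path_int W 0 T)" "(\<integral>\<omega>. path_int W 0 T \<omega> \<partial>P) = T * (\<Sum>y\<in>grid k. p y * W y)"
proof -
  obtain w where w: "\<And>x. x \<in> grid k \<Longrightarrow> \<bar>W x\<bar> \<le> w" using bounded_on_grid[of k W] by blast
  note rm = measurable_upto[OF riemann_sum_measurable[OF order_refl assms(2), of W _ k]]
  have m: "path_int W 0 T \<in> borel_measurable P"
    by (rule measurable_upto[OF path_int_measurable[OF order_refl assms(2) W]])
  show "integrable P (path_int W 0 T)"
    using path_int_bound[of _ k 0 T W w] assms w by (intro integrable_const_bound[of _ "T * w"] m AE_I2) auto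
  have "(\<lambda>N. \<integral>\<omega>. riemann_sum W 0 T \<omega> N \<partial>P) \<longlonglongrightarrow> (\<integral>\<omega>. path_int W 0 T \<omega> \<partial>P)"
  proof (rule integral_dominated_convergence[where w = "\<lambda>_. T * w"])
    show "AE \<omega> in P. riemann_sum W 0 T \<omega> \<longlonglongrightarrow> path_int W 0 T \<omega>"
      using assms by (intro AE_I2 riemann_sum_tendsto[of _ k]) auto
    show "AE \<omega> in P. norm (riemann_sum W 0 T \<omega> N) \<le> T * w" for N
      using riemann_sum_bound[of _ k 0 T W w N] assms w by (intro AE_I2) auto
  qed (use m rm in auto)
  moreover have "\<forall>\<^sub>F N in sequentially. (\<integral>\<omega>. riemann_sum W 0 T \<omega> N \<partial>P) = T * (\<Sum>y\<in>grid k. p y * W y)"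
    using eventually_gt_at_top[of 0]
  proof eventually_elim
    case (elim N)
    have "(\<integral>\<omega>. riemann_sum W 0 T \<omega> N \<partial>P) = (\<Sum>i<N. T / real N * (\<Sum>y\<in>grid k. p y * W y))"
      unfolding riemann_sum_def using assms
      by (subst Bochner_Integration.integral_sum)
         (auto intro!: integrable_mult_right integrable_coordinate[where g = W] simp: expectation_stationary[OF assms(1), where g = W] simp del: of_nat_Suc)
    then show ?case using elim by simp
  qed
  ultimately have "(\<lambda>N. T * (\<Sum>y\<in>grid k. p y * W y)) \<longlonglongrightarrow> (\<integral>\<omega>. path_int W 0 T \<omega> \<partial>P)"
    by (rule Lim_transform_eventually)
  then show "(\<integral>\<omega>. path_int W 0 T \<omega> \<partial>P) = T * (\<Sum>y\<in>grid k. p y * W y)"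
    using LIMSEQ_unique tendsto_const by blast
qed

locale gibbs = ground_state k V lam u
  for k :: nat and V :: "real \<Rightarrow> real" and lam :: real and u :: "real \<Rightarrow> real" +
  fixes p :: "real \<Rightarrow> real" and PV P :: "(real \<Rightarrow> real) measure"
  assumes V: "\<And>x. isCont V x"
    and stat: "stationary_prob k (gibbs_generator k u) p"
    and law_PV: "chain_law k (gibbs_generator k u) p PV"
    and law_P: "chain_law k (free_generator k) p P"
begin

definition W :: "real \<Rightarrow> real" where
  "W x = real k * V x - lam"

lemma isCont_W: "isCont W x"
  unfolding W_def[abs_def] by (intro continuous_intros V)

text \<open>The Girsanov density. The two boundary values of \<open>u\<close> come from the Doob transform, and the exponential
  is the Feynman-Kac weight of the tilted operator.\<close>

definition path_density :: "real \<Rightarrow> (real \<Rightarrow> real) \<Rightarrow> real" where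
  "path_density T \<omega> = u (\<omega> T) / u (\<omega> 0) * exp (path_int W 0 T \<omega>)"

sublocale P: chain k "free_generator k" "\<lambda>_. real k" "\<lambda>_. real k" "\<lambda>_. - 2 * real k" "4 * real k" p P
  by (intro chain.intro free_nearest_neighbour k chain_axioms.intro law_P)

text \<open>Adding one observation time multiplies the left side by a Gibbs transition probability and the right
  side, by Feynman-Kac, by an entry of the exponential of the tilted operator; the two are conjugate by \<open>u\<close>.
  Of the values of \<open>u\<close> only the first and the last survive the telescoping.\<close>

lemma cylinder_weight:
  assumes "finite S" "S \<noteq> {}" "0 \<in> S" "S \<subseteq> {0..}" "x \<in> S \<rightarrow> grid k"
  shows "measure PV (cylinder k S x) * u (x 0) =
    u (x (Max S)) * (\<integral>\<omega>. indicator (cylinder k S x) \<omega> * exp (path_int W 0 (Max S) \<omega>) \<partial>P)"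
  using assms
proof (induction S rule: finite_linorder_max_induct)
  case (insert t S)
  obtain a b c M where "nearest_neighbour k (gibbs_generator k u) a b c M"
    using gibbs_nearest_neighbour[OF k] .
  then interpret PV: chain k "gibbs_generator k u" a b c M p PV
    by (intro chain.intro chain_axioms.intro law_PV)
  obtain w where w: "\<And>x. x \<in> grid k \<Longrightarrow> \<bar>W x\<bar> \<le> w" using bounded_on_grid[of k W] by blast
  show ?case
  proof (cases "S = {}")
    case True
    then have t: "t = 0" using insert.prems by simp
    have "(\<integral>\<omega>. indicator (cylinder k {0} x) \<omega> * exp (path_int W 0 0 \<omega>) \<partial>P) = P.prob (cylinder k {0} x)"
      by (simp add: path_int_def set_lebesgue_integral_def cylinder_def Int_def conj_ac)
    then show ?thesis
      using True t insert.prems PV.cylinder_initial[of x] P.cylinder_initial[of x] by simp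
  next
    case False
    define s where "s = Max S"
    have S: "0 \<in> S" "S \<subseteq> {0..}" "x \<in> S \<rightarrow> grid k" using insert False by fastforce+
    have s: "s \<in> S" "0 \<le> s" "s < t" using insert False S by (auto simp: s_def)
    have sub: "S \<subseteq> {0..s}" "S \<subseteq> {0..t}" using S insert by (auto simp: s_def less_imp_le)
    have Max: "Max (insert t S) = t" using insert by (intro Max_eqI) (auto simp: less_imp_le)
    have xt: "x t \<in> grid k" and xs: "x s \<in> grid k" using insert S s by auto
    define Z where "Z \<omega> = indicator (cylinder k S x) \<omega> * exp (path_int W 0 s \<omega>)" for \<omega>
    have Zm: "Z \<in> borel_measurable (path_sigma_upto k s)"
      unfolding Z_def using insert(1) S s sub isCont_W
      by (intro borel_measurable_times borel_measurable_indicator cylinder_in_sets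
          measurable_compose[OF path_int_measurable, of _ _ _ _ exp borel]) auto
    have Zb: "\<bar>Z \<omega>\<bar> \<le> exp (s * w)" if "\<omega> \<in> cadlag_paths k" for \<omega>
      using path_int_bound[OF that order_refl s(2), of W w] isCont_W w
      by (auto simp: Z_def indicator_def)
    have ext: "cylinder k (insert t S) x = {\<omega> \<in> cylinder k S x. \<omega> t = x t}"
      by (auto simp: cylinder_def)
    have op: "op_exp (gibbs_generator k u) (t - s) (indicator {x t}) (x s)
        = u (x t) * op_exp (tilted_operator k V lam) (t - s) (indicator {x t}) (x s) / u (x s)"
    proof -
      interpret S: nearest_neighbour k "tilted_operator k V lam" "\<lambda>_. real k" "\<lambda>_. real k"
          "\<lambda>x. - 2 * real k + (real k * V x - lam)" "4 * real k + w"
        using w by (intro tilted_nearest_neighbour k) (simp add: W_def)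
      show ?thesis
      proof -
        have "op_exp (tilted_operator k V lam) (t - s) (\<lambda>y. u y * indicator {x t} y) (x s)
          = (\<Sum>y\<in>grid k. if y = x t then u y * op_exp (tilted_operator k V lam) (t - s) (indicator {y}) (x s) else 0)"
          unfolding S.op_exp_indicator_expansion[OF xs, of "t - s" "\<lambda>y. u y * indicator {x t} y"]
          by (intro sum.cong) (auto simp: indicator_def)
        then show ?thesis
          using xt gibbs_conjugation[where f = "indicator {x t}", OF k u eig xs, of "t - s"] by simp
      qed
    qed
    have "(\<integral>\<omega>. indicator (cylinder k (insert t S) x) \<omega> * exp (path_int W 0 t \<omega>) \<partial>P)
        = (\<integral>\<omega>. Z \<omega> * exp (path_int W s t \<omega>) * indicator {x t} (\<omega> t) \<partial>P)"
    proof (intro Bochner_Integration.integral_cong refl)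
      fix \<omega> assume "\<omega> \<in> space P"
      then have "path_int W 0 t \<omega> = path_int W 0 s \<omega> + path_int W s t \<omega>"
        using s isCont_W by (intro path_int_add[of \<omega> k]) auto
      then show "indicator (cylinder k (insert t S) x) \<omega> * exp (path_int W 0 t \<omega>)
          = Z \<omega> * exp (path_int W s t \<omega>) * indicator {x t} (\<omega> t)"
        unfolding ext Z_def by (auto simp: indicator_def exp_add)
    qed
    also have "\<dots> = (\<integral>\<omega>. Z \<omega> * op_exp (tilted_operator k V lam) (t - s) (indicator {x t}) (\<omega> s) \<partial>P)"
    proof -
      have "nearest_neighbour k (tilted_operator k V lam) (\<lambda>_. real k) (\<lambda>_. real k)
          (\<lambda>x. - 2 * real k + W x) (4 * real k + w)"
        using tilted_nearest_neighbour[OF k, of V lam w] w by (simp add: W_def)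
      from P.feynman_kac[OF _ _ Zm Zb this refl w isCont_W] show ?thesis using s by simp
    qed
    also have "\<dots> = (\<integral>\<omega>. Z \<omega> * op_exp (tilted_operator k V lam) (t - s) (indicator {x t}) (x s) \<partial>P)"
      using s(1) by (intro Bochner_Integration.integral_cong refl) (force simp: Z_def indicator_def cylinder_def)
    also have "\<dots> = op_exp (tilted_operator k V lam) (t - s) (indicator {x t}) (x s) * (\<integral>\<omega>. Z \<omega> \<partial>P)"
      by (simp add: mult.commute)
    finally have 1: "(\<integral>\<omega>. indicator (cylinder k (insert t S) x) \<omega> * exp (path_int W 0 t \<omega>) \<partial>P)
      = op_exp (tilted_operator k V lam) (t - s) (indicator {x t}) (x s) * (\<integral>\<omega>. Z \<omega> \<partial>P)" .
    have "measure PV (cylinder k (insert t S) x) = measure PV (cylinder k S x) *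
        op_exp (gibbs_generator k u) (t - s) (indicator {x t}) (x s)"
      unfolding ext s_def using insert(1) S sub xt by (intro PV.cylinder_extend) auto
    moreover have "measure PV (cylinder k S x) * u (x 0) = u (x s) * (\<integral>\<omega>. Z \<omega> \<partial>P)"
      using insert.IH[OF False S] by (simp add: Z_def s_def)
    ultimately have "measure PV (cylinder k (insert t S) x) * u (x 0)
      = u (x s) * (\<integral>\<omega>. Z \<omega> \<partial>P) * op_exp (gibbs_generator k u) (t - s) (indicator {x t}) (x s)"
      by (simp add: mult_ac)
    then show ?thesis unfolding Max 1 op using u[OF xs] by simp
  qed
qed simp

lemma path_density_measurable:
  assumes T: "0 \<le> T"
  shows "path_density T \<in> borel_measurable (path_sigma_upto k T)"
  unfolding path_density_def[abs_def] using T isCont_W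
  by (intro borel_measurable_times borel_measurable_divide coordinate_measurable
      measurable_compose[OF path_int_measurable, of _ _ _ _ exp borel]) auto

lemma path_density_pos: "\<omega> \<in> cadlag_paths k \<Longrightarrow> 0 \<le> T \<Longrightarrow> 0 < path_density T \<omega>"
  unfolding path_density_def using path_in_grid[of \<omega> k] u by simp

lemma path_density_bounded:
  assumes T: "0 \<le> T"
  obtains B where "\<And>\<omega>. \<omega> \<in> cadlag_paths k \<Longrightarrow> path_density T \<omega> \<le> B"
proof -
  obtain w where w: "\<And>x. x \<in> grid k \<Longrightarrow> \<bar>W x\<bar> \<le> w" using bounded_on_grid[of k W] by blast
  obtain B1 where B1: "\<And>x. x \<in> grid k \<Longrightarrow> \<bar>u x\<bar> \<le> B1" using bounded_on_grid[of k u] by blast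
  obtain B2 where B2: "\<And>x. x \<in> grid k \<Longrightarrow> \<bar>1 / u x\<bar> \<le> B2" using bounded_on_grid[of k "\<lambda>x. 1 / u x"] by blast
  have "path_density T \<omega> \<le> B1 * B2 * exp (T * w)" if o: "\<omega> \<in> cadlag_paths k" for \<omega>
  proof -
    have g: "\<omega> T \<in> grid k" "\<omega> 0 \<in> grid k" using path_in_grid[OF o] T by auto
    have "path_int W 0 T \<omega> \<le> T * w"
      using path_int_bound[OF o order_refl T, of W w] isCont_W w by auto
    moreover have "u (\<omega> T) * (1 / u (\<omega> 0)) \<le> B1 * B2"
      using B1[OF g(1)] B2[OF g(2)] u[OF g(1)] u[OF g(2)] by (intro mult_mono) auto
    ultimately show ?thesis unfolding path_density_def using u[OF g(1)] u[OF g(2)]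
      by (intro mult_mono) (auto intro: order_trans[rotated])
  qed
  then show ?thesis using that by blast
qed

lemma restricted_law_eq_density:
  assumes T: "0 \<le> T"
  shows "density (restr_to_subalg P (path_sigma_upto k T)) (\<lambda>\<omega>. ennreal (path_density T \<omega>))
       = restr_to_subalg PV (path_sigma_upto k T)"
proof -
  obtain a b c M where "nearest_neighbour k (gibbs_generator k u) a b c M"
    using gibbs_nearest_neighbour[OF k] .
  then interpret PV: chain k "gibbs_generator k u" a b c M p PV
    by (intro chain.intro chain_axioms.intro law_PV)
  obtain B where B: "\<And>\<omega>. \<omega> \<in> cadlag_paths k \<Longrightarrow> path_density T \<omega> \<le> B"
    using path_density_bounded[OF T] by blast
  have Db: "0 \<le> path_density T \<omega> \<and> path_density T \<omega> \<le> B" if "\<omega> \<in> cadlag_paths k" for \<omega>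
    using B[OF that] path_density_pos[OF that T] by simp
  note Dm = path_density_measurable[OF T]
  note wm = P.weighted_measure[where X = "path_density T" and T = T, OF P.measurable_upto[OF Dm] Db]
  have "restr_to_subalg (density P (\<lambda>\<omega>. ennreal (path_density T \<omega>))) (path_sigma_upto k T)
      = restr_to_subalg PV (path_sigma_upto k T)" (is "?N = ?M")
  proof (rule path_measure_eqI[OF T])
    show "sets ?N = sets (path_sigma_upto k T)" "finite_measure ?N" using wm by auto
    show "sets ?M = sets (path_sigma_upto k T)" by (rule sets_restr_to_subalg[OF PV.subalg])
    fix S x assume S: "finite S" "{0, T} \<subseteq> S" "S \<subseteq> {0..T}" "x \<in> S \<rightarrow> grid k"
    have C: "cylinder k S x \<in> sets (path_sigma_upto k T)" by (intro cylinder_in_sets S)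
    have Max: "Max S = T" using S by (intro Max_eqI) auto
    have "x 0 \<in> grid k" using S by auto
    have "(\<integral>\<omega>. indicator (cylinder k S x) \<omega> * path_density T \<omega> \<partial>P)
       = (\<integral>\<omega>. u (x T) / u (x 0) * (indicator (cylinder k S x) \<omega> * exp (path_int W 0 T \<omega>)) \<partial>P)"
      using S(2) by (intro Bochner_Integration.integral_cong refl) (auto simp: path_density_def cylinder_def indicator_def)
    also have "\<dots> = measure PV (cylinder k S x)"
      using cylinder_weight[of S x] S Max u[OF \<open>x 0 \<in> grid k\<close>] by (fastforce simp: field_simps)
    finally have "emeasure ?N (cylinder k S x) = ennreal (measure PV (cylinder k S x))"
      using wm(3)[OF _ C] by simp
    then show "emeasure ?N (cylinder k S x) = emeasure ?M (cylinder k S x)"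
      by (simp add: emeasure_restr_to_subalg[OF PV.subalg C] PV.emeasure_eq_measure)
  qed
  moreover have "density (restr_to_subalg P (path_sigma_upto k T)) (\<lambda>\<omega>. ennreal (path_density T \<omega>)) = ?N"
  proof (rule measure_eqI)
    show "sets (density (restr_to_subalg P (path_sigma_upto k T)) (\<lambda>\<omega>. ennreal (path_density T \<omega>))) = sets ?N"
      using wm(1) by (simp add: sets_restr_to_subalg[OF P.subalg])
    fix A assume "A \<in> sets (density (restr_to_subalg P (path_sigma_upto k T)) (\<lambda>\<omega>. ennreal (path_density T \<omega>)))"
    then have A: "A \<in> sets (path_sigma_upto k T)" by (simp add: sets_restr_to_subalg[OF P.subalg])
    have m: "(\<lambda>\<omega>. ennreal (path_density T \<omega>) * indicator A \<omega>) \<in> borel_measurable (path_sigma_upto k T)"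
      using Dm A by measurable
    have sub: "subalgebra (density P (\<lambda>\<omega>. ennreal (path_density T \<omega>))) (path_sigma_upto k T)"
      using P.subalg[of T] by (simp add: subalgebra_def)
    have "emeasure (density (restr_to_subalg P (path_sigma_upto k T)) (\<lambda>\<omega>. ennreal (path_density T \<omega>))) A
        = (\<integral>\<^sup>+\<omega>. ennreal (path_density T \<omega>) * indicator A \<omega> \<partial>restr_to_subalg P (path_sigma_upto k T))"
      using A Dm by (intro emeasure_density measurable_in_subalg[OF P.subalg])
        (auto simp: sets_restr_to_subalg[OF P.subalg])
    also have "\<dots> = (\<integral>\<^sup>+\<omega>. ennreal (path_density T \<omega>) * indicator A \<omega> \<partial>P)"
      by (rule nn_integral_subalgebra2[OF P.subalg m])
    also have "\<dots> = emeasure (density P (\<lambda>\<omega>. ennreal (path_density T \<omega>))) A"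
      using P.upto_in_events[OF A] P.measurable_upto[OF Dm] by (intro emeasure_density[symmetric]) auto
    also have "\<dots> = emeasure ?N A" by (rule emeasure_restr_to_subalg[OF sub A, symmetric])
    finally show "emeasure (density (restr_to_subalg P (path_sigma_upto k T)) (\<lambda>\<omega>. ennreal (path_density T \<omega>))) A = emeasure ?N A" .
  qed
  ultimately show ?thesis by simp
qed

lemma restricted_absolutely_continuous:
  assumes T: "0 \<le> T"
  shows "absolutely_continuous (restr_to_subalg P (path_sigma_upto k T)) (restr_to_subalg PV (path_sigma_upto k T))"
  unfolding restricted_law_eq_density[OF T, symmetric]
  by (intro absolutely_continuousI_density measurable_compose[OF _ measurable_ennreal]
      measurable_in_subalg[OF P.subalg] path_density_measurable T)

text \<open>The logarithm of the density is \<open>ln u\<close> at the final point minus \<open>ln u\<close> at the initial point plus the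
  integral of \<open>k V - lam\<close> along the path. The boundary terms have equal means under the stationary law, so
  the expectation is linear in \<open>T\<close>, not just asymptotically.\<close>

lemma
  assumes T: "0 \<le> T"
  shows ln_density_integrable: "integrable PV (\<lambda>\<omega>. ln (density_upto k PV P T \<omega>))"
    and ln_density_integral: "(\<integral>\<omega>. ln (density_upto k PV P T \<omega>) \<partial>PV) = T * ((\<Sum>x\<in>grid k. real k * V x * p x) - lam)"
proof -
  obtain a b c M where "nearest_neighbour k (gibbs_generator k u) a b c M"
    using gibbs_nearest_neighbour[OF k] .
  then interpret PV: chain k "gibbs_generator k u" a b c M p PV
    by (intro chain.intro chain_axioms.intro law_PV)
  let ?F = "path_sigma_upto k T"
  let ?f = "\<lambda>\<omega>. ln (u (\<omega> T)) - ln (u (\<omega> 0)) + path_int W 0 T \<omega>"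
  interpret R: prob_space "restr_to_subalg P ?F"
    by (rule prob_space_restr_to_subalg[OF P.subalg P.prob_space_axioms])
  have "AE \<omega> in restr_to_subalg P ?F. ennreal (path_density T \<omega>)
      = RN_deriv (restr_to_subalg P ?F) (restr_to_subalg PV ?F) \<omega>"
    by (intro R.RN_deriv_unique restricted_law_eq_density T measurable_compose[OF _ measurable_ennreal]
      measurable_in_subalg[OF P.subalg] path_density_measurable)
  then have "AE \<omega> in restr_to_subalg PV ?F. ennreal (path_density T \<omega>)
      = RN_deriv (restr_to_subalg P ?F) (restr_to_subalg PV ?F) \<omega>"
    by (rule absolutely_continuous_AE[OF _ restricted_absolutely_continuous[OF T], rotated])
       (simp add: sets_restr_to_subalg[OF PV.subalg] sets_restr_to_subalg[OF P.subalg])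
  from AE_restr_to_subalg[OF PV.subalg this] AE_space[of PV]
  have ae: "AE \<omega> in PV. ln (density_upto k PV P T \<omega>) = ?f \<omega>"
  proof eventually_elim
    case (elim \<omega>)
    have o: "\<omega> \<in> cadlag_paths k" using elim(2) by simp
    have "0 < u (\<omega> T)" "0 < u (\<omega> 0)" using path_in_grid[OF o] T u by auto
    moreover have "density_upto k PV P T \<omega> = path_density T \<omega>"
      unfolding density_upto_def elim(1)[symmetric] using path_density_pos[OF o T] by simp
    ultimately show ?case by (simp add: path_density_def ln_mult ln_div)
  qed
  have m: "(\<lambda>\<omega>. ln (density_upto k PV P T \<omega>)) \<in> borel_measurable PV"
  proof -
    have "RN_deriv (restr_to_subalg P ?F) (restr_to_subalg PV ?F) \<in> borel_measurable ?F"
      by (rule measurable_in_subalg'[OF P.subalg]) simp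
    from PV.measurable_upto[OF this] show ?thesis unfolding density_upto_def by measurable
  qed
  note pint = PV.expectation_path_int[OF stat T isCont_W]
  note cint = PV.integrable_coordinate[where g = "\<lambda>x. ln (u x)"]
  have fint: "integrable PV ?f"
    by (intro Bochner_Integration.integrable_add Bochner_Integration.integrable_diff pint cint T order_refl)
  show "integrable PV (\<lambda>\<omega>. ln (density_upto k PV P T \<omega>))"
    using integrable_cong_AE[OF m borel_measurable_integrable[OF fint] ae] fint by simp
  have "(\<integral>\<omega>. ln (density_upto k PV P T \<omega>) \<partial>PV) = (\<integral>\<omega>. ?f \<omega> \<partial>PV)"
    by (rule integral_cong_AE[OF m borel_measurable_integrable[OF fint] ae])
  also have "\<dots> = (\<integral>\<omega>. ln (u (\<omega> T)) \<partial>PV) - (\<integral>\<omega>. ln (u (\<omega> 0)) \<partial>PV) + (\<integral>\<omega>. path_int W 0 T \<omega> \<partial>PV)"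
    using cint pint(1) T by (simp add: Bochner_Integration.integral_add Bochner_Integration.integral_diff)
  also have "\<dots> = T * (\<Sum>y\<in>grid k. p y * W y)"
    using T by (simp add: pint(2) PV.expectation_stationary[OF stat, where g = "\<lambda>x. ln (u x)"])
  also have "(\<Sum>y\<in>grid k. p y * W y) = (\<Sum>x\<in>grid k. real k * V x * p x) - lam"
    using stat by (simp add: W_def stationary_prob_def prob_vector_def algebra_simps sum_subtractf flip: sum_distrib_left)
  finally show "(\<integral>\<omega>. ln (density_upto k PV P T \<omega>) \<partial>PV) = T * ((\<Sum>x\<in>grid k. real k * V x * p x) - lam)" .
qed

lemma
  shows entropy_tendsto: "((\<lambda>T. 1 / T * entropy_upto k PV P T) \<longlongrightarrow> gibbs_entropy k PV P) at_top"
    and gibbs_entropy_eq: "gibbs_entropy k PV P = - ((\<Sum>x\<in>grid k. real k * V x * p x) - lam)"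
proof -
  have lim: "((\<lambda>T. 1 / T * entropy_upto k PV P T) \<longlongrightarrow> - ((\<Sum>x\<in>grid k. real k * V x * p x) - lam)) at_top"
    by (rule tendsto_eventually)
       (auto intro!: eventually_mono[OF eventually_gt_at_top[of 0]] simp: entropy_upto_def ln_density_integral)
  then show "gibbs_entropy k PV P = - ((\<Sum>x\<in>grid k. real k * V x * p x) - lam)"
    unfolding gibbs_entropy_def by (intro tendsto_Lim) auto
  with lim show "((\<lambda>T. 1 / T * entropy_upto k PV P T) \<longlongrightarrow> gibbs_entropy k PV P) at_top" by simp
qed

end

section \<open>The Mather measure\<close>

text \<open>The Legendre dual variable of the velocity. It is the inverse hyperbolic sine of \<open>v / 2\<close>, so the
  velocity is \<open>2 sinh\<close> of the momentum.\<close>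

definition momentum :: "real \<Rightarrow> real" where
  "momentum v = ln ((v + sqrt (v\<^sup>2 + 4)) / 2)"

lemma momentum_arg_pos: "0 < (v + sqrt (v\<^sup>2 + 4)) / 2"
proof -
  have "\<bar>v\<bar> < sqrt (v\<^sup>2 + 4)" by (rule real_less_rsqrt) simp
  then have "0 < v + sqrt (v\<^sup>2 + 4)" by linarith
  then show ?thesis by simp
qed

lemma
  shows velocity_eq: "v = exp (momentum v) - exp (- momentum v)"
    and sqrt_eq: "sqrt (v\<^sup>2 + 4) = exp (momentum v) + exp (- momentum v)"
proof -
  define s where "s = sqrt (v\<^sup>2 + 4)"
  have s: "s * s = v * v + 4" by (simp add: s_def power2_eq_square)
  have e: "exp (momentum v) = (v + s) / 2" using momentum_arg_pos by (simp add: momentum_def s_def)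
  have "(v + s) / 2 * ((s - v) / 2) = 1" using s by (simp add: algebra_simps)
  then have "exp (- momentum v) = (s - v) / 2"
    unfolding exp_minus e by (rule inverse_unique)
  then show "v = exp (momentum v) - exp (- momentum v)" "sqrt (v\<^sup>2 + 4) = exp (momentum v) + exp (- momentum v)"
    using e by (simp_all add: s_def field_simps)
qed

lemma momentum_eq_0_iff: "momentum v = 0 \<longleftrightarrow> v = 0"
proof
  assume "momentum v = 0"
  then show "v = 0" using velocity_eq[of v] by simp
qed (simp add: momentum_def)

text \<open>In terms of the momentum the kinetic part is a sum of two products that are nonnegative by
  \<open>exp y \<ge> 1 + y\<close>.\<close>

lemma lagrangian_eq:
  "lagrangian V x v = - V x + (exp (momentum v) * (exp (- momentum v) - (1 + - momentum v))
      + exp (- momentum v) * (exp (momentum v) - (1 + momentum v)))"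
proof -
  have "lagrangian V x v = - V x + (exp (momentum v) - exp (- momentum v)) * momentum v
      - (exp (momentum v) + exp (- momentum v)) + 2"
    unfolding lagrangian_def momentum_def[symmetric] sqrt_eq[symmetric] velocity_eq[symmetric] by simp
  moreover have "exp (momentum v) * exp (- momentum v) = 1" by (simp add: exp_minus)
  ultimately show ?thesis by (simp add: algebra_simps)
qed

lemma lagrangian_ge: "- V x \<le> lagrangian V x v"
  unfolding lagrangian_eq using exp_ge_add_one_self[of "- momentum v"] exp_ge_add_one_self[of "momentum v"]
  by (auto intro!: add_nonneg_nonneg mult_nonneg_nonneg)

lemma lagrangian_eq_potential_iff: "lagrangian V x v = - V x \<longleftrightarrow> v = 0"
proof
  assume "lagrangian V x v = - V x"
  then have "exp (momentum v) * (exp (- momentum v) - (1 + - momentum v))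
      + exp (- momentum v) * (exp (momentum v) - (1 + momentum v)) = 0"
    unfolding lagrangian_eq by simp
  then have "exp (- momentum v) * (exp (momentum v) - (1 + momentum v)) = 0"
    using exp_ge_add_one_self[of "- momentum v"] exp_ge_add_one_self[of "momentum v"]
    by (subst (asm) add_nonneg_eq_0_iff) auto
  then have "exp (momentum v) - 1 = momentum v" by simp
  then have "ln (exp (momentum v)) = exp (momentum v) - 1" by (simp only: ln_exp)
  then have "exp (momentum v) = 1" by (rule ln_eq_minus_one[rotated]) simp
  then have "momentum v = 0" by simp
  then show "v = 0" by (rule momentum_eq_0_iff[THEN iffD1])
qed (simp add: lagrangian_def)

lemma lagrangian_deriv_velocity: "deriv (\<lambda>v. lagrangian V x v) v = momentum v"
proof (rule DERIV_imp_deriv)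
  define s where "s = sqrt (v\<^sup>2 + 4)"
  have s: "0 < s" unfolding s_def by (simp add: add_nonneg_pos)
  have q: "0 < v + s" using momentum_arg_pos[of v] by (simp add: s_def)
  have ds: "((\<lambda>v. sqrt (v\<^sup>2 + 4)) has_real_derivative v / s) (at v)"
  proof -
    have "0 < 4 + v\<^sup>2" using zero_le_power2[of v] by linarith
    then show ?thesis unfolding s_def by (auto intro!: derivative_eq_intros simp: field_simps)
  qed
  have "((\<lambda>v. (v + sqrt (v\<^sup>2 + 4)) / 2) has_real_derivative (1 + v / s) / 2) (at v)"
    by (rule DERIV_cdivide[OF DERIV_add[OF DERIV_ident ds]])
  from DERIV_chain2[OF DERIV_ln[OF momentum_arg_pos] this]
  have "(momentum has_real_derivative inverse ((v + s) / 2) * ((1 + v / s) / 2)) (at v)"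
    by (simp only: momentum_def[abs_def] s_def)
  also have "inverse ((v + s) / 2) * ((1 + v / s) / 2) = 1 / s"
  proof -
    have "1 + v / s = (v + s) / s" using s by (simp add: field_simps)
    moreover have "inverse (r / 2) * ((r / s) / 2) = 1 / s" if "r \<noteq> 0" for r
      using that by simp
    ultimately show ?thesis using q by (metis less_irrefl)
  qed
  finally have dm: "(momentum has_real_derivative 1 / s) (at v)" .
  show "(lagrangian V x has_real_derivative momentum v) (at v)"
    unfolding lagrangian_def[abs_def] momentum_def[symmetric]
    by (rule derivative_eq_intros ds dm refl)+ simp
qed

lemma lagrangian_deriv_position:
  assumes "(V has_real_derivative D) (at x)"
  shows "deriv (\<lambda>x. lagrangian V x v) x = - D"
  unfolding lagrangian_def by (rule DERIV_imp_deriv) (auto intro!: derivative_eq_intros assms)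

lemma periodic_continuous_bounded:
  fixes g :: "real \<Rightarrow> real"
  assumes "continuous_on UNIV g" "\<And>x. g (x + 1) = g x"
  obtains B where "\<And>x. \<bar>g x\<bar> \<le> B"
proof -
  have "bounded (g ` {0..1})"
    by (intro compact_imp_bounded compact_continuous_image continuous_on_subset[OF assms(1)]) auto
  then obtain B where B: "\<forall>x\<in>{0..1}. \<bar>g x\<bar> \<le> B" by (auto simp: bounded_iff)
  have "\<bar>g x\<bar> \<le> B" for x
    using bspec[OF B, of "frac x"] periodic_frac[of g x, OF assms(2)] by (simp add: frac_ge_0 less_imp_le frac_lt_1)
  then show ?thesis using that by blast
qed

text \<open>The second derivative is bounded, being continuous and periodic, and the first derivative vanishes
  at the maximum.\<close>

lemma quadratic_bound_at_maximum:
  assumes V: "C2_on_circle V" and max: "\<And>x. V x \<le> V x\<^sub>0"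
  obtains B where "0 \<le> B" "\<And>x. V x\<^sub>0 - V x \<le> B * (x - x\<^sub>0)\<^sup>2"
proof -
  obtain V' V'' where per: "\<And>x. V (x + 1) = V x"
    and d1: "\<And>x. (V has_real_derivative V' x) (at x)"
    and d2: "\<And>x. (V' has_real_derivative V'' x) (at x)" and cont: "continuous_on UNIV V''"
    using V unfolding C2_on_circle_def by blast
  have per1: "V' (x + 1) = V' x" for x
  proof -
    have "((\<lambda>x. V (x + 1)) has_real_derivative V' (x + 1)) (at x)"
      using d1[of "x + 1"] unfolding DERIV_shift .
    then show ?thesis unfolding per using d1 by (rule DERIV_unique)
  qed
  have per2: "V'' (x + 1) = V'' x" for x
  proof -
    have "((\<lambda>x. V' (x + 1)) has_real_derivative V'' (x + 1)) (at x)"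
      using d2[of "x + 1"] unfolding DERIV_shift .
    then show ?thesis unfolding per1 using d2 by (rule DERIV_unique)
  qed
  obtain B where B: "\<And>x. \<bar>V'' x\<bar> \<le> B" using periodic_continuous_bounded[OF cont per2] by blast
  have crit: "V' x\<^sub>0 = 0"
    by (rule DERIV_local_max[OF d1, of 1]) (use max in auto)
  have B0: "0 \<le> B" using B[of 0] by linarith
  have V'_bound: "\<bar>V' x\<bar> \<le> B * \<bar>x - x\<^sub>0\<bar>" for x
    using field_differentiable_bound[of UNIV V' V'' B x x\<^sub>0] d2 B crit by simp
  have "V x\<^sub>0 - V x \<le> B * (x - x\<^sub>0)\<^sup>2" for x
  proof -
    have "norm (V x - V x\<^sub>0) \<le> B * \<bar>x - x\<^sub>0\<bar> * norm (x - x\<^sub>0)"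
    proof (rule field_differentiable_bound[of "closed_segment x\<^sub>0 x" V V'])
      fix z assume "z \<in> closed_segment x\<^sub>0 x"
      then have "\<bar>z - x\<^sub>0\<bar> \<le> \<bar>x - x\<^sub>0\<bar>" using segment_bound(1)[of z x\<^sub>0 x] by (simp add: abs_minus_commute)
      then have "B * \<bar>z - x\<^sub>0\<bar> \<le> B * \<bar>x - x\<^sub>0\<bar>" using B0 by (rule mult_left_mono)
      then show "norm (V' z) \<le> B * \<bar>x - x\<^sub>0\<bar>" using V'_bound[of z] by simp
    qed (auto intro: DERIV_subset[OF d1])
    then show ?thesis by (simp add: power2_eq_square abs_le_iff mult.assoc)
  qed
  then show ?thesis using that B0 by blast
qed

lemma gronwall_zero:
  fixes f :: "real \<Rightarrow> real"
  assumes d: "\<And>t. (f has_real_derivative f' t) (at t)" and b: "\<And>t. \<bar>f' t\<bar> \<le> c * f t"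
    and pos: "\<And>t. 0 \<le> f t" and z: "f 0 = 0"
  shows "f t = 0"
proof (cases "0 \<le> t")
  case True
  have "f t * exp (- c * t) \<le> f 0 * exp (- c * 0)"
  proof (rule DERIV_nonpos_imp_nonincreasing[where f = "\<lambda>s. f s * exp (- c * s)", OF True])
    fix s :: real
    have "((\<lambda>s. f s * exp (- c * s)) has_real_derivative (f' s - c * f s) * exp (- c * s)) (at s)"
      by (auto intro!: derivative_eq_intros d simp: algebra_simps)
    moreover have "(f' s - c * f s) * exp (- c * s) \<le> 0"
      using b[of s] by (intro mult_nonpos_nonneg) (auto simp: abs_le_iff)
    ultimately show "\<exists>y. ((\<lambda>s. f s * exp (- c * s)) has_real_derivative y) (at s) \<and> y \<le> 0" by blast
  qed
  then show ?thesis using z pos[of t] by (simp add: mult_le_0_iff) 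
next
  case False
  have "f t * exp (c * t) \<le> f 0 * exp (c * 0)"
  proof (rule DERIV_nonneg_imp_nondecreasing[where f = "\<lambda>s. f s * exp (c * s)"])
    show "t \<le> 0" using False by simp
    fix s :: real
    have "((\<lambda>s. f s * exp (c * s)) has_real_derivative (f' s + c * f s) * exp (c * s)) (at s)"
      by (auto intro!: derivative_eq_intros d simp: algebra_simps)
    moreover have "0 \<le> (f' s + c * f s) * exp (c * s)"
      using b[of s] by (intro mult_nonneg_nonneg) (auto simp: abs_le_iff)
    ultimately show "\<exists>y. ((\<lambda>s. f s * exp (c * s)) has_real_derivative y) (at s) \<and> 0 \<le> y" by blast
  qed
  then show ?thesis using z pos[of t] by (simp add: mult_le_0_iff)
qed

text \<open>The Hamiltonian \<open>2 cosh p + V\<close> (up to a constant) is conserved along extremals. At the energy of the maximum it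
  forces the squared speed to be at most a multiple of \<open>V x\<^sub>0 - V \<gamma>\<close>, hence the speed to be at most
  a multiple of the distance to \<open>x\<^sub>0\<close>; by Gronwall an extremal starting there at rest stays there.\<close>

lemma equilibrium_at_maximum:
  assumes V: "C2_on_circle V" and max: "\<And>x. V x \<le> V x\<^sub>0"
    and el: "euler_lagrange V \<gamma> \<gamma>'" and init: "\<gamma> 0 = x\<^sub>0" "\<gamma>' 0 = 0"
  shows "\<gamma> t = x\<^sub>0" "\<gamma>' t = 0"
proof -
  obtain V' where per: "\<And>x. V (x + 1) = V x" and d1: "\<And>x. (V has_real_derivative V' x) (at x)"
    using V unfolding C2_on_circle_def by blast
  define p where "p t = momentum (\<gamma>' t)" for t
  have dg: "(\<gamma> has_real_derivative \<gamma>' t) (at t)" for t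
    using el by (simp add: euler_lagrange_def)
  have dp: "(p has_real_derivative - V' (\<gamma> t)) (at t)" for t
    using el unfolding euler_lagrange_def lagrangian_deriv_velocity lagrangian_deriv_position[OF d1]
    by (simp add: p_def[abs_def])
  have g': "\<gamma>' t = exp (p t) - exp (- p t)" for t unfolding p_def by (rule velocity_eq)
  define E where "E t = exp (p t) + exp (- p t) + V (\<gamma> t)" for t
  have "(E has_real_derivative 0) (at t)" for t
    unfolding E_def[abs_def]
    by (rule derivative_eq_intros dp dg DERIV_chain2[OF d1] refl)+ (simp add: g' algebra_simps)
  then have E: "E t = E 0" for t using DERIV_isconst_all[of E] by blast
  define D where "D t = V x\<^sub>0 - V (\<gamma> t)" for t
  have D0: "0 \<le> D t" for t using max by (simp add: D_def)
  have s: "exp (p t) + exp (- p t) = 2 + D t" for t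
    using E[of t] init by (simp add: E_def D_def p_def momentum_def)
  have g'2: "(\<gamma>' t)\<^sup>2 = D t * (D t + 4)" for t
  proof -
    have "(\<gamma>' t)\<^sup>2 = (exp (p t) + exp (- p t))\<^sup>2 - 4"
      unfolding g' by (simp add: power2_eq_square algebra_simps exp_minus)
    then show ?thesis unfolding s by (simp add: power2_eq_square algebra_simps)
  qed
  obtain B where B: "0 \<le> B" "\<And>x. V x\<^sub>0 - V x \<le> B * (x - x\<^sub>0)\<^sup>2"
    using quadratic_bound_at_maximum[of V x\<^sub>0, OF V max] by blast
  have "continuous_on UNIV V" using d1 by (meson DERIV_isCont continuous_at_imp_continuous_on)
  then obtain C where C: "\<And>x. \<bar>V x\<bar> \<le> C" using periodic_continuous_bounded[where g = V, OF _ per] by blast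
  define K where "K = sqrt (B * (2 * C + 4))"
  have C0: "0 \<le> C" using C[of 0] by linarith
  have speed: "\<bar>\<gamma>' t\<bar> \<le> K * \<bar>\<gamma> t - x\<^sub>0\<bar>" for t
  proof -
    have "(\<gamma>' t)\<^sup>2 \<le> (B * (\<gamma> t - x\<^sub>0)\<^sup>2) * (2 * C + 4)"
      unfolding g'2 using D0[of t] B(2)[of "\<gamma> t"] C[of x\<^sub>0] C[of "\<gamma> t"] C0 B(1)
      by (intro mult_mono) (auto simp: D_def abs_le_iff)
    also have "\<dots> = (K * \<bar>\<gamma> t - x\<^sub>0\<bar>)\<^sup>2"
      using B(1) C0 by (simp add: K_def power_mult_distrib)
    finally show ?thesis using B(1) C0 by (subst (asm) abs_le_square_iff[symmetric]) (simp add: K_def abs_mult)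
  qed
  have const: "(\<gamma> t - x\<^sub>0)\<^sup>2 = 0" for t
  proof (rule gronwall_zero[where f = "\<lambda>t. (\<gamma> t - x\<^sub>0)\<^sup>2" and c = "2 * K" and f' = "\<lambda>t. 2 * (\<gamma> t - x\<^sub>0) * \<gamma>' t"])
    show "((\<lambda>t. (\<gamma> t - x\<^sub>0)\<^sup>2) has_real_derivative 2 * (\<gamma> t - x\<^sub>0) * \<gamma>' t) (at t)" for t
      by (auto intro!: derivative_eq_intros dg)
    have a: "2 * \<bar>\<gamma> t - x\<^sub>0\<bar> * \<bar>\<gamma>' t\<bar> \<le> 2 * \<bar>\<gamma> t - x\<^sub>0\<bar> * (K * \<bar>\<gamma> t - x\<^sub>0\<bar>)" for t
      by (intro mult_left_mono speed) auto
    have b: "\<bar>2 * (\<gamma> t - x\<^sub>0) * \<gamma>' t\<bar> = 2 * \<bar>\<gamma> t - x\<^sub>0\<bar> * \<bar>\<gamma>' t\<bar>" for t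
      by (simp only: abs_mult abs_numeral)
    have c: "2 * K * (\<gamma> t - x\<^sub>0)\<^sup>2 = 2 * \<bar>\<gamma> t - x\<^sub>0\<bar> * (K * \<bar>\<gamma> t - x\<^sub>0\<bar>)" for t
      unfolding power2_abs[symmetric, of "\<gamma> t - x\<^sub>0"] power2_eq_square by (simp only: mult_ac)
    show "\<bar>2 * (\<gamma> t - x\<^sub>0) * \<gamma>' t\<bar> \<le> 2 * K * (\<gamma> t - x\<^sub>0)\<^sup>2" for t
      unfolding b c by (rule a)
  qed (use init in auto)
  then show *: "\<gamma> t = x\<^sub>0" for t by simp
  then have "\<gamma> = (\<lambda>_. x\<^sub>0)" by auto
  with dg[of t] show "\<gamma>' t = 0" using DERIV_unique DERIV_const by blast
qed

text \<open>Since the kinetic part of the Lagrangian is nonnegative, no invariant probability has action below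
  \<open>- V x\<^sub>0\<close>, and the Dirac mass at the equilibrium attains this value. Equality forces the position to be
  the maximum point and the velocity to vanish almost surely.\<close>

locale unique_maximum =
  fixes V :: "real \<Rightarrow> real" and x\<^sub>0 :: real and \<Phi> :: "real \<Rightarrow> real \<times> real \<Rightarrow> real \<times> real"
  assumes V: "C2_on_circle V" and flow: "euler_lagrange_flow V \<Phi>"
    and x0: "x\<^sub>0 \<in> {0..<1}" and strict: "\<And>x. x \<in> {0..<1} \<Longrightarrow> x \<noteq> x\<^sub>0 \<Longrightarrow> V x < V x\<^sub>0"
begin

lemma periodic: "V (x + 1) = V x"
  using V by (simp add: C2_on_circle_def)

lemma isCont_V: "isCont V x"
  using V unfolding C2_on_circle_def by (meson DERIV_isCont)

lemma le_max: "V x \<le> V x\<^sub>0"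
proof -
  have "V (frac x) \<le> V x\<^sub>0" using strict[of "frac x"] by (cases "frac x = x\<^sub>0") (auto simp: frac_lt_1)
  then show ?thesis by (simp add: periodic_frac[of V, OF periodic])
qed

lemma flow_fixed: "\<Phi> t (x\<^sub>0, 0) = (x\<^sub>0, 0)"
proof -
  have "(x\<^sub>0, 0) \<in> space tangent_circle" using x0 by (simp add: tangent_circle_def space_restrict_space)
  then obtain \<gamma> \<gamma>' where g: "euler_lagrange V \<gamma> \<gamma>'" "\<gamma> 0 = x\<^sub>0" "\<gamma>' 0 = 0" "\<Phi> t (x\<^sub>0, 0) = (frac (\<gamma> t), \<gamma>' t)"
    using flow unfolding euler_lagrange_flow_def by (metis prod.inject)
  have "frac x\<^sub>0 = x\<^sub>0" using x0 by (simp add: frac_eq)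
  then show ?thesis
    using equilibrium_at_maximum[of V x\<^sub>0, OF V le_max g(1-3), of t] g(4) by simp
qed

lemma lagrangian_measurable:
  assumes "sets m = sets tangent_circle"
  shows "(\<lambda>z. lagrangian V (fst z) (snd z)) \<in> borel_measurable m"
proof -
  have "continuous_on UNIV V" using isCont_V by (simp add: continuous_at_imp_continuous_on)
  then have "V \<in> borel_measurable borel" by (rule borel_measurable_continuous_onI)
  then have "(\<lambda>z. lagrangian V (fst z) (snd z)) \<in> borel_measurable (borel :: (real \<times> real) measure)"
    unfolding lagrangian_def by (simp add: borel_prod[symmetric])
  then show ?thesis
    unfolding measurable_cong_sets[OF assms refl] tangent_circle_def by (rule measurable_restrict_space1)
qed

definition equilibrium :: "(real \<times> real) measure" where
  "equilibrium = return tangent_circle (x\<^sub>0, 0)"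

lemma equilibrium_space: "(x\<^sub>0, 0) \<in> space tangent_circle"
  using x0 by (simp add: tangent_circle_def space_restrict_space)

lemma equilibrium_finite_action: "finite_action_prob V \<Phi> equilibrium"
proof -
  have "prob_space equilibrium" unfolding equilibrium_def by (rule prob_space_return[OF equilibrium_space])
  moreover have "distr equilibrium tangent_circle (\<Phi> t) = equilibrium" for t
    unfolding equilibrium_def using flow equilibrium_space
    by (subst distr_return) (auto simp: flow_fixed euler_lagrange_flow_def)
  moreover have "integrable equilibrium (\<lambda>z. lagrangian V (fst z) (snd z))"
  proof (rule integrableI_bounded)
    show "(\<lambda>z. lagrangian V (fst z) (snd z)) \<in> borel_measurable equilibrium"
      by (rule lagrangian_measurable) (simp add: equilibrium_def)
    have "(\<integral>\<^sup>+z. ennreal (norm (lagrangian V (fst z) (snd z))) \<partial>equilibrium) = ennreal (norm (lagrangian V x\<^sub>0 0))"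
      unfolding equilibrium_def using lagrangian_measurable[OF refl]
      by (subst nn_integral_return[OF equilibrium_space]) auto
    then show "(\<integral>\<^sup>+z. ennreal (norm (lagrangian V (fst z) (snd z))) \<partial>equilibrium) < \<infinity>" by simp
  qed
  ultimately show ?thesis
    unfolding finite_action_prob_def invariant_prob_def by (simp add: equilibrium_def)
qed

lemma equilibrium_action: "action V equilibrium = - V x\<^sub>0"
  unfolding action_def equilibrium_def integral_return[OF equilibrium_space lagrangian_measurable[OF refl]]
  by (simp add: lagrangian_def)

lemma action_ge:
  assumes m: "finite_action_prob V \<Phi> m"
  shows "- V x\<^sub>0 \<le> action V m"
proof -
  interpret prob_space m using m by (simp add: finite_action_prob_def invariant_prob_def)
  have int: "integrable m (\<lambda>z. lagrangian V (fst z) (snd z))" using m by (simp add: finite_action_prob_def)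
  have "(\<integral>z. - V x\<^sub>0 \<partial>m) \<le> action V m"
    unfolding action_def
    by (intro integral_mono int order_trans[OF _ lagrangian_ge]) (auto simp: le_max)
  then show ?thesis by (simp add: prob_space)
qed

lemma minimal_action: "Inf {action V m | m. finite_action_prob V \<Phi> m} = - V x\<^sub>0"
proof (rule cInf_eq_minimum)
  show "- V x\<^sub>0 \<in> {action V m | m. finite_action_prob V \<Phi> m}"
    using equilibrium_finite_action equilibrium_action by force
qed (auto intro: action_ge)

lemma critical_value_eq: "critical_value V \<Phi> = V x\<^sub>0"
  by (simp add: critical_value_def minimal_action)

lemma sup_potential: "(SUP x\<in>{0..<1}. V x) = V x\<^sub>0"
  using x0 le_max by (intro cSup_eq_maximum) auto

lemma minimizing_concentrated:
  assumes m: "minimizing_prob V \<Phi> m"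
  shows "AE z in m. z = (x\<^sub>0, 0)"
proof -
  have fa: "finite_action_prob V \<Phi> m" using m by (simp add: minimizing_prob_def)
  interpret prob_space m using fa by (simp add: finite_action_prob_def invariant_prob_def)
  have sets: "sets m = sets tangent_circle" using fa by (simp add: finite_action_prob_def invariant_prob_def)
  have int: "integrable m (\<lambda>z. lagrangian V (fst z) (snd z))" using fa by (simp add: finite_action_prob_def)
  have "action V m = - V x\<^sub>0" using m by (simp add: minimizing_prob_def minimal_action)
  then have "(\<integral>z. lagrangian V (fst z) (snd z) + V x\<^sub>0 \<partial>m) = 0"
    using int by (simp add: action_def prob_space)
  moreover have nn: "0 \<le> lagrangian V x v + V x\<^sub>0" for x v
    using lagrangian_ge[of V x v] le_max[of x] by linarith
  ultimately have "AE z in m. lagrangian V (fst z) (snd z) + V x\<^sub>0 = 0"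
    using int by (subst (asm) integral_nonneg_eq_0_iff_AE) auto
  then show ?thesis using AE_space
  proof eventually_elim
    case (elim z)
    have z: "fst z \<in> {0..<1}"
      using elim(2) sets_eq_imp_space_eq[OF sets] by (auto simp: tangent_circle_def space_restrict_space)
    have "V (fst z) = V x\<^sub>0" "lagrangian V (fst z) (snd z) = - V (fst z)"
      using elim(1) lagrangian_ge[of V "fst z" "snd z"] le_max[of "fst z"] by linarith+
    then have "fst z = x\<^sub>0" "snd z = 0"
      using strict[OF z] lagrangian_eq_potential_iff by (force, blast)
    then show ?case by (simp add: prod_eq_iff)
  qed
qed

lemma fst_measurable: "fst \<in> measurable tangent_circle circle"
  unfolding tangent_circle_def circle_def
proof (rule measurable_restrict_space2)
  have "fst \<in> borel_measurable (borel :: (real \<times> real) measure)" by (simp add: borel_prod[symmetric])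
  then show "fst \<in> borel_measurable (restrict_space borel ({0..<1::real} \<times> (UNIV :: real set)))"
    by (rule measurable_restrict_space1)
qed (auto simp: space_restrict_space)

lemma mather_measure_iff: "mather_measure V \<Phi> \<nu> \<longleftrightarrow> \<nu> = return circle x\<^sub>0"
proof
  assume "\<nu> = return circle x\<^sub>0"
  moreover have "distr equilibrium circle fst = return circle x\<^sub>0"
    unfolding equilibrium_def using distr_return[OF fst_measurable equilibrium_space] by simp
  moreover have "minimizing_prob V \<Phi> equilibrium"
    unfolding minimizing_prob_def minimal_action using equilibrium_finite_action equilibrium_action by simp
  ultimately show "mather_measure V \<Phi> \<nu>" unfolding mather_measure_def by metis
next
  assume "mather_measure V \<Phi> \<nu>"
  then obtain m where m: "minimizing_prob V \<Phi> m" "\<nu> = distr m circle fst"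
    unfolding mather_measure_def by blast
  have fa: "finite_action_prob V \<Phi> m" using m by (simp add: minimizing_prob_def)
  interpret prob_space m using fa by (simp add: finite_action_prob_def invariant_prob_def)
  have sets: "sets m = sets tangent_circle" using fa by (simp add: finite_action_prob_def invariant_prob_def)
  have fm: "fst \<in> measurable m circle"
    using fst_measurable measurable_cong_sets[OF sets refl] by blast
  have "distr m circle fst = distr m circle (\<lambda>_. x\<^sub>0)"
  proof (rule distr_cong_AE[OF refl refl])
    show "AE z in m. fst z = x\<^sub>0" using minimizing_concentrated[OF m(1)] by eventually_elim simp
    show "(\<lambda>_. x\<^sub>0) \<in> measurable m circle"
      using x0 by (intro measurable_const) (simp add: circle_def space_restrict_space)
  qed (rule fm)
  also have "\<dots> = return circle x\<^sub>0"
    using x0 by (intro distr_const) (simp add: circle_def space_restrict_space)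
  finally show "\<nu> = return circle x\<^sub>0" using m(2) by simp
qed

end

section \<open>The zero temperature limit of the entropy\<close>

theorem mainTheorem3:
  fixes V :: "real \<Rightarrow> real"
    and \<Phi> :: "real \<Rightarrow> real \<times> real \<Rightarrow> real \<times> real"
    and lam :: "nat \<Rightarrow> real"
    and u \<mu> \<pi> :: "nat \<Rightarrow> real \<Rightarrow> real"
    and PV P :: "nat \<Rightarrow> (real \<Rightarrow> real) measure"
  assumes V: "C2_on_circle V"
    and \<Phi>: "euler_lagrange_flow V \<Phi>"
    and perron: "\<And>k. k \<ge> 1 \<Longrightarrow> perron_triple k V (lam k) (u k) (\<mu> k)"
    and stationary: "\<And>k. k \<ge> 1 \<Longrightarrow> stationary_prob k (gibbs_generator k (u k)) (\<pi> k)"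
    and gibbs_law: "\<And>k. k \<ge> 1 \<Longrightarrow> chain_law k (gibbs_generator k (u k)) (\<pi> k) (PV k)"
    and free_law: "\<And>k. k \<ge> 1 \<Longrightarrow> chain_law k (free_generator k) (\<pi> k) (P k)"
  shows "(\<forall>k\<ge>1.
            (\<forall>T\<ge>0. absolutely_continuous (restr_to_subalg (P k) (path_sigma_upto k T))
                                          (restr_to_subalg (PV k) (path_sigma_upto k T)) \<and>
                    integrable (PV k) (\<lambda>\<omega>. ln (density_upto k (PV k) (P k) T \<omega>))) \<and>
            ((\<lambda>T. 1 / T * entropy_upto k (PV k) (P k) T) \<longlongrightarrow> gibbs_entropy k (PV k) (P k)) at_top \<and>
            gibbs_entropy k (PV k) (P k) = - ((\<Sum>x\<in>grid k. real k * V x * \<pi> k x) - lam k)) \<and>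
         (\<forall>x\<^sub>0\<in>{0..<1}. (\<forall>x\<in>{0..<1}. x \<noteq> x\<^sub>0 \<longrightarrow> V x < V x\<^sub>0) \<longrightarrow>
            (\<forall>\<nu>. mather_measure V \<Phi> \<nu> \<longleftrightarrow> \<nu> = return circle x\<^sub>0) \<and>
            critical_value V \<Phi> = (SUP x\<in>{0..<1}. V x) \<and>
            (\<lambda>k. \<Sum>x\<in>grid k. V x * \<pi> k x) \<longlonglongrightarrow> V x\<^sub>0 \<and>
            (\<lambda>k. 1 / real k * lam k) \<longlonglongrightarrow> critical_value V \<Phi> \<and>
            (\<lambda>k. 1 / real k * gibbs_entropy k (PV k) (P k)) \<longlonglongrightarrow> V x\<^sub>0 - critical_value V \<Phi> \<and>
            V x\<^sub>0 - critical_value V \<Phi> = 0)"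
proof -
  have per: "\<And>x. V (x + 1) = V x" and cont: "\<And>x. isCont V x"
    using V unfolding C2_on_circle_def by (blast, meson DERIV_isCont)
  have gs: "ground_state k V (lam k) (u k)" if "k \<ge> 1" for k
    using perron[OF that] that by unfold_locales (auto simp: perron_triple_def)
  have gb: "gibbs k V (lam k) (u k) (\<pi> k) (PV k) (P k)" if k: "k \<ge> 1" for k
    by (intro gibbs.intro gibbs_axioms.intro gs k cont stationary gibbs_law free_law)
  have ent: "gibbs_entropy k (PV k) (P k) = - ((\<Sum>x\<in>grid k. real k * V x * \<pi> k x) - lam k)" if "k \<ge> 1" for k
    by (rule gibbs.gibbs_entropy_eq[OF gb[OF that]])
  have part1: "(\<forall>T\<ge>0. absolutely_continuous (restr_to_subalg (P k) (path_sigma_upto k T))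
                                          (restr_to_subalg (PV k) (path_sigma_upto k T)) \<and>
                    integrable (PV k) (\<lambda>\<omega>. ln (density_upto k (PV k) (P k) T \<omega>))) \<and>
            ((\<lambda>T. 1 / T * entropy_upto k (PV k) (P k) T) \<longlongrightarrow> gibbs_entropy k (PV k) (P k)) at_top \<and>
            gibbs_entropy k (PV k) (P k) = - ((\<Sum>x\<in>grid k. real k * V x * \<pi> k x) - lam k)"
    if k: "k \<ge> 1" for k
    using gibbs.restricted_absolutely_continuous[OF gb[OF k]] gibbs.ln_density_integrable[OF gb[OF k]]
      gibbs.entropy_tendsto[OF gb[OF k]] ent[OF k] by blast
  have part2: "(\<forall>\<nu>. mather_measure V \<Phi> \<nu> \<longleftrightarrow> \<nu> = return circle x\<^sub>0) \<and>
            critical_value V \<Phi> = (SUP x\<in>{0..<1}. V x) \<and>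
            (\<lambda>k. \<Sum>x\<in>grid k. V x * \<pi> k x) \<longlonglongrightarrow> V x\<^sub>0 \<and>
            (\<lambda>k. 1 / real k * lam k) \<longlonglongrightarrow> critical_value V \<Phi> \<and>
            (\<lambda>k. 1 / real k * gibbs_entropy k (PV k) (P k)) \<longlonglongrightarrow> V x\<^sub>0 - critical_value V \<Phi> \<and>
            V x\<^sub>0 - critical_value V \<Phi> = 0"
    if x0: "x\<^sub>0 \<in> {0..<1}" and strict: "\<forall>x\<in>{0..<1}. x \<noteq> x\<^sub>0 \<longrightarrow> V x < V x\<^sub>0" for x\<^sub>0
  proof -
    interpret unique_maximum V x\<^sub>0 \<Phi>
      using V \<Phi> x0 strict by unfold_locales auto
    have mean: "(\<lambda>k. \<Sum>x\<in>grid k. V x * \<pi> k x) \<longlonglongrightarrow> V x\<^sub>0"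
      by (rule mean_potential_tendsto[OF gs stationary per cont le_max])
    have eigv: "(\<lambda>k. 1 / real k * lam k) \<longlonglongrightarrow> V x\<^sub>0"
      by (rule scaled_eigenvalue_tendsto[OF gs per cont le_max])
    have "(\<lambda>k. 1 / real k * lam k - (\<Sum>x\<in>grid k. V x * \<pi> k x)) \<longlonglongrightarrow> V x\<^sub>0 - V x\<^sub>0"
      by (intro tendsto_diff mean eigv)
    moreover have "\<forall>\<^sub>F k in sequentially. 1 / real k * lam k - (\<Sum>x\<in>grid k. V x * \<pi> k x)
        = 1 / real k * gibbs_entropy k (PV k) (P k)"
      using eventually_ge_at_top[of 1]
    proof eventually_elim
      case (elim k)
      have "(\<Sum>x\<in>grid k. real k * V x * \<pi> k x) = real k * (\<Sum>x\<in>grid k. V x * \<pi> k x)"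
        by (simp add: sum_distrib_left mult.assoc)
      then show ?case using elim by (simp add: ent field_simps)
    qed
    ultimately have "(\<lambda>k. 1 / real k * gibbs_entropy k (PV k) (P k)) \<longlonglongrightarrow> V x\<^sub>0 - V x\<^sub>0"
      by (rule Lim_transform_eventually)
    then show ?thesis
      using mather_measure_iff mean eigv by (simp add: critical_value_eq sup_potential)
  qed
  show ?thesis using part1 part2 by blast
qed

end
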